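(* Let $P$ and $Q$ be a well fed program and a well fed query, and let $P'$ and $Q'$ be a robustly typed program and a robustly typed query corresponding to $P$ and $Q$. If every LD-derivation of $P'\cup\{Q'\}$ is finite, then every left-based derivation of $P\cup\{Q\}$ is finite.
   Context: Basics. A query is a finite sequence of atoms; a clause is $h\leftarrow B$ with $h$ an atom and $B$ a query. Every predicate has a fixed mode, i.e. each argument position is either input or output; $p(\mathbf s,\mathbf t)$ denotes an atom with $\mathbf s$ (resp. $\mathbf t$) the vector of terms filling the input (resp. output) positions. In clause heads $p(\mathbf t_0,\mathbf s_{n+1})$, $\mathbf t_0$ is the input and $\mathbf s_{n+1}$ the output. A syntactic object is linear if each variable occurs in it at most once. A clause is input-linear if the vector of input terms of its head is linear; a program is input-linear if all its clauses are and it does not use the equality predicate $=$ with both arguments input. A flat term is a variable or a term $f(x_1,\dots,x_n)$, $n\ge 0$, with distinct variables $x_i$. A permutation $\pi$ on $\{1,\dots,n\}$ is extended by $\pi(i)=i$ outside $\{1,\dots,n\}$, and $\pi(o_1,\dots,o_n)=o_{\pi^{-1}(1)},\dots,o_{\pi^{-1}(n)}$. Types. A type is a set of terms closed under instantiation. The variable type is the type that contains variables and hence all terms; any other type is a non-variable type. Each argument position of each predicate has an associated type. $t:T$ means $t\in T$ (componentwise for vectors); $\models \varphi\Rightarrow \mathbf t:\mathbf T$ means that the implication holds after applying any substitution to all terms. A term is type-consistent (in a position of type $T$) if some instance of it is in $T$. Nicely moded. $Q=p_1(\mathbf s_1,\mathbf t_1),\dots,p_n(\mathbf s_n,\mathbf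 t_n)$ is $\pi$-nicely moded if $\mathbf t_1,\dots,\mathbf t_n$ is linear and for all $i$, $vars(\mathbf s_i)\cap\bigcup_{\pi(i)\le\pi(j)\le n}vars(\mathbf t_j)=\emptyset$. A clause $p(\mathbf t_0,\mathbf s_{n+1})\leftarrow Q$ is $\pi$-nicely moded if $Q$ is and $vars(\mathbf t_0)\cap\bigcup_{j=1}^n vars(\mathbf t_j)=\emptyset$. Well typed. With $p_i(\mathbf S_i,\mathbf T_i)$ the type of $p_i$, $Q$ is $\pi$-well typed if for all $i\in\{1,\dots,n\}$, $\models(\bigwedge_{1\le\pi(j)<\pi(i)}\mathbf t_j:\mathbf T_j)\Rightarrow\mathbf s_i:\mathbf S_i$. A clause $p(\mathbf t_0,\mathbf s_{n+1})\leftarrow Q$, with $p(\mathbf T_0,\mathbf S_{n+1})$ the type of $p$, is $\pi$-well typed if for all $i\in\{1,\dots,n+1\}$, $\models(\bigwedge_{0\le\pi(j)<\pi(i)}\mathbf t_j:\mathbf T_j)\Rightarrow\mathbf s_i:\mathbf S_i$. A program is permutation well typed if each clause is $\pi$-well typed for some $\pi$. Bound/free (relative to a permutation well typed program $P$). An input position of $p$ is bound if some clause head $p(\dots)$ in $P$ has a non-variable term there; an output position of $p$ is bound if some body atom $p(\dots)$ in $P$ has a non-variable term there; otherwise the position is free. $\mathbf r^{\sf f},\mathbf r^{\sf b}$ are the projections of $\mathbf r$ onto its free/bound positions. Robustly typed (relative to a permutation well typed program $P$ whose bound positions are of non-variable type). $Q$ is $\pi$-robustly typed if it is $\pi$-nicely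 moded and $\pi$-well typed, $\mathbf t_1^{\sf f},\dots,\mathbf t_n^{\sf f}$ is a vector of variables and $\mathbf t_1^{\sf b},\dots,\mathbf t_n^{\sf b}$ a vector of flat type-consistent terms. A clause $p(\mathbf t_0,\mathbf s_{n+1})\leftarrow Q$ is $\pi$-robustly typed if it is $\pi$-nicely moded and $\pi$-well typed; $\mathbf t_0^{\sf f},\dots,\mathbf t_n^{\sf f}$ is a vector of variables and $\mathbf t_0^{\sf b},\dots,\mathbf t_n^{\sf b}$ a vector of flat type-consistent terms; and if a position of type $\tau$ in $\mathbf s_{n+1}^{\sf b}$ is filled with a variable $x$, then $x$ also fills a position of type $\tau$ in $\mathbf t_0^{\sf b},\dots,\mathbf t_n^{\sf b}$. "Permutation robustly typed" means $\pi$-robustly typed for some $\pi$ (for each clause, for programs); "robustly typed" means this with $\pi$ the identity. If $Q$ is $\pi$-robustly typed, then $\pi(Q)$ is a robustly typed query corresponding to $Q$; if a clause $h\leftarrow B$ is $\pi$-robustly typed, then $h\leftarrow\pi(B)$ is a robustly typed clause corresponding to it; a robustly typed program corresponding to $P$ is obtained from $P$ by replacing every clause with a robustly typed clause corresponding to it. Derivations. A program consists of clauses and, for each predicate $p/n$, a block declaration: a (possibly empty) set of atoms $p(b_1,\dots,b_n)$ with $b_i\in\{?,-\}$. An atom $p(t_1,\dots,t_n)$ is blocked if for some $p(b_1,\dots,b_n)$ in the declaration, $t_i$ is a variable for all $i$ with $b_i=-$; otherwise it is selectable. In a derivation step a query $Q_1,a,Q_2$ is replaced by $(Q_1,B,Q_2)\theta$,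 where $h\leftarrow B$ is a variant, renamed apart, of a program clause and $\theta$ is the most general unifier of the selected atom $a$ and $h$. A derivation of $P\cup\{Q\}$ is a (finite or infinite) sequence of such steps starting at $Q$. An LD-derivation is a derivation in which the selected atom is always the leftmost atom. A delay-respecting derivation is one in which the selected atom is always selectable. In a step, the atoms of $B\theta$ are direct descendants of $a$, and $b\theta$ is a direct descendant of $b$ for $b$ in $Q_1,Q_2$; "descendant" is the reflexive transitive closure. In a delay-respecting derivation, if $Q_i=R_1,R_2$ where $R_1$ contains no selectable atom, then every descendant of every atom in $R_1$ is waiting. A delay-respecting derivation is left-based if in each step $Q_i;Q_{i+1}$ the selected atom is waiting in $Q_i$ or is the leftmost selectable atom in $Q_i$. Input selectability. A permutation robustly typed program $P$ has input selectability if every atom (using a predicate of $P$) that has variables in all free output positions is selectable in $P$ (1) only if it is non-variable in all bound input positions, and (2) if it is non-variable in all input positions of non-variable type. Robust. For a permutation robustly typed, input-linear program $P$ with input selectability, a predicate $p$ is robust if for each robustly typed query $p(\mathbf s,\mathbf t)$ consisting of one atom, every delay-respecting derivation of $P\cup\{p(\mathbf s,\mathbf t)\}$ is finite. Depends on. $p$ refers to $q$ if some clause of $P$ has $p$ in its head and $q$ in its body; $p\sqsupseteq q$ is the reflexive transitive closure of this relation. Well fed. $i$ is a safe position for $\pi$ if for all $j$, $\pi(j)<\pi(i)$ implies $j<i$. A $\pi$-robustly typed query is well fed if for each of its atoms $p(\mathbf s,\mathbf t)$, either this atom is in a safe position for $\pi$, or all predicates $q$ with $p\sqsupseteq q$ are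 robust. A clause is well fed if its body is. A program is well fed if all its clauses are well fed and input-linear, and it has input selectability.
   Formalization: Types are assumed nonempty, since with an empty type the claim fails (a predicate can then be vacuously robust); "corresponding" is taken for the same permutations for which P and Q are well fed. *)

theory Defs
  imports
    "HOL-Library.Extended_Nat"
    "HOL-Library.Infinite_Typeclass"
    "HOL-Combinatorics.Permutations"
begin

section \<open>Terms, atoms, queries and clauses\<close>

text \<open>
  A function symbol is identified by its name together with its number of arguments.
  Substitutions are total functions on variables.
\<close>

datatype ('f, 'v) trm = Var 'v | Fun 'f "('f, 'v) trm list"

type_synonym ('f, 'v) subst = "'v \<Rightarrow> ('f, 'v) trm"

fun subst_trm :: "('f, 'v) subst \<Rightarrow> ('f, 'v) trm \<Rightarrow> ('f, 'v) trm" where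
  "subst_trm \<sigma> (Var x) = \<sigma> x"
| "subst_trm \<sigma> (Fun f ts) = Fun f (map (subst_trm \<sigma>) ts)"

text \<open>All variable occurrences of a term, from left to right.\<close>

fun occs :: "('f, 'v) trm \<Rightarrow> 'v list" where
  "occs (Var x) = [x]"
| "occs (Fun f ts) = concat (map occs ts)"

definition is_var :: "('f, 'v) trm \<Rightarrow> bool" where
  "is_var t \<longleftrightarrow> (\<exists>x. t = Var x)"

definition vars_trms :: "('f, 'v) trm list \<Rightarrow> 'v set" where
  "vars_trms ts = (\<Union>t\<in>set ts. set (occs t))"

definition linear :: "('f, 'v) trm list \<Rightarrow> bool" where
  "linear ts \<longleftrightarrow> distinct (concat (map occs ts))"

definition flat :: "('f, 'v) trm \<Rightarrow> bool" where
  "flat t \<longleftrightarrow> is_var t \<or> (\<exists>f xs. t = Fun f (map Var xs) \<and> distinct xs)"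

datatype ('p, 'f, 'v) atom = Atom (pred: 'p) (args: "('f, 'v) trm list")

type_synonym ('p, 'f, 'v) query = "('p, 'f, 'v) atom list"

datatype ('p, 'f, 'v) clause =
  Clause (head: "('p, 'f, 'v) atom") (body: "('p, 'f, 'v) query")

definition subst_atom :: "('f, 'v) subst \<Rightarrow> ('p, 'f, 'v) atom \<Rightarrow> ('p, 'f, 'v) atom" where
  "subst_atom \<sigma> a = Atom (pred a) (map (subst_trm \<sigma>) (args a))"

definition subst_query :: "('f, 'v) subst \<Rightarrow> ('p, 'f, 'v) query \<Rightarrow> ('p, 'f, 'v) query" where
  "subst_query \<sigma> Q = map (subst_atom \<sigma>) Q"

definition subst_clause :: "('f, 'v) subst \<Rightarrow> ('p, 'f, 'v) clause \<Rightarrow> ('p, 'f, 'v) clause" where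
  "subst_clause \<sigma> c = Clause (subst_atom \<sigma> (head c)) (subst_query \<sigma> (body c))"

definition vars_query :: "('p, 'f, 'v) query \<Rightarrow> 'v set" where
  "vars_query Q = (\<Union>a\<in>set Q. vars_trms (args a))"

definition vars_clause :: "('p, 'f, 'v) clause \<Rightarrow> 'v set" where
  "vars_clause c = vars_query (head c # body c)"

definition variant :: "('p, 'f, 'v) clause \<Rightarrow> ('p, 'f, 'v) clause \<Rightarrow> bool" where
  "variant c d \<longleftrightarrow> (\<exists>\<sigma> \<tau>. c = subst_clause \<sigma> d \<and> d = subst_clause \<tau> c)"

definition unifier :: "('f, 'v) subst \<Rightarrow> ('p, 'f, 'v) atom \<Rightarrow> ('p, 'f, 'v) atom \<Rightarrow> bool" where
  "unifier \<sigma> a b \<longleftrightarrow> subst_atom \<sigma> a = subst_atom \<sigma> b"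

definition is_mgu :: "('f, 'v) subst \<Rightarrow> ('p, 'f, 'v) atom \<Rightarrow> ('p, 'f, 'v) atom \<Rightarrow> bool" where
  "is_mgu \<theta> a b \<longleftrightarrow> unifier \<theta> a b \<and>
     (\<forall>\<sigma>. unifier \<sigma> a b \<longrightarrow> (\<exists>\<tau>. \<forall>x. \<sigma> x = subst_trm \<tau> (\<theta> x)))"


section \<open>Types\<close>

text \<open>
  Types are required to be nonempty, so that a variable is type-consistent in every position.
\<close>

definition is_type :: "('f, 'v) trm set \<Rightarrow> bool" where
  "is_type T \<longleftrightarrow> T \<noteq> {} \<and> (\<forall>t\<in>T. \<forall>\<sigma>. subst_trm \<sigma> t \<in> T)"

definition variable_type :: "('f, 'v) trm set \<Rightarrow> bool" where
  "variable_type T \<longleftrightarrow> (\<exists>x. Var x \<in> T)"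

definition type_consistent :: "('f, 'v) trm set \<Rightarrow> ('f, 'v) trm \<Rightarrow> bool" where
  "type_consistent T t \<longleftrightarrow> (\<exists>\<sigma>. subst_trm \<sigma> t \<in> T)"


section \<open>Programs\<close>

datatype io = In | Out

text \<open>\<open>Any\<close> and \<open>Dash\<close> are the marks ? and - of block declarations.\<close>

datatype bmark = Any | Dash

text \<open>
  A program comes with its predicates and their modes and types; argument positions are counted
  from 0. The field \<open>eq_pred\<close> names the equality predicate (irrelevant if not among \<open>preds\<close>).
  Clauses are the only means of resolving an atom, for the equality predicate as well.
\<close>

record ('p, 'f, 'v) program =
  preds :: "'p set"
  mode :: "'p \<Rightarrow> io list"
  ptype :: "'p \<Rightarrow> ('f, 'v) trm set list"
  eq_pred :: 'p
  clauses :: "('p, 'f, 'v) clause set"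
  block :: "'p \<Rightarrow> bmark list set"

definition wf_atom :: "('p, 'f, 'v) program \<Rightarrow> ('p, 'f, 'v) atom \<Rightarrow> bool" where
  "wf_atom P a \<longleftrightarrow> pred a \<in> preds P \<and> length (args a) = length (mode P (pred a))"

definition wf_query :: "('p, 'f, 'v) program \<Rightarrow> ('p, 'f, 'v) query \<Rightarrow> bool" where
  "wf_query P Q \<longleftrightarrow> (\<forall>a\<in>set Q. wf_atom P a)"

definition wf_program :: "('p, 'f, 'v) program \<Rightarrow> bool" where
  "wf_program P \<longleftrightarrow>
     finite (clauses P) \<and>
     (\<forall>c\<in>clauses P. wf_query P (head c # body c)) \<and>
     (\<forall>p\<in>preds P.
        length (ptype P p) = length (mode P p) \<and>
        (\<forall>T\<in>set (ptype P p). is_type T) \<and>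
        (\<forall>bs\<in>block P p. length bs = length (mode P p))) \<and>
     (eq_pred P \<in> preds P \<longrightarrow> length (mode P (eq_pred P)) = 2)"

definition in_pos :: "('p, 'f, 'v) program \<Rightarrow> 'p \<Rightarrow> nat set" where
  "in_pos P p = {k. k < length (mode P p) \<and> mode P p ! k = In}"

definition out_pos :: "('p, 'f, 'v) program \<Rightarrow> 'p \<Rightarrow> nat set" where
  "out_pos P p = {k. k < length (mode P p) \<and> mode P p ! k = Out}"

definition inputs :: "('p, 'f, 'v) program \<Rightarrow> ('p, 'f, 'v) atom \<Rightarrow> ('f, 'v) trm list" where
  "inputs P a = [args a ! k. k \<leftarrow> [0..<length (args a)], k \<in> in_pos P (pred a)]"

definition outputs :: "('p, 'f, 'v) program \<Rightarrow> ('p, 'f, 'v) atom \<Rightarrow> ('f, 'v) trm list" where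
  "outputs P a = [args a ! k. k \<leftarrow> [0..<length (args a)], k \<in> out_pos P (pred a)]"

definition inputs_typed :: "('p, 'f, 'v) program \<Rightarrow> ('p, 'f, 'v) atom \<Rightarrow> bool" where
  "inputs_typed P a \<longleftrightarrow> (\<forall>k\<in>in_pos P (pred a). args a ! k \<in> ptype P (pred a) ! k)"

definition outputs_typed :: "('p, 'f, 'v) program \<Rightarrow> ('p, 'f, 'v) atom \<Rightarrow> bool" where
  "outputs_typed P a \<longleftrightarrow> (\<forall>k\<in>out_pos P (pred a). args a ! k \<in> ptype P (pred a) ! k)"

definition input_linear_clause :: "('p, 'f, 'v) program \<Rightarrow> ('p, 'f, 'v) clause \<Rightarrow> bool" where
  "input_linear_clause P c \<longleftrightarrow> linear (inputs P (head c))"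

definition input_linear :: "('p, 'f, 'v) program \<Rightarrow> bool" where
  "input_linear P \<longleftrightarrow>
     (\<forall>c\<in>clauses P. input_linear_clause P c) \<and>
     \<not> (mode P (eq_pred P) = [In, In] \<and>
        (\<exists>c\<in>clauses P. eq_pred P \<in> pred ` set (head c # body c)))"


section \<open>Permutation nicely moded, well typed and robustly typed queries and clauses\<close>

text \<open>
  Atoms of a query are counted from 1. A permutation of the positions of \<open>Q\<close> is a function with
  \<open>\<pi> permutes {1..length Q}\<close>, which is the identity outside of this set; in a clause, position 0
  belongs to the input of the head and position \<open>length (body c) + 1\<close> to its output.
\<close>

definition nth1 :: "'a list \<Rightarrow> nat \<Rightarrow> 'a" where
  "nth1 xs i = xs ! (i - 1)"

definition permute :: "(nat \<Rightarrow> nat) \<Rightarrow> 'a list \<Rightarrow> 'a list" where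
  "permute \<pi> xs = map (\<lambda>i. nth1 xs (inv \<pi> i)) [1..<Suc (length xs)]"

definition nicely_moded_query ::
  "('p, 'f, 'v) program \<Rightarrow> (nat \<Rightarrow> nat) \<Rightarrow> ('p, 'f, 'v) query \<Rightarrow> bool" where
  "nicely_moded_query P \<pi> Q \<longleftrightarrow>
     linear (concat (map (outputs P) Q)) \<and>
     (\<forall>i\<in>{1..length Q}. \<forall>j\<in>{1..length Q}. \<pi> i \<le> \<pi> j \<longrightarrow>
        vars_trms (inputs P (nth1 Q i)) \<inter> vars_trms (outputs P (nth1 Q j)) = {})"

definition nicely_moded_clause ::
  "('p, 'f, 'v) program \<Rightarrow> (nat \<Rightarrow> nat) \<Rightarrow> ('p, 'f, 'v) clause \<Rightarrow> bool" where
  "nicely_moded_clause P \<pi> c \<longleftrightarrow>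
     nicely_moded_query P \<pi> (body c) \<and>
     (\<forall>b\<in>set (body c). vars_trms (inputs P (head c)) \<inter> vars_trms (outputs P b) = {})"

definition well_typed_query ::
  "('p, 'f, 'v) program \<Rightarrow> (nat \<Rightarrow> nat) \<Rightarrow> ('p, 'f, 'v) query \<Rightarrow> bool" where
  "well_typed_query P \<pi> Q \<longleftrightarrow>
     (\<forall>i\<in>{1..length Q}. \<forall>\<sigma>.
        (\<forall>j\<in>{1..length Q}. \<pi> j < \<pi> i \<longrightarrow> outputs_typed P (subst_atom \<sigma> (nth1 Q j))) \<longrightarrow>
        inputs_typed P (subst_atom \<sigma> (nth1 Q i)))"

text \<open>The two conjuncts are the cases \<open>i \<le> n\<close> and \<open>i = n + 1\<close> of the definition.\<close>

definition well_typed_clause ::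
  "('p, 'f, 'v) program \<Rightarrow> (nat \<Rightarrow> nat) \<Rightarrow> ('p, 'f, 'v) clause \<Rightarrow> bool" where
  "well_typed_clause P \<pi> c \<longleftrightarrow>
     (\<forall>i\<in>{1..length (body c)}. \<forall>\<sigma>.
        inputs_typed P (subst_atom \<sigma> (head c)) \<and>
        (\<forall>j\<in>{1..length (body c)}. \<pi> j < \<pi> i \<longrightarrow>
           outputs_typed P (subst_atom \<sigma> (nth1 (body c) j))) \<longrightarrow>
        inputs_typed P (subst_atom \<sigma> (nth1 (body c) i))) \<and>
     (\<forall>\<sigma>.
        inputs_typed P (subst_atom \<sigma> (head c)) \<and>
        (\<forall>j\<in>{1..length (body c)}. outputs_typed P (subst_atom \<sigma> (nth1 (body c) j))) \<longrightarrow>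
        outputs_typed P (subst_atom \<sigma> (head c)))"

definition permutation_well_typed :: "('p, 'f, 'v) program \<Rightarrow> bool" where
  "permutation_well_typed P \<longleftrightarrow>
     (\<forall>c\<in>clauses P. \<exists>\<pi>. \<pi> permutes {1..length (body c)} \<and> well_typed_clause P \<pi> c)"

definition bound :: "('p, 'f, 'v) program \<Rightarrow> 'p \<Rightarrow> nat \<Rightarrow> bool" where
  "bound P p k \<longleftrightarrow>
     k \<in> in_pos P p \<and>
       (\<exists>c\<in>clauses P. pred (head c) = p \<and> \<not> is_var (args (head c) ! k)) \<or>
     k \<in> out_pos P p \<and>
       (\<exists>c\<in>clauses P. \<exists>b\<in>set (body c). pred b = p \<and> \<not> is_var (args b ! k))"

definition robust_position :: "('p, 'f, 'v) program \<Rightarrow> ('p, 'f, 'v) atom \<Rightarrow> nat \<Rightarrow> bool" where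
  "robust_position P a k \<longleftrightarrow>
     (if bound P (pred a) k
      then flat (args a ! k) \<and> type_consistent (ptype P (pred a) ! k) (args a ! k)
      else is_var (args a ! k))"

definition robustly_typed_query ::
  "('p, 'f, 'v) program \<Rightarrow> (nat \<Rightarrow> nat) \<Rightarrow> ('p, 'f, 'v) query \<Rightarrow> bool" where
  "robustly_typed_query P \<pi> Q \<longleftrightarrow>
     wf_query P Q \<and> \<pi> permutes {1..length Q} \<and>
     nicely_moded_query P \<pi> Q \<and> well_typed_query P \<pi> Q \<and>
     (\<forall>a\<in>set Q. \<forall>k\<in>out_pos P (pred a). robust_position P a k)"

definition robustly_typed_clause ::
  "('p, 'f, 'v) program \<Rightarrow> (nat \<Rightarrow> nat) \<Rightarrow> ('p, 'f, 'v) clause \<Rightarrow> bool" where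
  "robustly_typed_clause P \<pi> c \<longleftrightarrow>
     \<pi> permutes {1..length (body c)} \<and>
     nicely_moded_clause P \<pi> c \<and> well_typed_clause P \<pi> c \<and>
     (\<forall>k\<in>in_pos P (pred (head c)). robust_position P (head c) k) \<and>
     (\<forall>b\<in>set (body c). \<forall>k\<in>out_pos P (pred b). robust_position P b k) \<and>
     (\<forall>k\<in>out_pos P (pred (head c)). \<forall>x.
        bound P (pred (head c)) k \<and> args (head c) ! k = Var x \<longrightarrow>
        (\<exists>l\<in>in_pos P (pred (head c)).
           bound P (pred (head c)) l \<and>
           ptype P (pred (head c)) ! l = ptype P (pred (head c)) ! k \<and>
           args (head c) ! l = Var x) \<or>
        (\<exists>b\<in>set (body c). \<exists>l\<in>out_pos P (pred b).
           bound P (pred b) l \<and>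
           ptype P (pred b) ! l = ptype P (pred (head c)) ! k \<and>
           args b ! l = Var x))"

text \<open>\<open>\<rho>\<close> assigns to every clause the permutation for which it is considered.\<close>

definition permutation_robustly_typed ::
  "(('p, 'f, 'v) clause \<Rightarrow> nat \<Rightarrow> nat) \<Rightarrow> ('p, 'f, 'v) program \<Rightarrow> bool" where
  "permutation_robustly_typed \<rho> P \<longleftrightarrow>
     wf_program P \<and> permutation_well_typed P \<and>
     (\<forall>p\<in>preds P. \<forall>k. bound P p k \<longrightarrow> \<not> variable_type (ptype P p ! k)) \<and>
     (\<forall>c\<in>clauses P. robustly_typed_clause P (\<rho> c) c)"

definition corresponding_query ::
  "('p, 'f, 'v) program \<Rightarrow> (nat \<Rightarrow> nat) \<Rightarrow> ('p, 'f, 'v) query \<Rightarrow> ('p, 'f, 'v) query \<Rightarrow> bool" where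
  "corresponding_query P \<pi> Q Q' \<longleftrightarrow> robustly_typed_query P \<pi> Q \<and> Q' = permute \<pi> Q"

definition corresponding_program ::
  "(('p, 'f, 'v) clause \<Rightarrow> nat \<Rightarrow> nat) \<Rightarrow> ('p, 'f, 'v) program \<Rightarrow> ('p, 'f, 'v) program \<Rightarrow> bool" where
  "corresponding_program \<rho> P P' \<longleftrightarrow>
     permutation_robustly_typed \<rho> P \<and>
     P' = P\<lparr>clauses := (\<lambda>c. Clause (head c) (permute (\<rho> c) (body c))) ` clauses P\<rparr>"


section \<open>Derivations\<close>

definition blocked :: "('p, 'f, 'v) program \<Rightarrow> ('p, 'f, 'v) atom \<Rightarrow> bool" where
  "blocked P a \<longleftrightarrow>
     (\<exists>bs\<in>block P (pred a). \<forall>k<length bs. bs ! k = Dash \<longrightarrow> is_var (args a ! k))"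

definition selectable :: "('p, 'f, 'v) program \<Rightarrow> ('p, 'f, 'v) atom \<Rightarrow> bool" where
  "selectable P a \<longleftrightarrow> \<not> blocked P a"

text \<open>
  One resolution step on the atom at position \<open>k\<close> (counted from 0), where \<open>c\<close> is the input clause.
  Since \<open>\<theta>\<close> may be any most general unifier, the resolvent is determined up to renaming.
\<close>

definition resolution_step ::
  "('p, 'f, 'v) program \<Rightarrow> ('p, 'f, 'v) query \<Rightarrow> nat \<Rightarrow> ('p, 'f, 'v) clause \<Rightarrow> ('f, 'v) subst \<Rightarrow>
   ('p, 'f, 'v) query \<Rightarrow> bool" where
  "resolution_step P Q k c \<theta> Q' \<longleftrightarrow>
     k < length Q \<and>
     (\<exists>d\<in>clauses P. variant c d) \<and>
     vars_clause c \<inter> vars_query Q = {} \<and>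
     is_mgu \<theta> (Q ! k) (head c) \<and>
     Q' = subst_query \<theta> (take k Q @ body c @ drop (Suc k) Q)"

text \<open>
  \<open>steps D\<close> is the number of steps, infinite if \<open>D\<close> is infinite; step \<open>i\<close> leads from
  \<open>qry D i\<close> to \<open>qry D (Suc i)\<close> and the other fields only matter for \<open>i < steps D\<close>.
\<close>

record ('p, 'f, 'v) derivation =
  steps :: enat
  qry :: "nat \<Rightarrow> ('p, 'f, 'v) query"
  sel :: "nat \<Rightarrow> nat"
  cls :: "nat \<Rightarrow> ('p, 'f, 'v) clause"
  sub :: "nat \<Rightarrow> ('f, 'v) subst"

definition derivation ::
  "('p, 'f, 'v) program \<Rightarrow> ('p, 'f, 'v) query \<Rightarrow> ('p, 'f, 'v) derivation \<Rightarrow> bool" where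
  "derivation P Q D \<longleftrightarrow>
     qry D 0 = Q \<and>
     (\<forall>i. enat i < steps D \<longrightarrow>
        resolution_step P (qry D i) (sel D i) (cls D i) (sub D i) (qry D (Suc i)))"

definition finite_derivation :: "('p, 'f, 'v) derivation \<Rightarrow> bool" where
  "finite_derivation D \<longleftrightarrow> steps D \<noteq> \<infinity>"

definition LD_derivation ::
  "('p, 'f, 'v) program \<Rightarrow> ('p, 'f, 'v) query \<Rightarrow> ('p, 'f, 'v) derivation \<Rightarrow> bool" where
  "LD_derivation P Q D \<longleftrightarrow> derivation P Q D \<and> (\<forall>i. enat i < steps D \<longrightarrow> sel D i = 0)"

definition delay_respecting ::
  "('p, 'f, 'v) program \<Rightarrow> ('p, 'f, 'v) query \<Rightarrow> ('p, 'f, 'v) derivation \<Rightarrow> bool" where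
  "delay_respecting P Q D \<longleftrightarrow>
     derivation P Q D \<and>
     (\<forall>i. enat i < steps D \<longrightarrow> selectable P (qry D i ! sel D i))"

text \<open>
  Atom occurrences in a derivation are pairs \<open>(i, k)\<close>, standing for \<open>qry D i ! k\<close>; the relation
  holds if the second occurrence is a direct descendant of the first. An atom to the right of the
  selected one is shifted by the number of body atoms minus 1.
\<close>

definition direct_descendant ::
  "('p, 'f, 'v) derivation \<Rightarrow> nat \<times> nat \<Rightarrow> nat \<times> nat \<Rightarrow> bool" where
  "direct_descendant D = (\<lambda>(i, k) (j, l).
     enat i < steps D \<and> k < length (qry D i) \<and> j = Suc i \<and>
     (k < sel D i \<and> l = k \<or>
      k = sel D i \<and> k \<le> l \<and> l < k + length (body (cls D i)) \<or>
      sel D i < k \<and> Suc l = k + length (body (cls D i))))"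

definition descendant ::
  "('p, 'f, 'v) derivation \<Rightarrow> nat \<times> nat \<Rightarrow> nat \<times> nat \<Rightarrow> bool" where
  "descendant D = (direct_descendant D)\<^sup>*\<^sup>*"

definition waiting ::
  "('p, 'f, 'v) program \<Rightarrow> ('p, 'f, 'v) derivation \<Rightarrow> nat \<times> nat \<Rightarrow> bool" where
  "waiting P D o' \<longleftrightarrow>
     (\<exists>i R1 R2 k. enat i \<le> steps D \<and> qry D i = R1 @ R2 \<and>
        (\<forall>a\<in>set R1. \<not> selectable P a) \<and> k < length R1 \<and> descendant D (i, k) o')"

definition leftmost_selectable ::
  "('p, 'f, 'v) program \<Rightarrow> ('p, 'f, 'v) query \<Rightarrow> nat \<Rightarrow> bool" where
  "leftmost_selectable P Q k \<longleftrightarrow>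
     k < length Q \<and> selectable P (Q ! k) \<and> (\<forall>l<k. \<not> selectable P (Q ! l))"

definition left_based ::
  "('p, 'f, 'v) program \<Rightarrow> ('p, 'f, 'v) query \<Rightarrow> ('p, 'f, 'v) derivation \<Rightarrow> bool" where
  "left_based P Q D \<longleftrightarrow>
     delay_respecting P Q D \<and>
     (\<forall>i. enat i < steps D \<longrightarrow>
        waiting P D (i, sel D i) \<or> leftmost_selectable P (qry D i) (sel D i))"


section \<open>Well fed programs and queries\<close>

definition input_selectability :: "('p, 'f, 'v) program \<Rightarrow> bool" where
  "input_selectability P \<longleftrightarrow>
     (\<forall>a. wf_atom P a \<and>
        (\<forall>k\<in>out_pos P (pred a). \<not> bound P (pred a) k \<longrightarrow> is_var (args a ! k)) \<longrightarrow>
        (selectable P a \<longrightarrow>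
           (\<forall>k\<in>in_pos P (pred a). bound P (pred a) k \<longrightarrow> \<not> is_var (args a ! k))) \<and>
        ((\<forall>k\<in>in_pos P (pred a).
            \<not> variable_type (ptype P (pred a) ! k) \<longrightarrow> \<not> is_var (args a ! k)) \<longrightarrow>
         selectable P a))"

definition robust :: "('p, 'f, 'v) program \<Rightarrow> 'p \<Rightarrow> bool" where
  "robust P p \<longleftrightarrow>
     (\<forall>a D. pred a = p \<and> robustly_typed_query P id [a] \<and> delay_respecting P [a] D \<longrightarrow>
        finite_derivation D)"

definition refers_to :: "('p, 'f, 'v) program \<Rightarrow> 'p \<Rightarrow> 'p \<Rightarrow> bool" where
  "refers_to P p q \<longleftrightarrow> (\<exists>c\<in>clauses P. pred (head c) = p \<and> q \<in> pred ` set (body c))"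

definition depends_on :: "('p, 'f, 'v) program \<Rightarrow> 'p \<Rightarrow> 'p \<Rightarrow> bool" where
  "depends_on P = (refers_to P)\<^sup>*\<^sup>*"

definition safe_position :: "(nat \<Rightarrow> nat) \<Rightarrow> nat \<Rightarrow> bool" where
  "safe_position \<pi> i \<longleftrightarrow> (\<forall>j. \<pi> j < \<pi> i \<longrightarrow> j < i)"

text \<open>The condition shared by well fed queries and bodies of well fed clauses.\<close>

definition fed :: "('p, 'f, 'v) program \<Rightarrow> (nat \<Rightarrow> nat) \<Rightarrow> ('p, 'f, 'v) query \<Rightarrow> bool" where
  "fed P \<pi> Q \<longleftrightarrow>
     (\<forall>i\<in>{1..length Q}.
        safe_position \<pi> i \<or> (\<forall>q. depends_on P (pred (nth1 Q i)) q \<longrightarrow> robust P q))"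

definition well_fed_query ::
  "('p, 'f, 'v) program \<Rightarrow> (nat \<Rightarrow> nat) \<Rightarrow> ('p, 'f, 'v) query \<Rightarrow> bool" where
  "well_fed_query P \<pi> Q \<longleftrightarrow> robustly_typed_query P \<pi> Q \<and> fed P \<pi> Q"

definition well_fed_clause ::
  "('p, 'f, 'v) program \<Rightarrow> (nat \<Rightarrow> nat) \<Rightarrow> ('p, 'f, 'v) clause \<Rightarrow> bool" where
  "well_fed_clause P \<pi> c \<longleftrightarrow> robustly_typed_clause P \<pi> c \<and> fed P \<pi> (body c)"

definition well_fed_program ::
  "(('p, 'f, 'v) clause \<Rightarrow> nat \<Rightarrow> nat) \<Rightarrow> ('p, 'f, 'v) program \<Rightarrow> bool" where
  "well_fed_program \<rho> P \<longleftrightarrow>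
     permutation_robustly_typed \<rho> P \<and>
     (\<forall>c\<in>clauses P. well_fed_clause P (\<rho> c) c) \<and>
     input_linear P \<and> input_selectability P"

end

theory Submission
  imports Defs "HOL-Library.Sublist"
begin

text \<open>
  An infinite left-based derivation spans an infinite tree, in which the atoms are labelled so that
  the order for which the queries are robustly typed becomes the lexicographic order of the labels.
  Visiting this tree in lexicographic order yields an LD-derivation of the corresponding program, whose
  atoms are more general than the atoms of arbitrarily late stages of the given derivation. If it
  is infinite, the assumption is contradicted. Otherwise it reaches an atom which is never resolved in
  the given derivation; from some stage on this atom is the least one of the query, so it has correctly
  typed inputs and is selectable, and all steps take place below atoms in unsafe positions.

  Among these, there is a least atom with infinitely many steps below it. Steps only bind the outputs
  of the selected atom and thus propagate bindings to the right; since there are finitely many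
  steps to the left of that atom, its inputs may be instantiated in advance, to correctly typed
  terms, by the final values of the outputs on the left. The steps below it then form an infinite
  delay-respecting derivation from a single robustly typed atom, although its predicate is robust.
\<close>

section \<open>Substitutions\<close>

text \<open>The unifiers of a derivation are arbitrary most general ones, so a step may rename every
  variable and leave no atom literally unchanged. Each step is therefore compared with an idempotent
  unifier \<open>\<theta>0\<close>, built by matching, which moves only output variables of the
  selected atom and variables of the input clause. The actual unifier and \<open>\<theta>0\<close>
  are instances of each other, so statements about \<open>\<theta>0\<close> transfer up to renaming.

  The LD-derivation cannot copy the given one: bindings made by steps that it has not visited are
  missing from its queries. Generality is the relation that survives, because it still implies
  unifiability with the clause used at the node visited.

  Robustness speaks only of derivations that start from one robustly typed atom, while the inputs of
  the atom in question may be computed after steps below it have begun, or never. So they are read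
  off at a stage where the left side is finished, and outputs still open there get arbitrary values
  of their types. What remains to be shown is that inserting these values early disturbs no step
  below the atom.\<close>

lemma subst_trm_cong_iff:
  "subst_trm \<sigma> t = subst_trm \<tau> t \<longleftrightarrow> (\<forall>x\<in>set (occs t). \<sigma> x = \<tau> x)"
  by (induction t) auto

lemma subst_trm_cong:
  "(\<And>x. x \<in> set (occs t) \<Longrightarrow> \<sigma> x = \<tau> x) \<Longrightarrow> subst_trm \<sigma> t = subst_trm \<tau> t"
  by (simp add: subst_trm_cong_iff)

lemma subst_trm_Var [simp]: "subst_trm Var t = t"
  by (induction t) (auto simp: map_idI)

lemma subst_trm_subst_trm:
  "subst_trm \<tau> (subst_trm \<sigma> t) = subst_trm (\<lambda>x. subst_trm \<tau> (\<sigma> x)) t"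
  by (induction t) auto

lemma subst_trm_ident: "(\<And>x. x \<in> set (occs t) \<Longrightarrow> \<sigma> x = Var x) \<Longrightarrow> subst_trm \<sigma> t = t"
  using subst_trm_cong[of t \<sigma> Var] by simp

lemma set_occs_subst:
  "set (occs (subst_trm \<sigma> t)) = (\<Union>x\<in>set (occs t). set (occs (\<sigma> x)))"
  by (induction t) auto

lemma occs_rename: "occs (subst_trm (\<lambda>x. Var (f x)) t) = map f (occs t)"
proof (induction t)
  case (Fun g ts)
  then have "concat (map (occs \<circ> subst_trm (\<lambda>x. Var (f x))) ts) = concat (map (map f \<circ> occs) ts)"
    by (intro arg_cong[of _ _ concat]) auto
  then show ?case by (simp add: map_concat)
qed auto

lemma is_var_Var [simp]: "is_var (Var x)" and is_var_Fun [simp]: "\<not> is_var (Fun f ts)"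
  by (auto simp: is_var_def)

lemma is_var_substD: "is_var (subst_trm \<sigma> t) \<Longrightarrow> is_var t"
  by (cases t) auto

definition subst_comp :: "('f, 'v) subst \<Rightarrow> ('f, 'v) subst \<Rightarrow> ('f, 'v) subst" where
  "subst_comp \<sigma> \<tau> = (\<lambda>x. subst_trm \<tau> (\<sigma> x))"

lemma subst_trm_subst_comp: "subst_trm (subst_comp \<sigma> \<tau>) t = subst_trm \<tau> (subst_trm \<sigma> t)"
  by (simp add: subst_comp_def subst_trm_subst_trm)

definition avars :: "('p, 'f, 'v) atom \<Rightarrow> 'v set" where
  "avars a = vars_trms (args a)"

lemma pred_subst_atom [simp]: "pred (subst_atom \<sigma> a) = pred a"
  and args_subst_atom [simp]: "args (subst_atom \<sigma> a) = map (subst_trm \<sigma>) (args a)"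
  by (simp_all add: subst_atom_def)

lemma subst_atom_cong_iff:
  "subst_atom \<sigma> a = subst_atom \<tau> a \<longleftrightarrow> (\<forall>x\<in>avars a. \<sigma> x = \<tau> x)"
  by (cases a) (auto simp: subst_atom_def avars_def vars_trms_def subst_trm_cong_iff)

lemma subst_atom_cong:
  "(\<And>x. x \<in> avars a \<Longrightarrow> \<sigma> x = \<tau> x) \<Longrightarrow> subst_atom \<sigma> a = subst_atom \<tau> a"
  by (simp add: subst_atom_cong_iff)

lemma subst_atom_Var [simp]: "subst_atom Var a = a"
  by (cases a) (simp add: subst_atom_def map_idI)

lemma subst_atom_subst_atom:
  "subst_atom \<tau> (subst_atom \<sigma> a) = subst_atom (\<lambda>x. subst_trm \<tau> (\<sigma> x)) a"
  by (simp add: subst_atom_def subst_trm_subst_trm)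

lemma subst_atom_subst_comp: "subst_atom (subst_comp \<sigma> \<tau>) a = subst_atom \<tau> (subst_atom \<sigma> a)"
  by (simp add: subst_comp_def subst_atom_subst_atom)

lemma subst_atom_ident: "(\<And>x. x \<in> avars a \<Longrightarrow> \<sigma> x = Var x) \<Longrightarrow> subst_atom \<sigma> a = a"
  using subst_atom_cong[of a \<sigma> Var] by simp

lemma avars_subst: "avars (subst_atom \<sigma> a) = (\<Union>x\<in>avars a. set (occs (\<sigma> x)))"
  by (auto simp: avars_def vars_trms_def set_occs_subst)

lemma finite_avars [simp]: "finite (avars a)"
  by (simp add: avars_def vars_trms_def)

lemma vars_query_avars: "vars_query Q = (\<Union>a\<in>set Q. avars a)"
  by (simp add: vars_query_def avars_def)

lemma finite_vars_query [simp]: "finite (vars_query Q)"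
  by (simp add: vars_query_avars)

lemma vars_clause_avars: "vars_clause c = avars (head c) \<union> vars_query (body c)"
  by (simp add: vars_clause_def vars_query_avars)

lemma finite_vars_clause [simp]: "finite (vars_clause c)"
  by (simp add: vars_clause_avars)

lemma subst_clause_cong:
  "(\<And>x. x \<in> vars_clause c \<Longrightarrow> \<sigma> x = \<tau> x) \<Longrightarrow> subst_clause \<sigma> c = subst_clause \<tau> c"
  by (auto simp: subst_clause_def subst_query_def vars_clause_avars vars_query_avars
      intro!: subst_atom_cong)

lemma wf_atom_subst [simp]: "wf_atom P (subst_atom \<sigma> a) = wf_atom P a"
  by (simp add: wf_atom_def)


section \<open>Existence of most general unifiers\<close>

definition solves :: "('f, 'v) subst \<Rightarrow> (('f, 'v) trm \<times> ('f, 'v) trm) list \<Rightarrow> bool" where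
  "solves \<sigma> E \<longleftrightarrow> (\<forall>(s, t)\<in>set E. subst_trm \<sigma> s = subst_trm \<sigma> t)"

definition eq_vars :: "(('f, 'v) trm \<times> ('f, 'v) trm) list \<Rightarrow> 'v set" where
  "eq_vars E = (\<Union>(s, t)\<in>set E. set (occs s) \<union> set (occs t))"

definition eq_size :: "(('f, 'v) trm \<times> ('f, 'v) trm) list \<Rightarrow> nat" where
  "eq_size E = (\<Sum>(s, t)\<leftarrow>E. size s + size t)"

lemma size_subst_occurs:
  "x \<in> set (occs t) \<Longrightarrow> size (\<sigma> x) \<le> size (subst_trm \<sigma> t)"
proof (induction t)
  case (Fun f ts)
  then obtain t where t: "t \<in> set ts" "x \<in> set (occs t)" by auto
  then have "size (\<sigma> x) \<le> size (subst_trm \<sigma> t)" using Fun.IH by blast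
  also have "\<dots> \<le> size_list size (map (subst_trm \<sigma>) ts)"
    using t(1) by (intro size_list_estimation') auto
  finally show ?case by simp
qed auto

text \<open>If \<open>x\<close> occurred properly inside \<open>t\<close>, its value would be
  strictly smaller than the value of \<open>t\<close>, to which it is equal.\<close>

lemma occurs_check:
  assumes "x \<in> set (occs t)" "\<sigma> x = subst_trm \<sigma> t" shows "t = Var x"
proof (cases t)
  case (Fun f ts)
  then obtain u where u: "u \<in> set ts" "x \<in> set (occs u)" using assms(1) by auto
  have "size (\<sigma> x) \<le> size (subst_trm \<sigma> u)" using u(2) by (rule size_subst_occurs)
  also have "\<dots> \<le> size_list size (map (subst_trm \<sigma>) ts)"
    using u(1) by (intro size_list_estimation') auto
  also have "\<dots> < size (subst_trm \<sigma> t)" using Fun by simp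
  finally show ?thesis using assms(2) by simp
qed (use assms in auto)

lemma eq_size_zip:
  "length ss = length ts \<Longrightarrow> eq_size (zip ss ts) \<le> size_list size ss + size_list size ts"
  by (induction ss ts rule: list_induct2) (auto simp: eq_size_def)

lemma eq_vars_zip:
  "length ss = length ts \<Longrightarrow> eq_vars (zip ss ts) = (\<Union>t\<in>set ss \<union> set ts. set (occs t))"
  by (induction ss ts rule: list_induct2) (auto simp: eq_vars_def)

lemma eq_vars_append: "eq_vars (E @ F) = eq_vars E \<union> eq_vars F"
  by (auto simp: eq_vars_def)

lemma eq_size_append: "eq_size (E @ F) = eq_size E + eq_size F"
  by (simp add: eq_size_def)

lemma solves_zip:
  "length ss = length ts \<Longrightarrow>
   solves \<sigma> (zip ss ts) \<longleftrightarrow> map (subst_trm \<sigma>) ss = map (subst_trm \<sigma>) ts"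
  by (induction ss ts rule: list_induct2) (auto simp: solves_def)

lemma solves_append: "solves \<sigma> (E @ F) \<longleftrightarrow> solves \<sigma> E \<and> solves \<sigma> F"
  by (auto simp: solves_def)

lemma finite_eq_vars [simp]: "finite (eq_vars E)"
  by (auto simp: eq_vars_def)

text \<open>Replacing \<open>x\<close> by \<open>t\<close> removes \<open>x\<close> from the other
  equations, so the number of variables drops. The induction hypothesis is an assumption here
  because both orientations of an equation use the lemma. In the form
  \<open>\<chi> y = subst_trm \<chi> (\<theta> y)\<close> every solution factors through
  \<open>\<theta>\<close> by way of itself; for \<open>\<chi> = \<theta>\<close> this is
  idempotence.\<close>

lemma eliminate_variable:
  fixes E :: "(('f, 'v) trm \<times> ('f, 'v) trm) list"
  assumes IH: "\<And>E' :: (('f, 'v) trm \<times> ('f, 'v) trm) list. card (eq_vars E') < n \<Longrightarrow> \<exists>\<chi>. solves \<chi> E' \<Longrightarrow>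
      \<exists>\<theta>. solves \<theta> E' \<and> (\<forall>\<chi>. solves \<chi> E' \<longrightarrow> (\<forall>y. \<chi> y = subst_trm \<chi> (\<theta> y)))"
    and n: "n = card (insert x (set (occs t)) \<union> eq_vars E)"
    and t: "t \<noteq> Var x"
    and sol: "\<sigma> x = subst_trm \<sigma> t" "solves \<sigma> E"
  shows "\<exists>\<theta>. \<theta> x = subst_trm \<theta> t \<and> solves \<theta> E \<and>
    (\<forall>\<chi>. \<chi> x = subst_trm \<chi> t \<and> solves \<chi> E \<longrightarrow> (\<forall>y. \<chi> y = subst_trm \<chi> (\<theta> y)))"
proof -
  define \<beta> where "\<beta> = Var(x := t)"
  define E' where "E' = map (map_prod (subst_trm \<beta>) (subst_trm \<beta>)) E"
  have x: "x \<notin> set (occs t)" using occurs_check[of x t \<sigma>] t sol(1) by auto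
  have b: "subst_trm \<chi> (subst_trm \<beta> s) = subst_trm \<chi> s" if "\<chi> x = subst_trm \<chi> t" for \<chi> s
    using that by (auto simp: subst_trm_subst_trm \<beta>_def intro: subst_trm_cong)
  have eq: "solves \<chi> E' \<longleftrightarrow> solves \<chi> E" if "\<chi> x = subst_trm \<chi> t" for \<chi>
    using b[OF that] by (force simp: solves_def E'_def)
  have "eq_vars E' \<subseteq> (set (occs t) \<union> eq_vars E) - {x}"
    using x by (fastforce simp: eq_vars_def E'_def set_occs_subst \<beta>_def split: if_splits)
  then have "eq_vars E' \<subset> insert x (set (occs t)) \<union> eq_vars E" by auto
  then have "card (eq_vars E') < n" unfolding n by (intro psubset_card_mono) auto
  with eq[OF sol(1)] sol(2) IH obtain \<theta> where
    \<theta>: "solves \<theta> E'" "\<And>\<chi> y. solves \<chi> E' \<Longrightarrow> \<chi> y = subst_trm \<chi> (\<theta> y)" by blast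
  define \<theta>' where "\<theta>' = subst_comp \<beta> \<theta>"
  have "subst_trm \<beta> t = t" using x by (intro subst_trm_ident) (auto simp: \<beta>_def)
  then have 1: "\<theta>' x = subst_trm \<theta>' t" by (simp add: \<theta>'_def subst_trm_subst_comp) (simp add: subst_comp_def \<beta>_def)
  have 2: "solves \<theta>' E"
    using \<theta>(1) by (force simp: solves_def E'_def \<theta>'_def subst_trm_subst_comp)
  have 3: "\<chi> y = subst_trm \<chi> (\<theta>' y)" if "\<chi> x = subst_trm \<chi> t" "solves \<chi> E" for \<chi> y
  proof -
    have s: "solves \<chi> E'" using eq that by blast
    have "subst_trm \<chi> (\<theta>' y) = subst_trm \<chi> (\<beta> y)"
      using \<theta>(2)[OF s] by (auto simp: \<theta>'_def subst_comp_def subst_trm_subst_trm intro!: subst_trm_cong)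
    also have "\<dots> = \<chi> y" using that(1) by (simp add: \<beta>_def)
    finally show ?thesis by simp
  qed
  show ?thesis using 1 2 3 by blast
qed

lemma solvable_imp_strong_mgu:
  fixes E :: "(('f, 'v) trm \<times> ('f, 'v) trm) list"
  shows "\<exists>\<chi>. solves \<chi> E \<Longrightarrow>
   \<exists>\<theta>. solves \<theta> E \<and> (\<forall>\<chi>. solves \<chi> E \<longrightarrow> (\<forall>y. \<chi> y = subst_trm \<chi> (\<theta> y)))"
\<comment> \<open>Eliminating a variable lowers the first component; dropping a trivial equation or
  decomposing two compound terms lowers the second without raising the first.\<close>
proof (induction "(card (eq_vars E), eq_size E)" arbitrary: E rule: wf_induct_rule[OF wf_lex_prod[OF wf_less_than wf_less_than]])
  case 1
  then obtain \<chi>0 where \<chi>0: "solves \<chi>0 E" by blast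
  have IH: "\<exists>\<theta>. solves \<theta> E' \<and> (\<forall>\<chi>. solves \<chi> E' \<longrightarrow> (\<forall>y. \<chi> y = subst_trm \<chi> (\<theta> y)))"
    if "card (eq_vars E') < card (eq_vars E) \<or>
        card (eq_vars E') \<le> card (eq_vars E) \<and> eq_size E' < eq_size E" "\<exists>\<chi>. solves \<chi> E'"
    for E' :: "(('f, 'v) trm \<times> ('f, 'v) trm) list"
    using 1(1)[of E'] that by fastforce
  show ?case
  proof (cases E)
    case Nil
    then show ?thesis by (intro exI[of _ Var]) (auto simp: solves_def)
  next
    case (Cons e F)
    obtain s t where e: "e = (s, t)" by (cases e)
    have E: "solves \<chi> E \<longleftrightarrow> subst_trm \<chi> s = subst_trm \<chi> t \<and> solves \<chi> F" for \<chi>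
      by (auto simp: Cons e solves_def)
    have vE: "eq_vars E = set (occs s) \<union> set (occs t) \<union> eq_vars F"
      by (auto simp: Cons e eq_vars_def)
    have sE: "eq_size E = size s + size t + eq_size F" by (simp add: Cons e eq_size_def)
    have sz: "size u > 0" for u :: "('f, 'v) trm" by (cases u) auto
    show ?thesis
    proof (cases "s = t")
      case True
      have "eq_size F < eq_size E" using sz[of s] by (simp add: sE)
      moreover have "card (eq_vars F) \<le> card (eq_vars E)" by (intro card_mono) (auto simp: vE)
      ultimately show ?thesis using IH[of F] \<chi>0 by (simp add: E True) blast
    next
      case ne: False
      have IHc: "\<exists>\<theta>. solves \<theta> E' \<and> (\<forall>\<chi>. solves \<chi> E' \<longrightarrow> (\<forall>y. \<chi> y = subst_trm \<chi> (\<theta> y)))"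
        if "card (eq_vars E') < card (eq_vars E)" "\<exists>\<chi>. solves \<chi> E'"
        for E' :: "(('f, 'v) trm \<times> ('f, 'v) trm) list"
        using IH that by blast
      show ?thesis
      proof (cases s)
        case (Var x)
        show ?thesis
          using eliminate_variable[OF IHc, where x = x and t = t and E = F and \<sigma> = \<chi>0] \<chi>0 ne by (simp add: E vE Var)
      next
        case (Fun f ss)
        show ?thesis
        proof (cases t)
          case (Var x)
          have "subst_trm \<chi> s = subst_trm \<chi> t \<longleftrightarrow> \<chi> x = subst_trm \<chi> s" for \<chi>
            using Var by auto
          then show ?thesis
            using eliminate_variable[OF IHc, where x = x and t = s and E = F and \<sigma> = \<chi>0] \<chi>0 ne by (simp add: E vE Var)
        next
          case Fun2: (Fun g ts)
          have fg: "f = g" and len: "length ss = length ts"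
            using \<chi>0 unfolding E Fun Fun2 by (auto dest: map_eq_imp_length_eq)
          define E' where "E' = zip ss ts @ F"
          have eq: "solves \<chi> E' \<longleftrightarrow> solves \<chi> E" for \<chi>
            by (simp add: E'_def E Fun Fun2 fg solves_append solves_zip len)
          have "eq_vars E' = eq_vars E"
            by (simp add: vE E'_def Fun Fun2 eq_vars_append eq_vars_zip[OF len] UN_Un)
          moreover have "eq_size E' < eq_size E"
            using eq_size_zip[OF len] by (simp add: sE E'_def Fun Fun2 eq_size_append)
          ultimately show ?thesis using IH[of E'] \<chi>0 eq by auto
        qed
      qed
    qed
  qed
qed

lemma unifiable_imp_mgu:
  assumes "unifier \<chi> a b" shows "\<exists>\<theta>. is_mgu \<theta> a b"
proof -
  have p: "pred a = pred b" and len: "length (args a) = length (args b)"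
    using assms by (auto simp: unifier_def subst_atom_def dest: map_eq_imp_length_eq)
  have "unifier \<sigma> a b \<longleftrightarrow> solves \<sigma> (zip (args a) (args b))" for \<sigma>
    by (simp add: solves_zip len unifier_def subst_atom_def p)
  then show ?thesis
    using solvable_imp_strong_mgu[of "zip (args a) (args b)"] assms unfolding is_mgu_def by metis
qed

section \<open>Argument positions and linearity\<close>

text \<open>Sets of positions replace the lists \<open>inputs\<close> and \<open>outputs\<close>: a
  position survives substitution, so the terms before and after a step can be compared at the same
  index.\<close>

definition pvars :: "nat set \<Rightarrow> ('f, 'v) trm list \<Rightarrow> 'v set" where
  "pvars A ts = (\<Union>k\<in>A. set (occs (ts ! k)))"

definition plin :: "nat set \<Rightarrow> ('f, 'v) trm list \<Rightarrow> bool" where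
  "plin A ts \<longleftrightarrow> (\<forall>k\<in>A. distinct (occs (ts ! k))) \<and>
     (\<forall>k\<in>A. \<forall>l\<in>A. k \<noteq> l \<longrightarrow> set (occs (ts ! k)) \<inter> set (occs (ts ! l)) = {})"

definition ivars :: "('p, 'f, 'v) program \<Rightarrow> ('p, 'f, 'v) atom \<Rightarrow> 'v set" where
  "ivars P a = pvars (in_pos P (pred a)) (args a)"

definition ovars :: "('p, 'f, 'v) program \<Rightarrow> ('p, 'f, 'v) atom \<Rightarrow> 'v set" where
  "ovars P a = pvars (out_pos P (pred a)) (args a)"

lemma distinct_concat_map:
  "distinct ks \<Longrightarrow> distinct (concat (map f ks)) \<longleftrightarrow>
     (\<forall>k\<in>set ks. distinct (f k)) \<and> (\<forall>k\<in>set ks. \<forall>l\<in>set ks. k \<noteq> l \<longrightarrow> set (f k) \<inter> set (f l) = {})"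
proof (induction ks)
  case (Cons a ks)
  have D: "set (f k) \<inter> set (f a) = {} \<longleftrightarrow> set (f a) \<inter> set (f k) = {}" for k by auto
  have ne: "(\<forall>k\<in>set ks. k \<noteq> a \<longrightarrow> R k) = (\<forall>k\<in>set ks. R k)"
    "(\<forall>k\<in>set ks. a \<noteq> k \<longrightarrow> R k) = (\<forall>k\<in>set ks. R k)" for R
    using Cons.prems by auto
  have "distinct (concat (map f (a # ks))) \<longleftrightarrow> distinct (f a) \<and> distinct (concat (map f ks)) \<and>
      (\<forall>k\<in>set ks. set (f a) \<inter> set (f k) = {})" by auto
  also have "\<dots> \<longleftrightarrow> distinct (f a) \<and> ((\<forall>k\<in>set ks. distinct (f k)) \<and>
      (\<forall>k\<in>set ks. \<forall>l\<in>set ks. k \<noteq> l \<longrightarrow> set (f k) \<inter> set (f l) = {})) \<and>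
      (\<forall>k\<in>set ks. set (f a) \<inter> set (f k) = {})" using Cons by simp
  also have "\<dots> \<longleftrightarrow> (\<forall>k\<in>set (a # ks). distinct (f k)) \<and>
      (\<forall>k\<in>set (a # ks). \<forall>l\<in>set (a # ks). k \<noteq> l \<longrightarrow> set (f k) \<inter> set (f l) = {})"
    using Cons.prems D ne by (simp add: ball_conj_distrib) blast
  finally show ?case .
qed simp

lemma select_filter:
  "concat (map (\<lambda>k. if k \<in> A then [g k] else []) ks) = map g (filter (\<lambda>k. k \<in> A) ks)"
  by (induction ks) auto

lemma io_positions:
  assumes "wf_atom P a"
  shows "in_pos P (pred a) \<subseteq> {..<length (args a)}" "out_pos P (pred a) \<subseteq> {..<length (args a)}"
    "in_pos P (pred a) \<union> out_pos P (pred a) = {..<length (args a)}"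
    "in_pos P (pred a) \<inter> out_pos P (pred a) = {}"
  using assms by (auto simp: wf_atom_def in_pos_def out_pos_def) (metis io.exhaust)

lemma avars_io: "wf_atom P a \<Longrightarrow> avars a = ivars P a \<union> ovars P a"
proof -
  assume "wf_atom P a"
  then have "ivars P a \<union> ovars P a = (\<Union>k\<in>{..<length (args a)}. set (occs (args a ! k)))"
    using io_positions(3)[of P a] unfolding ivars_def ovars_def pvars_def by (metis UN_Un)
  also have "\<dots> = avars a" unfolding avars_def vars_trms_def set_conv_nth by blast
  finally show ?thesis by simp
qed

lemma linear_select:
  "A \<subseteq> {..<length ts} \<Longrightarrow>
   linear [ts ! k. k \<leftarrow> [0..<length ts], k \<in> A] \<longleftrightarrow> plin A ts"
proof -
  assume A: "A \<subseteq> {..<length ts}"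
  then have "set (filter (\<lambda>k. k \<in> A) [0..<length ts]) = A" by auto
  then show ?thesis
    by (simp only: linear_def select_filter map_map o_def distinct_concat_map distinct_filter
        distinct_upt plin_def)
qed

lemma linear_inputs: "wf_atom P a \<Longrightarrow> linear (inputs P a) \<longleftrightarrow> plin (in_pos P (pred a)) (args a)"
  unfolding inputs_def by (rule linear_select) (rule io_positions)

lemma linear_outputs: "wf_atom P a \<Longrightarrow> linear (outputs P a) \<longleftrightarrow> plin (out_pos P (pred a)) (args a)"
  unfolding outputs_def by (rule linear_select) (rule io_positions)

lemma vars_inputs: "wf_atom P a \<Longrightarrow> vars_trms (inputs P a) = ivars P a"
  using io_positions(1)[of P a] unfolding inputs_def select_filter ivars_def pvars_def vars_trms_def
  by auto

lemma vars_outputs: "wf_atom P a \<Longrightarrow> vars_trms (outputs P a) = ovars P a"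
  using io_positions(2)[of P a] unfolding outputs_def select_filter ovars_def pvars_def vars_trms_def
  by auto

lemma ivars_subst:
  "wf_atom P a \<Longrightarrow> ivars P (subst_atom \<sigma> a) = (\<Union>x\<in>ivars P a. set (occs (\<sigma> x)))"
proof -
  assume "wf_atom P a"
  then have "map (subst_trm \<sigma>) (args a) ! k = subst_trm \<sigma> (args a ! k)" if "k \<in> in_pos P (pred a)" for k
    using io_positions(1) that by (blast intro: nth_map)
  then show ?thesis by (simp add: ivars_def pvars_def set_occs_subst)
qed

lemma ovars_subst:
  "wf_atom P a \<Longrightarrow> ovars P (subst_atom \<sigma> a) = (\<Union>x\<in>ovars P a. set (occs (\<sigma> x)))"
proof -
  assume "wf_atom P a"
  then have "map (subst_trm \<sigma>) (args a) ! k = subst_trm \<sigma> (args a ! k)" if "k \<in> out_pos P (pred a)" for k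
    using io_positions(2) that by (blast intro: nth_map)
  then show ?thesis by (simp add: ovars_def pvars_def set_occs_subst)
qed

text \<open>The form in which linearity is exploited: positions without common variables can be
  treated one at a time and the results merged.\<close>

lemma glue_substitutions:
  assumes "\<And>k l. k \<in> A \<Longrightarrow> l \<in> A \<Longrightarrow> k \<noteq> l \<Longrightarrow> X k \<inter> X l = {}"
  obtains m :: "('f, 'v) subst" where "\<And>k x. k \<in> A \<Longrightarrow> x \<in> X k \<Longrightarrow> m x = \<mu> k x"
    and "\<And>x. x \<notin> (\<Union>k\<in>A. X k) \<Longrightarrow> m x = Var x"
proof
  define m where "m x = (if x \<in> (\<Union>k\<in>A. X k) then \<mu> (SOME k. k \<in> A \<and> x \<in> X k) x else Var x)" for x
  show "m x = \<mu> k x" if "k \<in> A" "x \<in> X k" for k x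
  proof -
    have "(SOME k. k \<in> A \<and> x \<in> X k) = k" using that assms by (intro some_equality) auto
    then show ?thesis using that by (auto simp: m_def)
  qed
qed auto


section \<open>The most general unifier of an atom and a clause head\<close>

text \<open>A flat term constrains nothing below its top symbol, so this is the only condition for
  matching a flat \<open>t\<close> against \<open>w\<close>.\<close>

definition compat :: "('f, 'v) trm \<Rightarrow> ('f, 'v) trm \<Rightarrow> bool" where
  "compat t w \<longleftrightarrow> is_var t \<or> (\<exists>f ts us. t = Fun f ts \<and> w = Fun f us \<and> length ts = length us)"

lemma compatI: "subst_trm \<theta> t = subst_trm \<theta> w \<Longrightarrow> \<not> is_var w \<Longrightarrow> compat t w"
  by (cases t; cases w) (auto simp: compat_def dest: map_eq_imp_length_eq)

lemma compat_subst: "compat t w \<Longrightarrow> compat t (subst_trm \<sigma> w)"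
  by (auto simp: compat_def)

lemma flat_match:
  assumes "flat t" "compat t w" shows "\<exists>m. subst_trm m t = w"
proof (cases "is_var t")
  case True
  then show ?thesis by (auto simp: is_var_def)
next
  case False
  then obtain f xs ws where t: "t = Fun f (map Var xs)" "distinct xs" "w = Fun f ws" "length xs = length ws"
    using assms by (auto simp: flat_def compat_def)
  have "map (\<lambda>x. the (map_of (zip xs ws) x)) xs = ws"
    using t by (intro nth_equalityI) (simp_all add: map_of_zip_nth)
  then show ?thesis using t by (intro exI[of _ "\<lambda>x. the (map_of (zip xs ws) x)"]) (simp add: o_def)
qed

lemma flat_list_match:
  assumes "plin A ts" "\<And>k. k \<in> A \<Longrightarrow> flat (ts ! k)" "\<And>k. k \<in> A \<Longrightarrow> compat (ts ! k) (W k)"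
  obtains m where "\<And>k. k \<in> A \<Longrightarrow> subst_trm m (ts ! k) = W k" "\<And>x. x \<notin> pvars A ts \<Longrightarrow> m x = Var x"
proof -
  have "\<forall>k\<in>A. \<exists>m. subst_trm m (ts ! k) = W k" using assms flat_match by blast
  then obtain \<mu> where \<mu>: "\<And>k. k \<in> A \<Longrightarrow> subst_trm (\<mu> k) (ts ! k) = W k" by metis
  obtain m where m: "\<And>k x. k \<in> A \<Longrightarrow> x \<in> set (occs (ts ! k)) \<Longrightarrow> m x = \<mu> k x"
    "\<And>x. x \<notin> (\<Union>k\<in>A. set (occs (ts ! k))) \<Longrightarrow> m x = Var x"
    using assms(1) unfolding plin_def
    by (rule_tac glue_substitutions[of A "\<lambda>k. set (occs (ts ! k))" \<mu>]) blast+
  show ?thesis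
  proof
    show "subst_trm m (ts ! k) = W k" if "k \<in> A" for k
      using \<mu>[OF that] m(1)[OF that] subst_trm_cong[of "ts ! k" m "\<mu> k"] by metis
  qed (use m(2) in \<open>auto simp: pvars_def\<close>)
qed

lemma robust_position_flat: "robust_position P a k \<Longrightarrow> flat (args a ! k)"
  by (auto simp: robust_position_def flat_def split: if_splits)

lemma subst_fixD: "subst_trm \<sigma> t = t \<Longrightarrow> x \<in> set (occs t) \<Longrightarrow> \<sigma> x = Var x"
  using subst_trm_cong_iff[of \<sigma> t Var] by simp

text \<open>
  The inputs of the head are matched against the inputs of the atom. A variable in an output position
  of the head, matched against a compound term, is bound to that term, which is flat. What remains
  is to match the outputs of the atom, which are linear and flat, against those of the head.
\<close>

lemma canonical_mgu:
  assumes wf: "wf_atom P a" "wf_atom P h"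
    and uni: "unifier \<theta> a h"
    and lin: "plin (in_pos P (pred h)) (args h)" "plin (out_pos P (pred a)) (args a)"
    and rob: "\<And>k. k \<in> in_pos P (pred h) \<Longrightarrow> robust_position P h k"
      "\<And>k. k \<in> out_pos P (pred a) \<Longrightarrow> robust_position P a k"
    and inp: "\<And>k. k \<in> in_pos P (pred a) \<Longrightarrow> bound P (pred a) k \<Longrightarrow> \<not> is_var (args a ! k)"
    and disj: "ivars P a \<inter> ovars P a = {}" "avars a \<inter> avars h = {}"
    and ret: "\<And>k x. k \<in> out_pos P (pred h) \<Longrightarrow> bound P (pred h) k \<Longrightarrow> args h ! k = Var x \<Longrightarrow>
      x \<in> ivars P h \<Longrightarrow> \<exists>l\<in>in_pos P (pred h). bound P (pred h) l \<and> args h ! l = Var x"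
  obtains \<theta>0 where "unifier \<theta>0 a h"
    and "\<And>\<chi> x. unifier \<chi> a h \<Longrightarrow> \<chi> x = subst_trm \<chi> (\<theta>0 x)"
    and "\<And>x. x \<in> ivars P h \<Longrightarrow> set (occs (\<theta>0 x)) \<subseteq> ivars P a"
    and "\<And>x. x \<in> ovars P a \<Longrightarrow> set (occs (\<theta>0 x)) \<subseteq> avars a \<union> avars h"
    and "\<And>x. x \<notin> ovars P a \<Longrightarrow> x \<notin> ivars P h \<Longrightarrow> \<theta>0 x = Var x \<or>
      (\<exists>k\<in>out_pos P (pred a). bound P (pred a) k \<and> args h ! k = Var x \<and> \<theta>0 x = args a ! k \<and>
        \<not> is_var (args a ! k))"
proof -
  define s where "s = args a"
  define v where "v = args h"
  define I where "I = in_pos P (pred a)"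
  define O' where "O' = out_pos P (pred a)"
  have p: "pred h = pred a" and len: "length v = length s"
    using uni by (auto simp: unifier_def subst_atom_def s_def v_def dest: map_eq_imp_length_eq)
  have all: "{..<length s} = I \<union> O'" using io_positions(3)[OF wf(1)] by (simp add: s_def I_def O'_def)
  have unifD: "subst_trm \<chi> (s ! k) = subst_trm \<chi> (v ! k)" if "unifier \<chi> a h" "k \<in> I \<union> O'" for \<chi> k
  proof -
    have "map (subst_trm \<chi>) s = map (subst_trm \<chi>) v" using that by (simp add: unifier_def subst_atom_def s_def v_def)
    then show ?thesis using that(2) len unfolding all[symmetric] by (metis lessThan_iff nth_map)
  qed
  note lin = lin[unfolded p, folded s_def v_def I_def O'_def]
  note ih = ivars_def[of P h, unfolded p, folded v_def I_def] and oa = ovars_def[of P a, folded s_def O'_def]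
    and ia = ivars_def[of P a, folded s_def I_def]
  have vh: "set (occs (v ! k)) \<subseteq> avars h" if "k \<in> I \<union> O'" for k
    using that len nth_mem[of k v] unfolding all[symmetric]
    by (auto simp: avars_def vars_trms_def v_def simp del: nth_mem)
  have vi: "set (occs (v ! k)) \<subseteq> ivars P h" if "k \<in> I" for k using that by (auto simp: ih pvars_def)
  have si: "set (occs (s ! k)) \<subseteq> ivars P a" if "k \<in> I" for k using that by (auto simp: ia pvars_def)
  have so: "set (occs (s ! k)) \<subseteq> ovars P a" if "k \<in> O'" for k using that by (auto simp: oa pvars_def)
  have av: "avars a = ivars P a \<union> ovars P a" using avars_io wf by blast
  have ihs: "ivars P h \<subseteq> avars h" using avars_io wf by blast
  \<comment> \<open>A free input position of the head holds a variable and matches anything. In a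
    bound one the atom is compound by \<open>inp\<close>, and unifiability forces the top symbols to
    agree.\<close>
  obtain \<theta>1 where \<theta>1: "\<And>k. k \<in> I \<Longrightarrow> subst_trm \<theta>1 (v ! k) = s ! k" "\<And>x. x \<notin> ivars P h \<Longrightarrow> \<theta>1 x = Var x"
  proof (rule flat_list_match[OF lin(1), of "\<lambda>k. s ! k"])
    fix k assume k: "k \<in> I"
    then have r: "robust_position P h k" using rob(1) by (simp add: I_def p)
    then show "flat (v ! k)" unfolding v_def by (rule robust_position_flat)
    show "compat (v ! k) (s ! k)"
    proof (cases "bound P (pred a) k")
      case True
      then have "\<not> is_var (s ! k)" using inp k by (simp add: I_def s_def)
      then show ?thesis using unifD[OF uni] k by (intro compatI[of \<theta>]) auto
    next
      case False
      then show ?thesis using r by (simp add: robust_position_def p compat_def v_def)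
    qed
  qed (auto simp: ih)
  have \<theta>1v: "set (occs (\<theta>1 x)) \<subseteq> ivars P a" if x: "x \<in> ivars P h" for x
  proof -
    obtain k where k: "k \<in> I" "x \<in> set (occs (v ! k))" using x by (auto simp: ih pvars_def)
    then have "set (occs (\<theta>1 x)) \<subseteq> set (occs (s ! k))" using \<theta>1(1)[OF k(1)] set_occs_subst[of \<theta>1 "v ! k"] by auto
    then show ?thesis using si[OF k(1)] by auto
  qed
  \<comment> \<open>A variable may fill several output positions of the head. Any one of them at
    which the atom has a compound term may determine its value; \<open>m\<close> then matches the
    outputs of the atom at the others against that value.\<close>
  define kf where "kf x = (SOME k. k \<in> O' \<and> v ! k = Var x \<and> \<not> is_var (s ! k))" for x
  define X2 where "X2 = {x. x \<notin> ivars P h \<and> (\<exists>k. k \<in> O' \<and> v ! k = Var x \<and> \<not> is_var (s ! k))}"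
  have kf: "kf x \<in> O'" "v ! kf x = Var x" "\<not> is_var (s ! kf x)" if "x \<in> X2" for x
    using someI_ex[of "\<lambda>k. k \<in> O' \<and> v ! k = Var x \<and> \<not> is_var (s ! k)"] that
    by (auto simp: kf_def X2_def)
  have X2h: "X2 \<subseteq> avars h" using vh by (fastforce simp: X2_def)
  have O'b: "bound P (pred a) k" if "k \<in> O'" "\<not> is_var (s ! k)" for k
    using rob(2)[of k] that by (auto simp: O'_def s_def robust_position_def split: if_splits)
  define \<beta> where "\<beta> x = (if x \<in> X2 then s ! kf x else Var x)" for x
  define W where "W k = subst_trm \<beta> (subst_trm \<theta>1 (v ! k))" for k
  obtain m where m: "\<And>k. k \<in> O' \<Longrightarrow> subst_trm m (s ! k) = W k" "\<And>x. x \<notin> ovars P a \<Longrightarrow> m x = Var x"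
  proof (rule flat_list_match[OF lin(2), of W])
    fix k assume k: "k \<in> O'"
    then show "flat (s ! k)" unfolding s_def using rob(2) by (intro robust_position_flat) (simp add: O'_def)
    show "compat (s ! k) (W k)"
    proof (cases "is_var (s ! k)")
      case True
      then show ?thesis by (simp add: compat_def)
    next
      case sk: False
      show ?thesis
      proof (cases "v ! k")
        case (Fun f ts)
        then have "compat (s ! k) (v ! k)" using unifD[OF uni, of k] k by (intro compatI[of \<theta>]) auto
        then show ?thesis unfolding W_def by (intro compat_subst)
      next
        case (Var x)
        show ?thesis
        \<comment> \<open>If \<open>x\<close> also occurs in the inputs of the head,
          \<open>ret\<close> yields a bound input position \<open>l\<close> filled with
          \<open>x\<close>, where the atom is compound. The top symbols of \<open>s ! l\<close> and
          \<open>s ! k\<close> agree because \<open>\<theta>\<close> identifies both with the value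
          of \<open>x\<close>.\<close>
        proof (cases "x \<in> ivars P h")
          case True
          have "bound P (pred h) k" using O'b[OF k sk] p by simp
          then obtain l where l: "l \<in> I" "bound P (pred a) l" "v ! l = Var x"
            using ret[of k x] k True Var by (auto simp: p O'_def I_def v_def)
          then have nl: "\<not> is_var (s ! l)" using inp by (auto simp: I_def s_def)
          have "\<theta>1 x = s ! l" using \<theta>1(1)[OF l(1)] l(3) by simp
          moreover have "subst_trm \<theta> (s ! k) = subst_trm \<theta> (s ! l)"
            using unifD[OF uni, of k] unifD[OF uni, of l] k l Var by simp
          ultimately show ?thesis using compatI[of \<theta>, OF _ nl] by (simp add: W_def Var compat_subst)
        next
          case False
          then have x: "x \<in> X2" using k sk Var by (auto simp: X2_def)
          have "subst_trm \<theta> (s ! k) = subst_trm \<theta> (s ! kf x)"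
            using unifD[OF uni, of k] unifD[OF uni, of "kf x"] k kf[OF x] Var by simp
          then show ?thesis using compatI kf(3)[OF x] x False by (simp add: W_def Var \<theta>1(2) \<beta>_def)
        qed
      qed
    qed
  qed (auto simp: oa)
  have mfix: "m y = Var y" if "x \<in> X2" "y \<in> set (occs (s ! kf x))" for x y
  proof -
    have "W (kf x) = s ! kf x" using kf[OF that(1)] that(1) by (simp add: W_def \<theta>1(2) X2_def \<beta>_def)
    then show ?thesis using m(1)[OF kf(1)[OF that(1)]] that(2) subst_fixD by metis
  qed
  define \<theta>0 where "\<theta>0 x = (if x \<in> ovars P a then m x else if x \<in> ivars P h then \<theta>1 x else \<beta> x)" for x
  have ona: "x \<notin> ovars P a" "x \<notin> ivars P a" if "x \<in> avars h" for x using that disj(2) av by auto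
  have \<beta>a: "\<beta> x = Var x" if "x \<in> avars a" for x using that disj(2) X2h by (auto simp: \<beta>_def)
  have W0: "subst_trm \<theta>0 (v ! k) = W k" if "k \<in> I \<union> O'" for k
    unfolding W_def subst_trm_subst_trm
  proof (rule subst_trm_cong)
    fix x assume "x \<in> set (occs (v ! k))"
    then have x: "x \<in> avars h" using vh that by auto
    show "\<theta>0 x = subst_trm \<beta> (\<theta>1 x)"
    proof (cases "x \<in> ivars P h")
      case True
      then have "subst_trm \<beta> (\<theta>1 x) = \<theta>1 x" using \<theta>1v[OF True] \<beta>a av by (intro subst_trm_ident) auto
      then show ?thesis using True x ona by (simp add: \<theta>0_def)
    next
      case False
      then show ?thesis using x ona \<theta>1(2) by (simp add: \<theta>0_def)
    qed
  qed
  have "unifier \<theta>0 a h"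
  proof -
    have "subst_trm \<theta>0 (s ! k) = subst_trm \<theta>0 (v ! k)" if k: "k \<in> I" for k
    proof -
      have "\<theta>0 x = Var x" if "x \<in> set (occs (s ! k))" for x
      proof -
        have "x \<in> ivars P a" using that si k by auto
        then show ?thesis using disj av ihs \<beta>a by (auto simp: \<theta>0_def)
      qed
      then have "subst_trm \<theta>0 (s ! k) = s ! k" by (rule subst_trm_ident)
      moreover have "W k = s ! k"
        unfolding W_def \<theta>1(1)[OF k] using si k av \<beta>a by (intro subst_trm_ident) auto
      ultimately show ?thesis using W0 k by simp
    qed
    moreover have "subst_trm \<theta>0 (s ! k) = subst_trm \<theta>0 (v ! k)" if k: "k \<in> O'" for k
    proof -
      have "subst_trm \<theta>0 (s ! k) = subst_trm m (s ! k)" using so[OF k] by (intro subst_trm_cong) (auto simp: \<theta>0_def)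
      then show ?thesis using m(1)[OF k] W0 k by simp
    qed
    ultimately have "map (subst_trm \<theta>0) s = map (subst_trm \<theta>0) v"
      using all len by (intro nth_equalityI) auto
    then show ?thesis by (simp add: unifier_def subst_atom_def s_def v_def p)
  qed
  \<comment> \<open>Every unifier absorbs each of \<open>\<theta>1\<close>, \<open>\<beta>\<close>
    and \<open>m\<close> separately, and on each variable \<open>\<theta>0\<close> acts as one of
    the three.\<close>
  moreover have "\<chi> x = subst_trm \<chi> (\<theta>0 x)" if \<chi>: "unifier \<chi> a h" for \<chi> x
  proof -
    have 1: "\<chi> x = subst_trm \<chi> (\<theta>1 x)" for x
    proof (cases "x \<in> ivars P h")
      case True
      then obtain k where k: "k \<in> I" "x \<in> set (occs (v ! k))" by (auto simp: ih pvars_def)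
      have "subst_trm (subst_comp \<theta>1 \<chi>) (v ! k) = subst_trm \<chi> (v ! k)"
        using unifD[OF \<chi>, of k] k \<theta>1(1) by (simp add: subst_trm_subst_comp)
      then show ?thesis using k(2) by (auto simp: subst_trm_cong_iff subst_comp_def)
    qed (simp add: \<theta>1)
    have 2: "\<chi> x = subst_trm \<chi> (\<beta> x)" for x
      using unifD[OF \<chi>, of "kf x"] kf[of x] by (auto simp: \<beta>_def)
    have 3: "\<chi> x = subst_trm \<chi> (m x)" for x
    proof (cases "x \<in> ovars P a")
      case True
      then obtain k where k: "k \<in> O'" "x \<in> set (occs (s ! k))" by (auto simp: oa pvars_def)
      have "subst_trm \<chi> (W k) = subst_trm \<chi> (v ! k)"
        using 1 2 by (auto simp: W_def subst_trm_subst_trm intro!: subst_trm_cong)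
      then have "subst_trm (subst_comp m \<chi>) (s ! k) = subst_trm \<chi> (s ! k)"
        using unifD[OF \<chi>, of k] k m(1) by (simp add: subst_trm_subst_comp)
      then show ?thesis using k(2) by (auto simp: subst_trm_cong_iff subst_comp_def)
    qed (simp add: m)
    show ?thesis using 1 2 3 by (auto simp: \<theta>0_def)
  qed
  moreover have "set (occs (\<theta>0 x)) \<subseteq> ivars P a" if "x \<in> ivars P h" for x
    using that \<theta>1v ihs ona by (auto simp: \<theta>0_def)
  moreover have "set (occs (\<theta>0 x)) \<subseteq> avars a \<union> avars h" if x: "x \<in> ovars P a" for x
  proof -
    obtain k where k: "k \<in> O'" "x \<in> set (occs (s ! k))" using x by (auto simp: oa pvars_def)
    have "set (occs (m x)) \<subseteq> set (occs (W k))" using m(1)[OF k(1)] k(2) set_occs_subst[of m "s ! k"] by auto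
    moreover have "set (occs (subst_trm \<beta> (\<theta>1 y))) \<subseteq> avars a \<union> avars h" if y: "y \<in> set (occs (v ! k))" for y
    proof (cases "y \<in> ivars P h")
      case True
      then have "subst_trm \<beta> (\<theta>1 y) = \<theta>1 y" using \<theta>1v[OF True] \<beta>a av by (intro subst_trm_ident) auto
      then show ?thesis using \<theta>1v[OF True] av by auto
    next
      case False
      have "y \<in> avars h" using y vh k by auto
      then show ?thesis using False so[OF kf(1), of y] av by (auto simp: \<theta>1(2) \<beta>_def)
    qed
    ultimately show ?thesis using x by (auto simp: \<theta>0_def W_def subst_trm_subst_trm set_occs_subst)
  qed
  moreover have "\<theta>0 x = Var x \<or> (\<exists>k\<in>out_pos P (pred a). bound P (pred a) k \<and> args h ! k = Var x \<and>
      \<theta>0 x = args a ! k \<and> \<not> is_var (args a ! k))" if "x \<notin> ovars P a" "x \<notin> ivars P h" for x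
  proof (cases "x \<in> X2")
    case True
    then have "\<theta>0 x = s ! kf x" using that by (simp add: \<theta>0_def \<beta>_def)
    then show ?thesis using kf[OF True] O'b by (intro disjI2 bexI[of _ "kf x"]) (auto simp: s_def v_def O'_def)
  qed (use that in \<open>simp add: \<theta>0_def \<beta>_def\<close>)
  ultimately show ?thesis using that by blast
qed

section \<open>Labelled queries\<close>

text \<open>
  Atoms of a query are labelled with their addresses in the derivation tree, children being counted
  in the order given by the permutation of the clause. The order of the atoms for which a query is
  robustly typed is then the lexicographic order of their labels, which are not prefixes of
  each other.
\<close>

fun lx :: "nat list \<Rightarrow> nat list \<Rightarrow> bool" where
  "lx (a # s) (b # t) \<longleftrightarrow> a < b \<or> a = b \<and> lx s t"
| "lx _ _ \<longleftrightarrow> False"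

lemma lx_irrefl [simp]: "\<not> lx l l"
  by (induction l) auto

lemma lx_trans: "lx a b \<Longrightarrow> lx b c \<Longrightarrow> lx a c"
  by (induction a b arbitrary: c rule: lx.induct) (case_tac c; auto)+

lemma lx_not_prefix: "lx l l' \<Longrightarrow> \<not> prefix l l' \<and> \<not> prefix l' l"
  by (induction l l' rule: lx.induct) auto

lemma lx_total: "\<not> prefix l l' \<Longrightarrow> \<not> prefix l' l \<Longrightarrow> lx l l' \<or> lx l' l"
  by (induction l l' rule: lx.induct) auto

lemma lx_append: "lx l l' \<Longrightarrow> lx (l @ s) (l' @ t)"
  by (induction l l' rule: lx.induct) auto

text \<open>Passage from a child to its parent: against a label that is not below \<open>w\<close>,
  the comparison is already decided inside \<open>w\<close>.\<close>

lemma lx_append_left: "lx (w @ s) l \<Longrightarrow> \<not> prefix w l \<Longrightarrow> lx w l"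
  by (induction w l rule: lx.induct) auto

lemma lx_append_right: "lx l (w @ s) \<Longrightarrow> \<not> prefix w l \<Longrightarrow> lx l w"
  by (induction l w rule: lx.induct) auto

lemma lx_same [simp]: "lx (w @ s) (w @ t) \<longleftrightarrow> lx s t"
  by (induction w) auto

type_synonym ('p, 'f, 'v) lquery = "(nat list \<times> ('p, 'f, 'v) atom) set"

text \<open>The conditions on a robustly typed query, with positions replaced by labels and their
  order by \<open>lx\<close>. Since \<open>lx\<close> never relates a label to its extensions, it is
  the prefix condition that makes \<open>lx\<close> total on the labels.\<close>

definition robust_labelled :: "('p, 'f, 'v) program \<Rightarrow> ('p, 'f, 'v) lquery \<Rightarrow> bool" where
  "robust_labelled P S \<longleftrightarrow>
     (\<forall>l a l' a'. (l, a) \<in> S \<longrightarrow> (l', a') \<in> S \<longrightarrow> prefix l l' \<longrightarrow> l = l' \<and> a = a') \<and>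
     (\<forall>l a. (l, a) \<in> S \<longrightarrow> wf_atom P a \<and> plin (out_pos P (pred a)) (args a) \<and>
        (\<forall>k\<in>out_pos P (pred a). robust_position P a k)) \<and>
     (\<forall>l a l' a'. (l, a) \<in> S \<longrightarrow> (l', a') \<in> S \<longrightarrow> l \<noteq> l' \<longrightarrow> ovars P a \<inter> ovars P a' = {}) \<and>
     (\<forall>l a l' a'. (l, a) \<in> S \<longrightarrow> (l', a') \<in> S \<longrightarrow> l = l' \<or> lx l l' \<longrightarrow>
        ivars P a \<inter> ovars P a' = {}) \<and>
     (\<forall>l a \<sigma>. (l, a) \<in> S \<longrightarrow>
        (\<forall>l' a'. (l', a') \<in> S \<longrightarrow> lx l' l \<longrightarrow> outputs_typed P (subst_atom \<sigma> a')) \<longrightarrow>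
        inputs_typed P (subst_atom \<sigma> a))"

lemma robust_labelledI:
  assumes "\<And>l a l' a'. (l, a) \<in> S \<Longrightarrow> (l', a') \<in> S \<Longrightarrow> prefix l l' \<Longrightarrow> l = l' \<and> a = a'"
    and "\<And>l a. (l, a) \<in> S \<Longrightarrow> wf_atom P a"
    and "\<And>l a. (l, a) \<in> S \<Longrightarrow> plin (out_pos P (pred a)) (args a)"
    and "\<And>l a k. (l, a) \<in> S \<Longrightarrow> k \<in> out_pos P (pred a) \<Longrightarrow> robust_position P a k"
    and "\<And>l a l' a'. (l, a) \<in> S \<Longrightarrow> (l', a') \<in> S \<Longrightarrow> l \<noteq> l' \<Longrightarrow> ovars P a \<inter> ovars P a' = {}"
    and "\<And>l a l' a'. (l, a) \<in> S \<Longrightarrow> (l', a') \<in> S \<Longrightarrow> l = l' \<or> lx l l' \<Longrightarrow> ivars P a \<inter> ovars P a' = {}"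
    and "\<And>l a \<sigma>. (l, a) \<in> S \<Longrightarrow>
      (\<And>l' a'. (l', a') \<in> S \<Longrightarrow> lx l' l \<Longrightarrow> outputs_typed P (subst_atom \<sigma> a')) \<Longrightarrow>
      inputs_typed P (subst_atom \<sigma> a)"
  shows "robust_labelled P S"
  unfolding robust_labelled_def
  by (intro conjI allI impI) (use assms in \<open>simp; fail\<close>)+

lemma robust_labelledD:
  assumes "robust_labelled P S" "(l, a) \<in> S"
  shows "wf_atom P a" "plin (out_pos P (pred a)) (args a)"
    "\<And>k. k \<in> out_pos P (pred a) \<Longrightarrow> robust_position P a k"
    "ivars P a \<inter> ovars P a = {}"
    "(\<And>l' a'. (l', a') \<in> S \<Longrightarrow> lx l' l \<Longrightarrow> outputs_typed P (subst_atom \<sigma> a')) \<Longrightarrow>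
     inputs_typed P (subst_atom \<sigma> a)"
  using assms by (simp_all add: robust_labelled_def)

lemma robust_labelledD2:
  assumes "robust_labelled P S" "(l, a) \<in> S" "(l', a') \<in> S"
  shows "prefix l l' \<Longrightarrow> l = l'" "l = l' \<Longrightarrow> a = a'"
    "l \<noteq> l' \<Longrightarrow> ovars P a \<inter> ovars P a' = {}"
    "lx l l' \<Longrightarrow> ivars P a \<inter> ovars P a' = {}"
    "l \<noteq> l' \<Longrightarrow> lx l l' \<or> lx l' l"
proof -
  have pr: "prefix l l' \<Longrightarrow> l = l' \<and> a = a'" if "(l, a) \<in> S" "(l', a') \<in> S" for l a l' a'
    using assms(1) that by (simp add: robust_labelled_def)
  show "prefix l l' \<Longrightarrow> l = l'" "l = l' \<Longrightarrow> a = a'"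
    using pr[OF assms(2,3)] by simp_all
  show "l \<noteq> l' \<Longrightarrow> ovars P a \<inter> ovars P a' = {}" "lx l l' \<Longrightarrow> ivars P a \<inter> ovars P a' = {}"
    using assms by (simp_all add: robust_labelled_def)
  show "l \<noteq> l' \<Longrightarrow> lx l l' \<or> lx l' l"
    using pr[OF assms(2,3)] pr[OF assms(3,2)] lx_total[of l l'] by blast
qed

text \<open>Collects, in terms of positions, what the persistence argument takes from a robustly
  typed, input-linear clause. It is a separate notion because it has to be applied to variants of
  program clauses.\<close>

definition robust_clause :: "('p, 'f, 'v) program \<Rightarrow> (nat \<Rightarrow> nat) \<Rightarrow> ('p, 'f, 'v) clause \<Rightarrow> bool" where
  "robust_clause P f c \<longleftrightarrow>
     wf_query P (head c # body c) \<and> f permutes {1..length (body c)} \<and> well_typed_clause P f c \<and>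
     plin (in_pos P (pred (head c))) (args (head c)) \<and>
     (\<forall>k\<in>in_pos P (pred (head c)). robust_position P (head c) k) \<and>
     (\<forall>b\<in>set (body c). plin (out_pos P (pred b)) (args b) \<and> ivars P (head c) \<inter> ovars P b = {} \<and>
        (\<forall>k\<in>out_pos P (pred b). robust_position P b k)) \<and>
     (\<forall>i\<in>{1..length (body c)}. \<forall>j\<in>{1..length (body c)}.
        (i \<noteq> j \<longrightarrow> ovars P (nth1 (body c) i) \<inter> ovars P (nth1 (body c) j) = {}) \<and>
        (f i \<le> f j \<longrightarrow> ivars P (nth1 (body c) i) \<inter> ovars P (nth1 (body c) j) = {})) \<and>
     (\<forall>k\<in>out_pos P (pred (head c)). \<forall>x.
        bound P (pred (head c)) k \<and> args (head c) ! k = Var x \<longrightarrow>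
        (\<exists>l\<in>in_pos P (pred (head c)).
           bound P (pred (head c)) l \<and> args (head c) ! l = Var x) \<or>
        (\<exists>b\<in>set (body c). \<exists>l\<in>out_pos P (pred b).
           bound P (pred b) l \<and>
           ptype P (pred b) ! l = ptype P (pred (head c)) ! k \<and>
           args b ! l = Var x))"

lemma nth1_mem: "i \<in> {1..length B} \<Longrightarrow> nth1 B i \<in> set B"
  by (auto simp: nth1_def)

lemma nth1_map: "i \<in> {1..length B} \<Longrightarrow> nth1 (map g B) i = g (nth1 B i)"
  by (auto simp: nth1_def)

lemma set_nth1: "set B = nth1 B ` {1..length B}"
proof -
  have "B ! k \<in> nth1 B ` {1..length B}" if "k < length B" for k
    using that by (intro image_eqI[of _ _ "Suc k"]) (auto simp: nth1_def)
  then have "set B \<subseteq> nth1 B ` {1..length B}" by (auto simp: set_conv_nth)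
  then show ?thesis using nth1_mem by blast
qed

lemma linear_outputs_query:
  assumes "wf_query P Q" "linear (concat (map (outputs P) Q))"
  shows "\<And>a. a \<in> set Q \<Longrightarrow> plin (out_pos P (pred a)) (args a)"
    and "\<And>i j. i \<in> {1..length Q} \<Longrightarrow> j \<in> {1..length Q} \<Longrightarrow> i \<noteq> j \<Longrightarrow>
      ovars P (nth1 Q i) \<inter> ovars P (nth1 Q j) = {}"
proof -
  define g where "g i = concat (map occs (outputs P (Q ! i)))" for i
  have wf: "wf_atom P a" if "a \<in> set Q" for a using assms(1) that by (auto simp: wf_query_def)
  have "concat (map occs (concat (map (outputs P) Q))) = concat (map (\<lambda>a. concat (map occs (outputs P a))) Q)"
    by (induction Q) auto
  also have "\<dots> = concat (map g [0..<length Q])"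
    by (intro arg_cong[of _ _ concat] nth_equalityI) (auto simp: g_def)
  finally have "distinct (concat (map g [0..<length Q]))" using assms(2) by (simp add: linear_def)
  then have *: "\<And>i. i < length Q \<Longrightarrow> distinct (g i)"
    "\<And>i j. i < length Q \<Longrightarrow> j < length Q \<Longrightarrow> i \<noteq> j \<Longrightarrow> set (g i) \<inter> set (g j) = {}"
    by (simp_all only: distinct_concat_map[OF distinct_upt] set_upt atLeastLessThan_iff Ball_def
        zero_le simp_thms)
  have lin: "linear (outputs P a)" if "a \<in> set Q" for a
    using that *(1) by (auto simp: in_set_conv_nth linear_def g_def)
  show "plin (out_pos P (pred a)) (args a)" if "a \<in> set Q" for a
    using lin that linear_outputs wf by blast
  have g: "set (g i) = ovars P (Q ! i)" if "i < length Q" for i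
    using vars_outputs[OF wf, of "Q ! i"] that by (simp add: g_def vars_trms_def)
  show "ovars P (nth1 Q i) \<inter> ovars P (nth1 Q j) = {}"
    if "i \<in> {1..length Q}" "j \<in> {1..length Q}" "i \<noteq> j" for i j
  proof -
    have "i - 1 < length Q" "j - 1 < length Q" "i - 1 \<noteq> j - 1" using that by auto
    then show ?thesis using *(2)[of "i - 1" "j - 1"] unfolding nth1_def by (simp add: g)
  qed
qed

lemma robust_clause_of_robustly_typed:
  assumes "robustly_typed_clause P f c" "wf_query P (head c # body c)" "input_linear_clause P c"
  shows "robust_clause P f c"
proof -
  have h: "wf_atom P (head c)" and B: "wf_query P (body c)"
    using assms(2) by (auto simp: wf_query_def)
  then have wf: "\<And>b. b \<in> set (body c) \<Longrightarrow> wf_atom P b" by (auto simp: wf_query_def)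
  have nm: "nicely_moded_clause P f c" using assms(1) by (simp add: robustly_typed_clause_def)
  note lin = linear_outputs_query[OF B]
  have "f i \<le> f j \<longrightarrow> ivars P (nth1 (body c) i) \<inter> ovars P (nth1 (body c) j) = {}"
    if "i \<in> {1..length (body c)}" "j \<in> {1..length (body c)}" for i j
    using nm that by (simp add: nicely_moded_clause_def nicely_moded_query_def vars_inputs vars_outputs wf nth1_mem)
  moreover have "ivars P (head c) \<inter> ovars P b = {}" if "b \<in> set (body c)" for b
    using nm that by (simp add: nicely_moded_clause_def vars_inputs vars_outputs wf h)
  moreover have "linear (concat (map (outputs P) (body c)))"
    using nm by (simp add: nicely_moded_clause_def nicely_moded_query_def)
  moreover have "plin (in_pos P (pred (head c))) (args (head c))"
    using assms(3) by (simp add: input_linear_clause_def linear_inputs[OF h])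
  moreover have "(\<exists>l\<in>in_pos P (pred (head c)). bound P (pred (head c)) l \<and> args (head c) ! l = Var x) \<or>
        (\<exists>b\<in>set (body c). \<exists>l\<in>out_pos P (pred b).
           bound P (pred b) l \<and> ptype P (pred b) ! l = ptype P (pred (head c)) ! k \<and> args b ! l = Var x)"
    if "k \<in> out_pos P (pred (head c))" "bound P (pred (head c)) k" "args (head c) ! k = Var x" for k x
    using assms(1) that unfolding robustly_typed_clause_def by metis
  ultimately show ?thesis
    using assms(1,2) lin by (simp add: robust_clause_def robustly_typed_clause_def)
qed


section \<open>Renamings\<close>

text \<open>Relative to a set \<open>X\<close>, because a unifier is a total function whose
  behaviour is controlled only on certain variables.\<close>

definition renames :: "('f, 'v) subst \<Rightarrow> 'v set \<Rightarrow> bool" where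
  "renames \<sigma> X \<longleftrightarrow> (\<forall>x\<in>X. is_var (\<sigma> x)) \<and> inj_on \<sigma> X"

lemma renames_subset: "renames \<sigma> X \<Longrightarrow> Y \<subseteq> X \<Longrightarrow> renames \<sigma> Y"
  by (auto simp: renames_def inj_on_subset)

lemma renamesE:
  assumes "renames \<sigma> X"
  obtains f where "\<And>x. x \<in> X \<Longrightarrow> \<sigma> x = Var (f x)" "inj_on f X"
proof -
  obtain f where f: "\<And>x. x \<in> X \<Longrightarrow> \<sigma> x = Var (f x)" using assms unfolding renames_def is_var_def by metis
  moreover have "inj_on f X" using assms f by (auto simp: renames_def inj_on_def)
  ultimately show ?thesis using that by blast
qed

text \<open>Instances of compound terms are compound, so a substitution with a left inverse can send
  variables only to variables, and never two to the same one.\<close>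

lemma renames_inverseI: "(\<And>x. x \<in> X \<Longrightarrow> subst_trm \<tau> (\<sigma> x) = Var x) \<Longrightarrow> renames \<sigma> X"
  unfolding renames_def inj_on_def by (metis is_var_Var is_var_substD trm.inject(1))

lemma renames_disjoint:
  assumes "renames \<sigma> X" "Y \<subseteq> X" "Z \<subseteq> X" "Y \<inter> Z = {}"
  shows "(\<Union>x\<in>Y. set (occs (\<sigma> x))) \<inter> (\<Union>x\<in>Z. set (occs (\<sigma> x))) = {}"
proof -
  obtain f where f: "\<And>x. x \<in> X \<Longrightarrow> \<sigma> x = Var (f x)" "inj_on f X" using renamesE[OF assms(1)] by blast
  then have "(\<Union>x\<in>W. set (occs (\<sigma> x))) = f ` W" if "W \<subseteq> X" for W using that by fastforce
  then show ?thesis using assms f(2) by (simp add: inj_on_image_Int[symmetric])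
qed

lemma rename_trm:
  assumes "renames \<sigma> (set (occs t))"
  shows "is_var (subst_trm \<sigma> t) \<longleftrightarrow> is_var t" "flat t \<Longrightarrow> flat (subst_trm \<sigma> t)"
    "distinct (occs t) \<Longrightarrow> distinct (occs (subst_trm \<sigma> t))"
    "type_consistent T t \<Longrightarrow> type_consistent T (subst_trm \<sigma> t)"
proof -
  obtain f where f: "\<And>x. x \<in> set (occs t) \<Longrightarrow> \<sigma> x = Var (f x)" "inj_on f (set (occs t))"
    using renamesE[OF assms] by blast
  have eq: "subst_trm \<sigma> t = subst_trm (\<lambda>x. Var (f x)) t" using f by (intro subst_trm_cong) auto
  show "is_var (subst_trm \<sigma> t) \<longleftrightarrow> is_var t" unfolding eq by (cases t) auto
  show "distinct (occs t) \<Longrightarrow> distinct (occs (subst_trm \<sigma> t))"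
    unfolding eq occs_rename using f(2) by (simp add: distinct_map)
  show "flat t \<Longrightarrow> flat (subst_trm \<sigma> t)"
  proof -
    assume "flat t"
    then consider "is_var t" | g xs where "t = Fun g (map Var xs)" "distinct xs" by (auto simp: flat_def)
    then show ?thesis
    proof cases
      case 2
      have "concat (map (\<lambda>x. [x]) xs) = xs" by (induction xs) auto
      then have "distinct (map f xs)" using 2 f(2) by (simp add: distinct_map o_def)
      moreover have "subst_trm \<sigma> t = Fun g (map Var (map f xs))" unfolding eq using 2 by simp
      ultimately show ?thesis unfolding flat_def by blast
    qed (auto simp: eq is_var_def flat_def)
  qed
  assume "type_consistent T t"
  then obtain \<tau> where \<tau>: "subst_trm \<tau> t \<in> T" by (auto simp: type_consistent_def)
  have "subst_trm (\<lambda>y. \<tau> (inv_into (set (occs t)) f y)) (subst_trm \<sigma> t) = subst_trm \<tau> t"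
    unfolding eq subst_trm_subst_trm using f(2) by (intro subst_trm_cong) auto
  then show "type_consistent T (subst_trm \<sigma> t)" using \<tau> unfolding type_consistent_def by metis
qed

lemma args_subst_nth:
  "wf_atom P a \<Longrightarrow> k \<in> in_pos P (pred a) \<Longrightarrow> args (subst_atom \<sigma> a) ! k = subst_trm \<sigma> (args a ! k)"
  "wf_atom P a \<Longrightarrow> k \<in> out_pos P (pred a) \<Longrightarrow> args (subst_atom \<sigma> a) ! k = subst_trm \<sigma> (args a ! k)"
  using io_positions(1,2)[of P a] by (auto simp: subset_iff)

lemma occs_nth_avars:
  "wf_atom P a \<Longrightarrow> k \<in> in_pos P (pred a) \<Longrightarrow> set (occs (args a ! k)) \<subseteq> avars a"
  "wf_atom P a \<Longrightarrow> k \<in> out_pos P (pred a) \<Longrightarrow> set (occs (args a ! k)) \<subseteq> avars a"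
  using avars_io[of P a] by (auto simp: ivars_def ovars_def pvars_def)

lemma rename_robust_position:
  assumes "renames \<sigma> (set (occs (args a ! k)))" "robust_position P a k"
    and "args (subst_atom \<sigma> a) ! k = subst_trm \<sigma> (args a ! k)"
  shows "robust_position P (subst_atom \<sigma> a) k"
  using assms rename_trm[OF assms(1)] by (auto simp: robust_position_def split: if_splits)

lemma rename_plin:
  assumes "renames \<sigma> (pvars A ts)" "plin A ts" "\<And>k. k \<in> A \<Longrightarrow> ss ! k = subst_trm \<sigma> (ts ! k)"
  shows "plin A ss"
  unfolding plin_def
proof (intro conjI ballI impI)
  fix k assume "k \<in> A"
  then have "renames \<sigma> (set (occs (ts ! k)))" using assms(1) by (auto simp: pvars_def intro: renames_subset)
  then show "distinct (occs (ss ! k))" using assms(2,3) \<open>k \<in> A\<close> rename_trm(3) by (fastforce simp: plin_def)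
next
  fix k l assume kl: "k \<in> A" "l \<in> A" "k \<noteq> l"
  then have "set (occs (ts ! k)) \<inter> set (occs (ts ! l)) = {}" using assms(2) by (auto simp: plin_def)
  then show "set (occs (ss ! k)) \<inter> set (occs (ss ! l)) = {}"
    using renames_disjoint[OF assms(1), of "set (occs (ts ! k))" "set (occs (ts ! l))"] kl assms(3)
    by (auto simp: pvars_def set_occs_subst)
qed

lemma rename_atom:
  assumes "renames \<sigma> (avars a)" "wf_atom P a"
  shows "plin (in_pos P (pred a)) (args a) \<Longrightarrow> plin (in_pos P (pred a)) (args (subst_atom \<sigma> a))"
    "plin (out_pos P (pred a)) (args a) \<Longrightarrow> plin (out_pos P (pred a)) (args (subst_atom \<sigma> a))"
    "k \<in> in_pos P (pred a) \<Longrightarrow> robust_position P a k \<Longrightarrow> robust_position P (subst_atom \<sigma> a) k"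
    "k \<in> out_pos P (pred a) \<Longrightarrow> robust_position P a k \<Longrightarrow> robust_position P (subst_atom \<sigma> a) k"
proof -
  have i: "renames \<sigma> (pvars (in_pos P (pred a)) (args a))" and o': "renames \<sigma> (pvars (out_pos P (pred a)) (args a))"
    using assms avars_io[of P a] by (auto intro: renames_subset simp: ivars_def ovars_def)
  show "plin (in_pos P (pred a)) (args a) \<Longrightarrow> plin (in_pos P (pred a)) (args (subst_atom \<sigma> a))"
    using rename_plin[OF i] args_subst_nth(1)[OF assms(2)] by blast
  show "plin (out_pos P (pred a)) (args a) \<Longrightarrow> plin (out_pos P (pred a)) (args (subst_atom \<sigma> a))"
    using rename_plin[OF o'] args_subst_nth(2)[OF assms(2)] by blast
  show "k \<in> in_pos P (pred a) \<Longrightarrow> robust_position P a k \<Longrightarrow> robust_position P (subst_atom \<sigma> a) k"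
    using renames_subset[OF assms(1) occs_nth_avars(1)[OF assms(2)]] args_subst_nth(1)[OF assms(2)]
      rename_robust_position by blast
  show "k \<in> out_pos P (pred a) \<Longrightarrow> robust_position P a k \<Longrightarrow> robust_position P (subst_atom \<sigma> a) k"
    using renames_subset[OF assms(1) occs_nth_avars(2)[OF assms(2)]] args_subst_nth(2)[OF assms(2)]
      rename_robust_position by blast
qed

lemma rename_disjoint_atoms:
  assumes "renames \<sigma> (avars a \<union> avars b)" "wf_atom P a" "wf_atom P b"
  shows "ovars P a \<inter> ovars P b = {} \<Longrightarrow> ovars P (subst_atom \<sigma> a) \<inter> ovars P (subst_atom \<sigma> b) = {}"
    "ivars P a \<inter> ovars P b = {} \<Longrightarrow> ivars P (subst_atom \<sigma> a) \<inter> ovars P (subst_atom \<sigma> b) = {}"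
  using renames_disjoint[OF assms(1), of "ovars P a" "ovars P b"]
    renames_disjoint[OF assms(1), of "ivars P a" "ovars P b"] assms(2,3)
  by (auto simp: ovars_subst ivars_subst avars_io)

section \<open>Labelled queries under substitution, resolution and renaming\<close>

definition apply_labelled :: "('f, 'v) subst \<Rightarrow> ('p, 'f, 'v) lquery \<Rightarrow> ('p, 'f, 'v) lquery" where
  "apply_labelled \<sigma> S = (\<lambda>(l, a). (l, subst_atom \<sigma> a)) ` S"

text \<open>Children are numbered by \<open>f\<close> and not by their place in the text, so that
  \<open>lx\<close> orders siblings by data flow.\<close>

definition expand ::
  "('p, 'f, 'v) lquery \<Rightarrow> nat list \<Rightarrow> (nat \<Rightarrow> nat) \<Rightarrow> ('p, 'f, 'v) query \<Rightarrow> ('p, 'f, 'v) lquery" where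
  "expand S w f B = {(l, b) \<in> S. l \<noteq> w} \<union> (\<lambda>j. (w @ [f j], nth1 B j)) ` {1..length B}"

lemma apply_labelled_apply_labelled:
  "apply_labelled \<tau> (apply_labelled \<sigma> S) = apply_labelled (subst_comp \<sigma> \<tau>) S"
  by (force simp: apply_labelled_def subst_atom_subst_comp)

lemma mem_apply_labelled: "(l, b) \<in> apply_labelled \<sigma> S \<longleftrightarrow> (\<exists>a. (l, a) \<in> S \<and> b = subst_atom \<sigma> a)"
  by (auto simp: apply_labelled_def)

lemma robust_labelled_rename:
  assumes "robust_labelled P S" "renames \<sigma> (\<Union>(l, a)\<in>S. avars a)"
  shows "robust_labelled P (apply_labelled \<sigma> S)"
proof -
  have r: "renames \<sigma> (avars a \<union> avars b)" if "(l, a) \<in> S" "(l', b) \<in> S" for l a l' b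
    by (rule renames_subset[OF assms(2)]) (use that in auto)
  have r1: "renames \<sigma> (avars a)" if "(l, a) \<in> S" for l a
    by (rule renames_subset[OF assms(2)]) (use that in auto)
  note D = robust_labelledD[OF assms(1)] and D2 = robust_labelledD2[OF assms(1)]
  show ?thesis
  proof (rule robust_labelledI, unfold mem_apply_labelled; (elim exE conjE)?; hypsubst?)
    fix l a l' a' assume a: "(l, a) \<in> S" "(l', a') \<in> S"
    show "l = l' \<and> subst_atom \<sigma> a = subst_atom \<sigma> a'" if "prefix l l'" using D2(1,2)[OF a] that by blast
    show "ovars P (subst_atom \<sigma> a) \<inter> ovars P (subst_atom \<sigma> a') = {}" if "l \<noteq> l'"
      using rename_disjoint_atoms(1)[OF r D(1) D(1)] a D2(3)[OF a that] by blast
    show "ivars P (subst_atom \<sigma> a) \<inter> ovars P (subst_atom \<sigma> a') = {}" if "l = l' \<or> lx l l'"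
    proof (rule rename_disjoint_atoms(2)[OF r D(1) D(1)])
      show "ivars P a \<inter> ovars P a' = {}" using that D2(2,4)[OF a] D(4)[OF a(1)] by blast
    qed (use a in blast)+
  next
    fix l a assume a: "(l, a) \<in> S"
    show "wf_atom P (subst_atom \<sigma> a)" using D(1)[OF a] by simp
    show "plin (out_pos P (pred (subst_atom \<sigma> a))) (args (subst_atom \<sigma> a))"
      using rename_atom(2)[OF r1 D(1)] a D(2)[OF a] unfolding pred_subst_atom by blast
    show "robust_position P (subst_atom \<sigma> a) k" if "k \<in> out_pos P (pred (subst_atom \<sigma> a))" for k
      using rename_atom(4)[OF r1 D(1)] a D(3)[OF a] that unfolding pred_subst_atom by blast
  next
    fix l a \<tau> assume a: "(l, a) \<in> S"
      "\<And>l' a'. \<exists>b. (l', b) \<in> S \<and> a' = subst_atom \<sigma> b \<Longrightarrow> lx l' l \<Longrightarrow> outputs_typed P (subst_atom \<tau> a')"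
    show "inputs_typed P (subst_atom \<tau> (subst_atom \<sigma> a))"
      using D(5)[OF a(1), of "subst_comp \<sigma> \<tau>"] a(2) unfolding subst_atom_subst_comp by blast
  qed
qed

lemma well_typed_clause_subst:
  assumes "well_typed_clause P f c"
  shows "well_typed_clause P f (subst_clause \<sigma> c)"
proof -
  have *: "subst_atom \<tau> (nth1 (map (subst_atom \<sigma>) (body c)) j) = subst_atom (subst_comp \<sigma> \<tau>) (nth1 (body c) j)"
    if "j \<in> {1..length (body c)}" for \<tau> j
    using that by (simp add: nth1_map subst_atom_subst_comp)
  have **: "subst_atom \<tau> (subst_atom \<sigma> (head c)) = subst_atom (subst_comp \<sigma> \<tau>) (head c)" for \<tau>
    by (simp add: subst_atom_subst_comp)
  show ?thesis
    unfolding well_typed_clause_def subst_clause_def subst_query_def clause.sel length_map **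
  proof (intro conjI ballI allI impI; elim conjE)
    fix i \<tau>
    assume i: "i \<in> {1..length (body c)}" and "inputs_typed P (subst_atom (subst_comp \<sigma> \<tau>) (head c))"
      "\<forall>j\<in>{1..length (body c)}. f j < f i \<longrightarrow>
        outputs_typed P (subst_atom \<tau> (nth1 (map (subst_atom \<sigma>) (body c)) j))"
    then have "inputs_typed P (subst_atom (subst_comp \<sigma> \<tau>) (nth1 (body c) i))"
      using assms i * unfolding well_typed_clause_def by auto
    then show "inputs_typed P (subst_atom \<tau> (nth1 (map (subst_atom \<sigma>) (body c)) i))" using i * by simp
  next
    fix \<tau>
    assume "inputs_typed P (subst_atom (subst_comp \<sigma> \<tau>) (head c))"
      "\<forall>j\<in>{1..length (body c)}. outputs_typed P (subst_atom \<tau> (nth1 (map (subst_atom \<sigma>) (body c)) j))"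
    then show "outputs_typed P (subst_atom (subst_comp \<sigma> \<tau>) (head c))"
      using assms * unfolding well_typed_clause_def by auto
  qed
qed

text \<open>The composition of the two substitutions that witness a variant fixes all variables of
  \<open>d\<close>. Hence the first one is a renaming on \<open>d\<close>, and every condition can
  be transported along it.\<close>

lemma robust_clause_variant:
  assumes "robust_clause P f d" "variant c d"
  shows "robust_clause P f c"
proof -
  obtain \<sigma> \<tau> where c: "c = subst_clause \<sigma> d" and d: "d = subst_clause \<tau> c"
    using assms(2) by (auto simp: variant_def)
  have "subst_clause (subst_comp \<sigma> \<tau>) d = subst_clause \<tau> c"
    unfolding c by (simp add: subst_clause_def subst_query_def subst_atom_subst_comp)
  then have eq: "subst_clause (subst_comp \<sigma> \<tau>) d = d" by (rule trans[OF _ d[symmetric]])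
  have "subst_atom (subst_comp \<sigma> \<tau>) (head d) = head d"
    using arg_cong[OF eq, of head] by (simp add: subst_clause_def)
  moreover have "map (subst_atom (subst_comp \<sigma> \<tau>)) (body d) = map (\<lambda>a. a) (body d)"
    using arg_cong[OF eq, of body] by (simp add: subst_clause_def subst_query_def)
  ultimately have fx: "subst_atom (subst_comp \<sigma> \<tau>) a = subst_atom Var a" if "a = head d \<or> a \<in> set (body d)" for a
    using that unfolding map_eq_conv by auto
  have "subst_trm \<tau> (\<sigma> x) = Var x" if "x \<in> vars_clause d" for x
    using that fx unfolding vars_clause_avars vars_query_avars subst_atom_cong_iff subst_comp_def by blast
  then have ren: "renames \<sigma> (vars_clause d)" by (rule renames_inverseI)
  have hd: "head c = subst_atom \<sigma> (head d)" and bd: "body c = map (subst_atom \<sigma>) (body d)"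
    by (auto simp: c subst_clause_def subst_query_def)
  have wf: "\<And>a. a = head d \<or> a \<in> set (body d) \<Longrightarrow> wf_atom P a"
    using assms(1) by (auto simp: robust_clause_def wf_query_def)
  have r: "renames \<sigma> (avars a \<union> avars b)" if "a = head d \<or> a \<in> set (body d)" "b = head d \<or> b \<in> set (body d)" for a b
    by (rule renames_subset[OF ren]) (use that in \<open>auto simp: vars_clause_avars vars_query_avars\<close>)
  have r1: "renames \<sigma> (avars a)" if "a = head d \<or> a \<in> set (body d)" for a
    using r[OF that that] by simp
  show ?thesis
    unfolding robust_clause_def
  proof (intro conjI, goal_cases)
    case 1
    then show ?case using wf by (auto simp: hd bd wf_query_def)
  next
    case 2
    then show ?case using assms(1) by (simp add: bd robust_clause_def)
  next
    case 3
    then show ?case using assms(1) well_typed_clause_subst by (auto simp: c robust_clause_def)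
  next
    case 4
    then show ?case using assms(1) rename_atom(1)[OF r1 wf, of "head d"] by (simp add: hd robust_clause_def)
  next
    case 5
    then show ?case using assms(1) rename_atom(3)[OF r1 wf, of "head d"] by (simp add: hd robust_clause_def)
  next
    case 6
    show ?case
    proof
      fix b assume "b \<in> set (body c)"
      then obtain b' where b: "b' \<in> set (body d)" "b = subst_atom \<sigma> b'" by (auto simp: bd)
      then show "plin (out_pos P (pred b)) (args b) \<and> ivars P (head c) \<inter> ovars P b = {} \<and>
          (\<forall>k\<in>out_pos P (pred b). robust_position P b k)"
        using assms(1) rename_atom(2,4)[OF r1 wf, of b'] rename_disjoint_atoms(2)[OF r wf wf, of "head d" b']
        by (simp add: hd robust_clause_def)
    qed
  next
    case 7
    have "(i \<noteq> j \<longrightarrow> ovars P (nth1 (body c) i) \<inter> ovars P (nth1 (body c) j) = {}) \<and>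
        (f i \<le> f j \<longrightarrow> ivars P (nth1 (body c) i) \<inter> ovars P (nth1 (body c) j) = {})"
      if "i \<in> {1..length (body d)}" "j \<in> {1..length (body d)}" for i j
      using that assms(1) rename_disjoint_atoms[OF r wf wf, of "nth1 (body d) i" "nth1 (body d) j"]
        nth1_mem[OF that(1)] nth1_mem[OF that(2)]
      by (simp add: robust_clause_def bd nth1_map)
    then show ?case by (simp add: bd)
  next
    case 8
    show ?case
    proof (intro ballI allI impI, elim conjE)
      fix k x assume kx: "k \<in> out_pos P (pred (head c))" "bound P (pred (head c)) k" "args (head c) ! k = Var x"
      have h: "wf_atom P (head d)" using wf by simp
      have k: "k \<in> out_pos P (pred (head d))" using kx by (simp add: hd)
      have "\<sigma> ` set (occs (args (head d) ! k)) = {Var x}" and "is_var (args (head d) ! k)"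
        using kx args_subst_nth(2)[OF h k, of \<sigma>] is_var_substD[of \<sigma> "args (head d) ! k"]
        by (auto simp: hd is_var_def simp del: args_subst_atom)
      then obtain y where y: "args (head d) ! k = Var y" "\<sigma> y = Var x" by (auto simp: is_var_def)
      have "(\<exists>l\<in>in_pos P (pred (head d)). bound P (pred (head d)) l \<and> args (head d) ! l = Var y) \<or>
        (\<exists>b\<in>set (body d). \<exists>l\<in>out_pos P (pred b). bound P (pred b) l \<and>
           ptype P (pred b) ! l = ptype P (pred (head d)) ! k \<and> args b ! l = Var y)"
        using assms(1) k kx(2) y(1) by (simp add: robust_clause_def hd)
      then show "(\<exists>l\<in>in_pos P (pred (head c)). bound P (pred (head c)) l \<and> args (head c) ! l = Var x) \<or>
        (\<exists>b\<in>set (body c). \<exists>l\<in>out_pos P (pred b). bound P (pred b) l \<and>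
           ptype P (pred b) ! l = ptype P (pred (head c)) ! k \<and> args b ! l = Var x)"
      proof (elim disjE bexE conjE)
        fix l assume "l \<in> in_pos P (pred (head d))" "bound P (pred (head d)) l" "args (head d) ! l = Var y"
        then show ?thesis using args_subst_nth(1)[OF h, of l \<sigma>] y(2) by (auto simp: hd simp del: args_subst_atom)
      next
        fix b l assume "b \<in> set (body d)" "l \<in> out_pos P (pred b)" "bound P (pred b) l"
          "ptype P (pred b) ! l = ptype P (pred (head d)) ! k" "args b ! l = Var y"
        then show ?thesis using args_subst_nth(2)[OF wf, of b l \<sigma>] y(2)
          by (intro disjI2 bexI[of _ "subst_atom \<sigma> b"] bexI[of _ l]) (auto simp: hd bd simp del: args_subst_atom)
      qed
    qed
  qed
qed

section \<open>Persistence of robust typedness\<close>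

lemma mem_expand:
  "(l, b) \<in> expand S w f B \<longleftrightarrow>
     (l, b) \<in> S \<and> l \<noteq> w \<or> (\<exists>j\<in>{1..length B}. l = w @ [f j] \<and> b = nth1 B j)"
  by (auto simp: expand_def)

lemma mem_step_old:
  "(l, b) \<in> S \<Longrightarrow> l \<noteq> w \<Longrightarrow> (l, subst_atom \<theta> b) \<in> apply_labelled \<theta> (expand S w f B)"
  unfolding mem_apply_labelled mem_expand by blast

lemma mem_step_new:
  "j \<in> {1..length B} \<Longrightarrow> (w @ [f j], subst_atom \<theta> (nth1 B j)) \<in> apply_labelled \<theta> (expand S w f B)"
  unfolding mem_apply_labelled mem_expand by blast

lemma concat_map_concat: "concat (map h (concat xss)) = concat (map (\<lambda>xs. concat (map h xs)) xss)"
  by (induction xss) auto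

lemma occs_subst: "occs (subst_trm \<sigma> t) = concat (map (\<lambda>x. occs (\<sigma> x)) (occs t))"
proof (induction t)
  case (Fun g ts)
  have "concat (map (occs \<circ> subst_trm \<sigma>) ts) =
      concat (map ((\<lambda>xs. concat (map (\<lambda>x. occs (\<sigma> x)) xs)) \<circ> occs) ts)"
    using Fun by (intro arg_cong[of _ _ concat]) auto
  then show ?case by (simp add: concat_map_concat)
qed simp

lemma robust_clauseD:
  assumes "robust_clause P f c"
  shows "wf_atom P (head c)" "\<And>b. b \<in> set (body c) \<Longrightarrow> wf_atom P b"
    "f permutes {1..length (body c)}" "well_typed_clause P f c"
    "plin (in_pos P (pred (head c))) (args (head c))"
    "\<And>k. k \<in> in_pos P (pred (head c)) \<Longrightarrow> robust_position P (head c) k"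
    "\<And>b. b \<in> set (body c) \<Longrightarrow> plin (out_pos P (pred b)) (args b)"
    "\<And>b. b \<in> set (body c) \<Longrightarrow> ivars P (head c) \<inter> ovars P b = {}"
    "\<And>b k. b \<in> set (body c) \<Longrightarrow> k \<in> out_pos P (pred b) \<Longrightarrow> robust_position P b k"
    "\<And>i j. i \<in> {1..length (body c)} \<Longrightarrow> j \<in> {1..length (body c)} \<Longrightarrow> i \<noteq> j \<Longrightarrow>
       ovars P (nth1 (body c) i) \<inter> ovars P (nth1 (body c) j) = {}"
    "\<And>i j. i \<in> {1..length (body c)} \<Longrightarrow> j \<in> {1..length (body c)} \<Longrightarrow> f i \<le> f j \<Longrightarrow>
       ivars P (nth1 (body c) i) \<inter> ovars P (nth1 (body c) j) = {}"
    "\<And>k x. k \<in> out_pos P (pred (head c)) \<Longrightarrow> bound P (pred (head c)) k \<Longrightarrow> args (head c) ! k = Var x \<Longrightarrow>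
        (\<exists>l\<in>in_pos P (pred (head c)).
           bound P (pred (head c)) l \<and> args (head c) ! l = Var x) \<or>
        (\<exists>b\<in>set (body c). \<exists>l\<in>out_pos P (pred b).
           bound P (pred b) l \<and>
           ptype P (pred b) ! l = ptype P (pred (head c)) ! k \<and>
           args b ! l = Var x)"
  using assms by (simp_all add: robust_clause_def wf_query_def)

lemma ovars_nth: "k \<in> out_pos P (pred a) \<Longrightarrow> set (occs (args a ! k)) \<subseteq> ovars P a"
  and ivars_nth: "k \<in> in_pos P (pred a) \<Longrightarrow> set (occs (args a ! k)) \<subseteq> ivars P a"
  by (auto simp: ovars_def ivars_def pvars_def)

lemma avars_vars_clause:
  "avars (head c) \<subseteq> vars_clause c" "b \<in> set (body c) \<Longrightarrow> avars b \<subseteq> vars_clause c"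
  by (auto simp: vars_clause_avars vars_query_avars)

text \<open>Only the selected atom needs an argument. The atoms before it type its inputs, hence
  those of the clause head; the typed outputs of the body then yield a typed output of the head,
  which is that of the atom. This direction later carries typing from a late stage back to an early
  one.\<close>

lemma outputs_typed_backwards:
  assumes rl: "robust_labelled P S" and wa: "(w, a) \<in> S" and rc: "robust_clause P f c"
    and uni: "subst_atom \<theta> a = subst_atom \<theta> (head c)"
    and typed: "\<And>l b. (l, b) \<in> apply_labelled \<theta> (expand S w f (body c)) \<Longrightarrow> lx l \<alpha> \<Longrightarrow>
      outputs_typed P (subst_atom \<sigma> b)"
    and lb: "(l, b) \<in> S" "lx l \<alpha>"
  shows "outputs_typed P (subst_atom \<sigma> (subst_atom \<theta> b))"
proof (cases "l = w")
  case False
  then show ?thesis using typed lb by (auto simp: mem_apply_labelled mem_expand)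
next
  case True
  then have b: "b = a" using robust_labelledD2(2)[OF rl lb(1) wa] by simp
  define \<tau> where "\<tau> = subst_comp \<theta> \<sigma>"
  have "inputs_typed P (subst_atom \<tau> a)"
  proof (rule robust_labelledD(5)[OF rl wa])
    fix l' a' assume l': "(l', a') \<in> S" "lx l' w"
    then have "l' \<noteq> w" by auto
    then show "outputs_typed P (subst_atom \<tau> a')"
      using typed[of l' "subst_atom \<theta> a'"] l' lb(2) True lx_trans
      by (auto simp: mem_apply_labelled mem_expand \<tau>_def subst_atom_subst_comp)
  qed
  then have "inputs_typed P (subst_atom \<tau> (head c))" using uni by (simp add: \<tau>_def subst_atom_subst_comp)
  moreover have "outputs_typed P (subst_atom \<tau> (nth1 (body c) j))" if "j \<in> {1..length (body c)}" for j
    using typed[OF mem_step_new[OF that]] lb(2) True lx_append[of w \<alpha> "[f j]" "[]"]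
    by (simp add: \<tau>_def subst_atom_subst_comp)
  ultimately have "outputs_typed P (subst_atom \<tau> (head c))"
    using robust_clauseD(4)[OF rc] unfolding well_typed_clause_def by blast
  then show ?thesis using uni by (simp add: \<tau>_def subst_atom_subst_comp b)
qed

text \<open>For an old atom, \<open>outputs_typed_backwards\<close> restores the premises that held
  before the step. For a body atom, the atoms before \<open>w\<close> type the inputs of the head,
  and the siblings with smaller labels supply the other premises of well-typedness.\<close>

lemma inputs_typed_step:
  assumes rl: "robust_labelled P S" and wa: "(w, a) \<in> S" and rc: "robust_clause P f c"
    and uni: "subst_atom \<theta> a = subst_atom \<theta> (head c)"
    and lb: "(l, b) \<in> apply_labelled \<theta> (expand S w f (body c))"
    and typed: "\<And>l' b'. (l', b') \<in> apply_labelled \<theta> (expand S w f (body c)) \<Longrightarrow> lx l' l \<Longrightarrow>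
      outputs_typed P (subst_atom \<sigma> b')"
  shows "inputs_typed P (subst_atom \<sigma> b)"
proof -
  obtain b' where b: "b = subst_atom \<theta> b'" "(l, b') \<in> expand S w f (body c)"
    using lb by (auto simp: mem_apply_labelled)
  show ?thesis
    using b(2) unfolding mem_expand
  proof (elim disjE bexE conjE)
    assume l: "(l, b') \<in> S" "l \<noteq> w"
    have "inputs_typed P (subst_atom (subst_comp \<theta> \<sigma>) b')"
      using outputs_typed_backwards[OF rl wa rc uni typed]
      by (intro robust_labelledD(5)[OF rl l(1)]) (simp add: subst_atom_subst_comp)
    then show ?thesis by (simp add: b subst_atom_subst_comp)
  next
    fix j assume j: "j \<in> {1..length (body c)}" "l = w @ [f j]" "b' = nth1 (body c) j"
    have "inputs_typed P (subst_atom (subst_comp \<theta> \<sigma>) a)"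
    proof (rule robust_labelledD(5)[OF rl wa])
      fix l' a' assume l': "(l', a') \<in> S" "lx l' w"
      then have "l' \<noteq> w" by auto
      then show "outputs_typed P (subst_atom (subst_comp \<theta> \<sigma>) a')"
        using typed[of l' "subst_atom \<theta> a'"] l' j(2) lx_append[of l' w "[]" "[f j]"]
        by (auto simp: mem_apply_labelled mem_expand subst_atom_subst_comp)
    qed
    then have "inputs_typed P (subst_atom (subst_comp \<theta> \<sigma>) (head c))" using uni by (simp add: subst_atom_subst_comp)
    moreover have "outputs_typed P (subst_atom (subst_comp \<theta> \<sigma>) (nth1 (body c) i))"
      if "i \<in> {1..length (body c)}" "f i < f j" for i
      using typed[OF mem_step_new[OF that(1)]] that(2) j(2) by (simp add: subst_atom_subst_comp)
    ultimately have "inputs_typed P (subst_atom (subst_comp \<theta> \<sigma>) (nth1 (body c) j))"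
      using robust_clauseD(4)[OF rc] j(1) unfolding well_typed_clause_def by blast
    then show ?thesis by (simp add: b j subst_atom_subst_comp)
  qed
qed

text \<open>From here on the unifier of \<open>canonical_mgu\<close> is known only through these
  properties. The last one says which variables can still move: those that alone fill an output
  position of the head opposite to a compound term.\<close>

locale canonical_step =
  fixes P :: "('p, 'f, 'v) program" and S :: "('p, 'f, 'v) lquery" and w :: "nat list"
    and a :: "('p, 'f, 'v) atom" and f :: "nat \<Rightarrow> nat" and c :: "('p, 'f, 'v) clause"
    and \<theta>0 :: "('f, 'v) subst"
  assumes rl: "robust_labelled P S" and wa: "(w, a) \<in> S" and rc: "robust_clause P f c"
    and fresh: "\<And>l b. (l, b) \<in> S \<Longrightarrow> vars_clause c \<inter> avars b = {}"
    and unifies: "unifier \<theta>0 a (head c)"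
    and general: "\<And>\<chi> x. unifier \<chi> a (head c) \<Longrightarrow> \<chi> x = subst_trm \<chi> (\<theta>0 x)"
    and on_inputs: "\<And>x. x \<in> ivars P (head c) \<Longrightarrow> set (occs (\<theta>0 x)) \<subseteq> ivars P a"
    and on_outputs: "\<And>x. x \<in> ovars P a \<Longrightarrow> set (occs (\<theta>0 x)) \<subseteq> avars a \<union> avars (head c)"
    and elsewhere: "\<And>x. x \<notin> ovars P a \<Longrightarrow> x \<notin> ivars P (head c) \<Longrightarrow> \<theta>0 x = Var x \<or>
      (\<exists>k\<in>out_pos P (pred a). bound P (pred a) k \<and> args (head c) ! k = Var x \<and> \<theta>0 x = args a ! k \<and>
        \<not> is_var (args a ! k))"

lemma canonical_step_exists:
  assumes rl: "robust_labelled P S" and wa: "(w, a) \<in> S" and rc: "robust_clause P f c"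
    and fresh: "\<And>l b. (l, b) \<in> S \<Longrightarrow> vars_clause c \<inter> avars b = {}"
    and uni: "unifier \<theta> a (head c)"
    and inp: "\<And>k. k \<in> in_pos P (pred a) \<Longrightarrow> bound P (pred a) k \<Longrightarrow> \<not> is_var (args a ! k)"
  obtains \<theta>0 where "canonical_step P S w a f c \<theta>0"
proof -
  note D = robust_labelledD[OF rl wa] and C = robust_clauseD[OF rc]
  obtain \<theta>0 where "unifier \<theta>0 a (head c)"
    and "\<And>\<chi> x. unifier \<chi> a (head c) \<Longrightarrow> \<chi> x = subst_trm \<chi> (\<theta>0 x)"
    and "\<And>x. x \<in> ivars P (head c) \<Longrightarrow> set (occs (\<theta>0 x)) \<subseteq> ivars P a"
    and "\<And>x. x \<in> ovars P a \<Longrightarrow> set (occs (\<theta>0 x)) \<subseteq> avars a \<union> avars (head c)"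
    and "\<And>x. x \<notin> ovars P a \<Longrightarrow> x \<notin> ivars P (head c) \<Longrightarrow> \<theta>0 x = Var x \<or>
      (\<exists>k\<in>out_pos P (pred a). bound P (pred a) k \<and> args (head c) ! k = Var x \<and> \<theta>0 x = args a ! k \<and>
        \<not> is_var (args a ! k))"
  proof (rule canonical_mgu[OF D(1) C(1) uni C(5) D(2) C(6) D(3) inp D(4)])
    show "avars a \<inter> avars (head c) = {}" using fresh[OF wa] avars_vars_clause(1)[of c] by blast
    fix k x assume k: "k \<in> out_pos P (pred (head c))" "bound P (pred (head c)) k" "args (head c) ! k = Var x"
      and x: "x \<in> ivars P (head c)"
    \<comment> \<open>Input variables of the head do not occur in outputs of the body, so of the two
      alternatives in the last condition on clauses only the one about head inputs remains.\<close>
    have "x \<notin> ovars P b" if "b \<in> set (body c)" for b using C(8)[OF that] x by blast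
    then have "\<not> (\<exists>b\<in>set (body c). \<exists>l\<in>out_pos P (pred b). args b ! l = Var x)"
      by (auto simp: ovars_def pvars_def) (metis list.set_intros(1) occs.simps(1))
    then show "\<exists>l\<in>in_pos P (pred (head c)). bound P (pred (head c)) l \<and> args (head c) ! l = Var x"
      using C(12)[OF k] by blast
  qed (assumption | blast)+
  then have "canonical_step P S w a f c \<theta>0" using rl wa rc fresh by (simp add: canonical_step_def)
  then show ?thesis by (rule that)
qed

section \<open>What the canonical unifier fixes, moves and preserves\<close>

context canonical_step
begin

lemmas C = robust_clauseD[OF rc]

lemma wf_a: "wf_atom P a" using robust_labelledD(1)[OF rl wa] .

lemma head_vars: "ivars P (head c) \<subseteq> vars_clause c" "ovars P (head c) \<subseteq> vars_clause c"
  using avars_io[OF C(1)] avars_vars_clause(1)[of c] by auto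

lemma body_vars: "b \<in> set (body c) \<Longrightarrow> ivars P b \<subseteq> vars_clause c"
  "b \<in> set (body c) \<Longrightarrow> ovars P b \<subseteq> vars_clause c"
  using avars_io[OF C(2)] avars_vars_clause(2)[of b c] by auto

lemma old_vars: "(l, b) \<in> S \<Longrightarrow> ivars P b \<subseteq> avars b" "(l, b) \<in> S \<Longrightarrow> ovars P b \<subseteq> avars b"
  using avars_io robust_labelledD(1)[OF rl] by blast+

lemma length_args: "pred (head c) = pred a" "length (args (head c)) = length (args a)"
  using unifies by (auto simp: unifier_def subst_atom_def dest: map_eq_imp_length_eq)

lemma fixed: "x \<notin> ovars P a \<Longrightarrow> x \<notin> vars_clause c \<Longrightarrow> \<theta>0 x = Var x"
  using elsewhere[of x] head_vars ovars_nth[of _ P "head c"] length_args by fastforce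

text \<open>\<open>general\<close> for the unifier \<open>\<theta>0\<close> itself is
  idempotence.\<close>

lemma range_fixed: "y \<in> set (occs (\<theta>0 x)) \<Longrightarrow> \<theta>0 y = Var y"
  using general[OF unifies, of x] subst_fixD by metis

lemma fixed_old: "(l, b) \<in> S \<Longrightarrow> x \<in> avars b \<Longrightarrow> x \<notin> ovars P a \<Longrightarrow> \<theta>0 x = Var x"
  using fixed fresh by blast

lemma range_vars: "set (occs (\<theta>0 x)) \<subseteq> insert x (avars a \<union> vars_clause c)"
proof (cases "x \<in> ovars P a")
  case True
  then show ?thesis using on_outputs avars_vars_clause(1)[of c] by blast
next
  case False
  show ?thesis
  proof (cases "x \<in> ivars P (head c)")
    case True
    then show ?thesis using on_inputs old_vars(1)[OF wa] by blast
  next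
    case F: False
    then show ?thesis using elsewhere[OF False F] ovars_nth[of _ P a] old_vars(2)[OF wa] by force
  qed
qed

lemma clause_range:
  assumes "x \<in> vars_clause c" "x \<notin> ivars P (head c)"
  shows "set (occs (\<theta>0 x)) \<subseteq> insert x (ovars P a)"
  using elsewhere[of x] assms fresh[OF wa] old_vars(2)[OF wa] ovars_nth[of _ P a] by force

lemma clause_distinct:
  assumes "x \<in> vars_clause c" "x \<notin> ivars P (head c)"
  shows "distinct (occs (\<theta>0 x))"
  using elsewhere[of x] assms fresh[OF wa] old_vars(2)[OF wa] robust_labelledD(2)[OF rl wa]
  by (fastforce simp: plin_def)

text \<open>Clause variables that move are sent to terms in different output positions of
  \<open>a\<close>, which share no variables; those that stay do not occur in \<open>a\<close> at
  all. This keeps the outputs of the body linear.\<close>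

lemma clause_disjoint:
  assumes "x \<in> vars_clause c" "x \<notin> ivars P (head c)" "y \<in> vars_clause c" "y \<notin> ivars P (head c)" "x \<noteq> y"
  shows "set (occs (\<theta>0 x)) \<inter> set (occs (\<theta>0 y)) = {}"
proof -
  have c: "x \<notin> ovars P a" "y \<notin> ovars P a" using assms fresh[OF wa] old_vars(2)[OF wa] by auto
  from elsewhere[OF c(1) assms(2)] elsewhere[OF c(2) assms(4)] show ?thesis
  proof (elim disjE bexE conjE)
    fix k l assume k: "k \<in> out_pos P (pred a)" "args (head c) ! k = Var x" "\<theta>0 x = args a ! k"
      and l: "l \<in> out_pos P (pred a)" "args (head c) ! l = Var y" "\<theta>0 y = args a ! l"
    then have "k \<noteq> l" using assms(5) by auto
    then show ?thesis using k l robust_labelledD(2)[OF rl wa] by (auto simp: plin_def)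
  qed (use assms(5) c ovars_nth[of _ P a] in force)+
qed

text \<open>By the last condition on clauses, an output variable of the body which is bound by the
  output of the selected atom fills a whole bound output position.\<close>

lemma rebound:
  assumes "b \<in> set (body c)" "k \<in> out_pos P (pred b)" "x \<in> set (occs (args b ! k))" "\<theta>0 x \<noteq> Var x"
  shows "bound P (pred b) k \<and> args b ! k = Var x \<and> flat (\<theta>0 x) \<and> type_consistent (ptype P (pred b) ! k) (\<theta>0 x)"
proof -
  have x: "x \<in> ovars P b" using ovars_nth[OF assms(2)] assms(3) by blast
  then have xc: "x \<in> vars_clause c" and xi: "x \<notin> ivars P (head c)"
    using body_vars(2)[OF assms(1)] C(8)[OF assms(1)] by auto
  then have "x \<notin> ovars P a" using fresh[OF wa] old_vars(2)[OF wa] by blast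
  with assms(4) elsewhere xi obtain m where m: "m \<in> out_pos P (pred a)" "bound P (pred a) m"
    "args (head c) ! m = Var x" "\<theta>0 x = args a ! m" by blast
  have "\<not> (\<exists>l\<in>in_pos P (pred (head c)). args (head c) ! l = Var x)"
    using xi by (auto simp: ivars_def pvars_def)
  \<comment> \<open>The condition on clauses offers a head input or a body output, and the former
    has just been excluded. Linearity of the body outputs identifies the position found with
    position \<open>k\<close> of \<open>b\<close>, so the arriving term is consistent with the type
    required there.\<close>
  then obtain b' l where b': "b' \<in> set (body c)" "l \<in> out_pos P (pred b')" "bound P (pred b') l"
    "ptype P (pred b') ! l = ptype P (pred a) ! m" "args b' ! l = Var x"
    using C(12)[of m x] m length_args by auto
  have x': "x \<in> ovars P b'" using ovars_nth[OF b'(2)] b'(5) by simp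
  obtain i j where ij: "i \<in> {1..length (body c)}" "b = nth1 (body c) i" "j \<in> {1..length (body c)}" "b' = nth1 (body c) j"
    using assms(1) b'(1) by (auto simp: set_nth1 simp del: atLeastAtMost_iff)
  then have bb: "b' = b" using C(10)[of i j] x x' by auto
  have lk: "l = k"
  proof (rule ccontr)
    assume "l \<noteq> k"
    then have "set (occs (args b ! l)) \<inter> set (occs (args b ! k)) = {}"
      using C(7)[OF assms(1)] b'(2) bb assms(2) by (simp add: plin_def)
    then show False using b'(5) bb assms(3) by simp
  qed
  have r: "robust_position P a m" using robust_labelledD(3)[OF rl wa m(1)] .
  then have "flat (args a ! m)" "type_consistent (ptype P (pred a) ! m) (args a ! m)"
    using m(2) by (auto simp: robust_position_def)
  then show ?thesis using b' m(4) bb lk by simp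
qed

lemma body_outputs:
  assumes "b \<in> set (body c)"
  shows "plin (out_pos P (pred b)) (args (subst_atom \<theta>0 b))"
    and "k \<in> out_pos P (pred b) \<Longrightarrow> robust_position P (subst_atom \<theta>0 b) k"
    and "ovars P (subst_atom \<theta>0 b) \<subseteq> ovars P b \<union> ovars P a"
proof -
  note wf = C(2)[OF assms]
  have ok: "x \<in> vars_clause c" "x \<notin> ivars P (head c)" if "x \<in> ovars P b" for x
    using that body_vars(2)[OF assms] C(8)[OF assms] by auto
  have ok': "x \<in> vars_clause c" "x \<notin> ivars P (head c)" if "k \<in> out_pos P (pred b)" "x \<in> set (occs (args b ! k))" for x k
    using that ok ovars_nth by blast+
  have pl: "plin (out_pos P (pred b)) (args b)" using C(7)[OF assms] .
  show "plin (out_pos P (pred b)) (args (subst_atom \<theta>0 b))"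
    unfolding plin_def
  proof (intro conjI ballI impI)
    fix k assume k: "k \<in> out_pos P (pred b)"
    have "distinct (occs (args b ! k))" using pl k by (auto simp: plin_def)
    then show "distinct (occs (args (subst_atom \<theta>0 b) ! k))"
      unfolding args_subst_nth(2)[OF wf k] occs_subst
      using clause_distinct clause_disjoint ok'[OF k] by (simp add: distinct_concat_map)
  next
    fix k l assume k: "k \<in> out_pos P (pred b)" and l: "l \<in> out_pos P (pred b)" and kl: "k \<noteq> l"
    have "set (occs (\<theta>0 x)) \<inter> set (occs (\<theta>0 y)) = {}" if "x \<in> set (occs (args b ! k))" "y \<in> set (occs (args b ! l))" for x y
    proof (rule clause_disjoint)
      show "x \<noteq> y" using pl k l kl that by (auto simp: plin_def)
    qed (use ok'[OF k] ok'[OF l] that in auto)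
    then show "set (occs (args (subst_atom \<theta>0 b) ! k)) \<inter> set (occs (args (subst_atom \<theta>0 b) ! l)) = {}"
      unfolding args_subst_nth(2)[OF wf k] args_subst_nth(2)[OF wf l] set_occs_subst by blast
  qed
  show "ovars P (subst_atom \<theta>0 b) \<subseteq> ovars P b \<union> ovars P a"
    unfolding ovars_subst[OF wf] using clause_range ok by blast
  assume k: "k \<in> out_pos P (pred b)"
  have r: "robust_position P b k" using C(9)[OF assms k] .
  show "robust_position P (subst_atom \<theta>0 b) k"
  proof (cases "\<forall>x\<in>set (occs (args b ! k)). \<theta>0 x = Var x")
    case True
    then have "subst_trm \<theta>0 (args b ! k) = args b ! k" by (intro subst_trm_ident) auto
    then show ?thesis using r args_subst_nth(2)[OF wf k, of \<theta>0] by (simp add: robust_position_def)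
  next
    case False
    then obtain x where x: "x \<in> set (occs (args b ! k))" "\<theta>0 x \<noteq> Var x" by blast
    then show ?thesis using rebound[OF assms k x] args_subst_nth(2)[OF wf k, of \<theta>0]
      by (simp add: robust_position_def)
  qed
qed

lemma old_outputs:
  assumes "(l, b) \<in> S" "l \<noteq> w"
  shows "k \<in> out_pos P (pred b) \<Longrightarrow> args (subst_atom \<theta>0 b) ! k = args b ! k"
    and "ovars P (subst_atom \<theta>0 b) = ovars P b"
proof -
  have wf: "wf_atom P b" using robust_labelledD(1)[OF rl assms(1)] .
  have "\<theta>0 x = Var x" if "x \<in> ovars P b" for x
    using that robust_labelledD2(3)[OF rl assms(1) wa assms(2)] fixed_old[OF assms(1)] old_vars(2)[OF assms(1)] by blast
  then have *: "subst_trm \<theta>0 (args b ! k) = args b ! k" if "k \<in> out_pos P (pred b)" for k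
    using ovars_nth[OF that] by (intro subst_trm_ident) blast
  then show *: "k \<in> out_pos P (pred b) \<Longrightarrow> args (subst_atom \<theta>0 b) ! k = args b ! k" for k
    using args_subst_nth(2)[OF wf] by simp
  then show "ovars P (subst_atom \<theta>0 b) = ovars P b" unfolding ovars_def pvars_def by simp
qed

text \<open>An atom before \<open>w\<close> contains no output variable of \<open>a\<close>: not in
  its outputs, which are disjoint from those of \<open>a\<close>, and not in its inputs, which may
  not mention outputs of later atoms. This is why bindings travel only to the right.\<close>

lemma old_unchanged:
  assumes "(l, b) \<in> S" "lx l w" shows "subst_atom \<theta>0 b = b"
proof (rule subst_atom_ident)
  fix x assume x: "x \<in> avars b"
  have "l \<noteq> w" using assms(2) by auto
  then have "avars b \<inter> ovars P a = {}"
    using avars_io[of P b] robust_labelledD(1)[OF rl assms(1)] robust_labelledD2(3,4)[OF rl assms(1) wa] assms(2) by blast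
  then show "\<theta>0 x = Var x" using x fixed_old[OF assms(1)] by blast
qed

lemma old_inputs: "(l, b) \<in> S \<Longrightarrow> ivars P (subst_atom \<theta>0 b) \<subseteq> avars a \<union> vars_clause c \<union> ivars P b"
  using robust_labelledD(1)[OF rl] range_vars by (fastforce simp: ivars_subst)

lemma body_inputs:
  "b \<in> set (body c) \<Longrightarrow> ivars P (subst_atom \<theta>0 b) \<subseteq> avars a \<union> vars_clause c"
  using range_vars body_vars(1)[of b] by (fastforce simp: ivars_subst C(2))

lemma robust_labelled_canonical: "robust_labelled P (apply_labelled \<theta>0 (expand S w f (body c)))"
proof -
  note D = robust_labelledD[OF rl] and D2 = robust_labelledD2[OF rl]
  have inj: "f i = f j \<longleftrightarrow> i = j" for i j using C(3) by (metis permutes_inj inj_eq)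
  have case_old: "ovars P (subst_atom \<theta>0 b) \<inter> ovars P (subst_atom \<theta>0 b') = {}"
    if "(l, b) \<in> S" "l \<noteq> w" "b' \<in> set (body c)" for l b b'
    using old_outputs(2)[OF that(1,2)] body_outputs(3)[OF that(3)] fresh[OF that(1)] body_vars(2)[OF that(3)]
      old_vars(2)[OF that(1)] D2(3)[OF that(1) wa that(2)] by blast
  show ?thesis
  proof (rule robust_labelledI, unfold mem_apply_labelled)
    fix l a1 l' a2
    assume "\<exists>b. (l, b) \<in> expand S w f (body c) \<and> a1 = subst_atom \<theta>0 b"
      "\<exists>b. (l', b) \<in> expand S w f (body c) \<and> a2 = subst_atom \<theta>0 b"
    then obtain b b' where b: "(l, b) \<in> expand S w f (body c)" "a1 = subst_atom \<theta>0 b"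
      and b': "(l', b') \<in> expand S w f (body c)" "a2 = subst_atom \<theta>0 b'" by blast
    show "l = l' \<and> a1 = a2" if p: "prefix l l'"
      using b(1) b'(1) unfolding mem_expand
    proof (elim disjE bexE conjE)
      assume "(l, b) \<in> S" "(l', b') \<in> S"
      then show ?thesis using D2(1,2) p b b' by blast
    next
      fix j assume "(l, b) \<in> S" "l \<noteq> w" "l' = w @ [f j]"
      then show ?thesis using D2(1)[of l b w a] D2(1)[of w a l b] wa p prefix_same_cases[of l l' w] by auto
    next
      fix j assume "(l', b') \<in> S" "l' \<noteq> w" "l = w @ [f j]"
      then have "prefix w l'" using p prefixE append_prefixD by blast
      then show ?thesis using D2(1)[OF wa \<open>(l', b') \<in> S\<close>] \<open>l' \<noteq> w\<close> by auto
    next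
      fix i j assume "l = w @ [f i]" "b = nth1 (body c) i" "l' = w @ [f j]" "b' = nth1 (body c) j"
      then show ?thesis using p inj b b' by auto
    qed
    show "ovars P a1 \<inter> ovars P a2 = {}" if ne: "l \<noteq> l'"
      using b(1) b'(1) unfolding mem_expand
    proof (elim disjE bexE conjE)
      assume "(l, b) \<in> S" "l \<noteq> w" "(l', b') \<in> S" "l' \<noteq> w"
      then show ?thesis using D2(3) ne b b' old_outputs(2) by simp
    next
      fix j assume "(l, b) \<in> S" "l \<noteq> w" "j \<in> {1..length (body c)}" "b' = nth1 (body c) j"
      then show ?thesis using case_old[of l b b'] b(2) b'(2) nth1_mem by blast
    next
      fix j assume "(l', b') \<in> S" "l' \<noteq> w" "j \<in> {1..length (body c)}" "b = nth1 (body c) j"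
      then show ?thesis using case_old[of l' b' b] b(2) b'(2) nth1_mem by blast
    next
      fix i j assume ij: "i \<in> {1..length (body c)}" "l = w @ [f i]" "b = nth1 (body c) i"
        "j \<in> {1..length (body c)}" "l' = w @ [f j]" "b' = nth1 (body c) j"
      then have "i \<noteq> j" using ne by auto
      have m: "b \<in> set (body c)" "b' \<in> set (body c)" using ij nth1_mem by auto
      have "set (occs (\<theta>0 x)) \<inter> set (occs (\<theta>0 y)) = {}" if "x \<in> ovars P b" "y \<in> ovars P b'" for x y
        by (rule clause_disjoint) (use that C(10)[OF ij(1,4) \<open>i \<noteq> j\<close>] ij(3,6) body_vars(2)[OF m(1)]
            body_vars(2)[OF m(2)] C(8)[OF m(1)] C(8)[OF m(2)] in blast)+
      then show ?thesis unfolding b(2) b'(2) ovars_subst[OF C(2)[OF m(1)]] ovars_subst[OF C(2)[OF m(2)]] by blast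
    qed
    show "ivars P a1 \<inter> ovars P a2 = {}" if le: "l = l' \<or> lx l l'"
      using b(1) b'(1) unfolding mem_expand
    proof (elim disjE bexE conjE)
      assume s: "(l, b) \<in> S" "l \<noteq> w" "(l', b') \<in> S" "l' \<noteq> w"
      have n: "ivars P b \<inter> ovars P b' = {}" using le D2(2,4)[OF s(1,3)] D(4)[OF s(1)] by auto
      show ?thesis
      proof (cases "lx l w")
        case True
        then show ?thesis using old_unchanged[OF s(1)] n b b' old_outputs(2)[OF s(3,4)] by simp
      next
        case False
        \<comment> \<open>An input to the right of \<open>w\<close> may become instantiated, but the
          new variables come from \<open>a\<close> or from the clause, and none of these is an
          output variable of an old atom to the right of \<open>w\<close>.\<close>
        then have "lx w l" using D2(5)[OF s(1) wa s(2)] by blast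
        then have "lx w l'" using le lx_trans by blast
        then have "avars a \<inter> ovars P b' = {}"
          using avars_io[OF wf_a] D2(4)[OF wa s(3)] D2(3)[OF s(3) wa s(4)] by blast
        moreover have "vars_clause c \<inter> ovars P b' = {}" using fresh[OF s(3)] old_vars(2)[OF s(3)] by blast
        ultimately show ?thesis using old_inputs[OF s(1)] n b b' old_outputs(2)[OF s(3,4)] by blast
      qed
    next
      fix j assume s: "(l, b) \<in> S" "l \<noteq> w" and j: "j \<in> {1..length (body c)}" "l' = w @ [f j]" "b' = nth1 (body c) j"
      have m: "b' \<in> set (body c)" using j nth1_mem by auto
      have np: "\<not> prefix w l" using D2(1)[OF wa s(1)] s(2) by blast
      then have "lx l w" using le j(2) lx_append_right by auto
      then have "ivars P a1 = ivars P b" "ivars P b \<inter> ovars P a = {}"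
        using old_unchanged[OF s(1)] b(2) D2(4)[OF s(1) wa] by auto
      then show ?thesis using body_outputs(3)[OF m] body_vars(2)[OF m] fresh[OF s(1)] old_vars(1)[OF s(1)] b'(2) by blast
    next
      fix j assume s: "(l', b') \<in> S" "l' \<noteq> w" and j: "j \<in> {1..length (body c)}" "l = w @ [f j]" "b = nth1 (body c) j"
      have m: "b \<in> set (body c)" using j nth1_mem by auto
      have np: "\<not> prefix w l'" using D2(1)[OF wa s(1)] s(2) by blast
      then have "lx w l'" using le j(2) lx_append_left by auto
      then have "avars a \<inter> ovars P b' = {}"
        using avars_io[OF wf_a] D2(4)[OF wa s(1)] D2(3)[OF s(1) wa s(2)] by blast
      then show ?thesis using body_inputs[OF m] old_outputs(2)[OF s] b(2) b'(2) fresh[OF s(1)] old_vars(2)[OF s(1)] by blast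
    next
      fix i j assume ij: "i \<in> {1..length (body c)}" "l = w @ [f i]" "b = nth1 (body c) i"
        "j \<in> {1..length (body c)}" "l' = w @ [f j]" "b' = nth1 (body c) j"
      have m: "b \<in> set (body c)" "b' \<in> set (body c)" using ij nth1_mem by auto
      have "f i \<le> f j" using le ij by auto
      then have n: "ivars P b \<inter> ovars P b' = {}" using C(11)[OF ij(1,4)] ij by simp
      have "set (occs (\<theta>0 x)) \<inter> set (occs (\<theta>0 y)) = {}" if x: "x \<in> ivars P b" and y: "y \<in> ovars P b'" for x y
      proof -
        have yc: "y \<in> vars_clause c" "y \<notin> ivars P (head c)" using y body_vars(2)[OF m(2)] C(8)[OF m(2)] by auto
        have xc: "x \<in> vars_clause c" using x body_vars(1)[OF m(1)] by auto
        show ?thesis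
        proof (cases "x \<in> ivars P (head c)")
          case True
          then show ?thesis using on_inputs[OF True] clause_range[OF yc] D(4)[OF wa] fresh[OF wa] old_vars(1)[OF wa] yc(1) by blast
        next
          case False
          then show ?thesis using clause_disjoint[OF xc False yc] n x y by blast
        qed
      qed
      then show ?thesis unfolding b(2) b'(2) ovars_subst[OF C(2)[OF m(2)]] ivars_subst[OF C(2)[OF m(1)]] by blast
    qed
  next
    fix l a1 assume "\<exists>b. (l, b) \<in> expand S w f (body c) \<and> a1 = subst_atom \<theta>0 b"
    then obtain b where b: "(l, b) \<in> expand S w f (body c)" "a1 = subst_atom \<theta>0 b" by blast
    then have cs: "(l, b) \<in> S \<and> l \<noteq> w \<or> b \<in> set (body c)"
      unfolding mem_expand using nth1_mem by blast
    show "wf_atom P a1" using cs b(2) D(1) C(2) by auto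
    show "plin (out_pos P (pred a1)) (args a1)"
      using cs
    proof (elim disjE conjE)
      assume s: "(l, b) \<in> S" "l \<noteq> w"
      show ?thesis using D(2)[OF s(1)] old_outputs(1)[OF s] unfolding b(2) plin_def pred_subst_atom by simp
    qed (use body_outputs(1) b(2) in simp)
    show "robust_position P a1 k" if "k \<in> out_pos P (pred a1)" for k
      using cs
    proof (elim disjE conjE)
      assume s: "(l, b) \<in> S" "l \<noteq> w"
      have k: "k \<in> out_pos P (pred b)" using that b(2) by simp
      show ?thesis using D(3)[OF s(1) k] old_outputs(1)[OF s k] unfolding b(2) robust_position_def pred_subst_atom by simp
    qed (use that body_outputs(2) b(2) in simp)
  next
    fix l a1 \<sigma> assume "\<exists>b. (l, b) \<in> expand S w f (body c) \<and> a1 = subst_atom \<theta>0 b"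
      and "\<And>l' a'. \<exists>b. (l', b) \<in> expand S w f (body c) \<and> a' = subst_atom \<theta>0 b \<Longrightarrow> lx l' l \<Longrightarrow>
        outputs_typed P (subst_atom \<sigma> a')"
    then show "inputs_typed P (subst_atom \<sigma> a1)"
      using inputs_typed_step[OF rl wa rc unifies[unfolded unifier_def], of l a1 \<sigma>] unfolding mem_apply_labelled by blast
  qed
qed

context
  fixes \<theta> assumes mgu: "is_mgu \<theta> a (head c)"
begin

lemma via_canonical: "subst_trm \<theta> (\<theta>0 x) = \<theta> x"
  using general[of \<theta> x] mgu by (simp add: is_mgu_def)

lemma back_to_canonical:
  obtains \<rho> where "\<And>x. subst_trm \<rho> (\<theta> x) = \<theta>0 x"
proof -
  have "\<exists>\<tau>. \<forall>x. \<theta>0 x = subst_trm \<tau> (\<theta> x)" using mgu unifies by (simp add: is_mgu_def)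
  then show ?thesis using that by metis
qed

text \<open>Since \<open>\<theta>0\<close> factors through the actual unifier, the latter has a left
  inverse wherever \<open>\<theta>0\<close> is the identity.\<close>

lemma renames_fixed: "renames \<theta> {x. \<theta>0 x = Var x}"
proof -
  obtain \<rho> where \<rho>: "\<And>x. subst_trm \<rho> (\<theta> x) = \<theta>0 x" using back_to_canonical by blast
  then show ?thesis by (intro renames_inverseI[of _ \<rho>]) auto
qed

text \<open>The actual step is the canonical one followed by \<open>\<theta>\<close>. All variables
  left by the canonical step are fixed points of \<open>\<theta>0\<close>, and on these
  \<open>\<theta>\<close> is a renaming.\<close>

lemma robust_labelled_mgu: "robust_labelled P (apply_labelled \<theta> (expand S w f (body c)))"
proof -
  have eq: "subst_comp \<theta>0 \<theta> = \<theta>" by (simp add: subst_comp_def via_canonical)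
  have "renames \<theta> (\<Union>(l, b)\<in>apply_labelled \<theta>0 (expand S w f (body c)). avars b)"
    by (rule renames_subset[OF renames_fixed]) (auto simp: apply_labelled_def avars_subst range_fixed)
  from robust_labelled_rename[OF robust_labelled_canonical this]
  show ?thesis unfolding apply_labelled_apply_labelled eq .
qed

end

end

lemma selectable_imp_bound_inputs:
  assumes "input_selectability P" "robust_labelled P S" "(w, a) \<in> S" "selectable P a"
    and "k \<in> in_pos P (pred a)" "bound P (pred a) k"
  shows "\<not> is_var (args a ! k)"
proof -
  note D = robust_labelledD[OF assms(2,3)]
  have "is_var (args a ! k)" if "k \<in> out_pos P (pred a)" "\<not> bound P (pred a) k" for k
    using D(3)[OF that(1)] that(2) by (simp add: robust_position_def)
  then show ?thesis using assms(1,4-6) D(1) unfolding input_selectability_def by blast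
qed

lemma canonical_step_selectable:
  assumes "robust_labelled P S" "(w, a) \<in> S" "robust_clause P f c"
    and "\<And>l b. (l, b) \<in> S \<Longrightarrow> vars_clause c \<inter> avars b = {}"
    and "is_mgu \<theta> a (head c)" "input_selectability P" "selectable P a"
  obtains \<theta>0 where "canonical_step P S w a f c \<theta>0"
proof -
  have "unifier \<theta> a (head c)" using assms(5) by (simp add: is_mgu_def)
  then show ?thesis
    by (rule canonical_step_exists[OF assms(1-3), rotated])
      (use assms(4) selectable_imp_bound_inputs[OF assms(6,1,2,7)] that in blast)+
qed

text \<open>With no atom to the left the typing premise is void, so the inputs have their types
  already under the identity. A non-variable type contains no variable, hence part (2) of input
  selectability applies.\<close>

lemma leftmost_imp_selectable:
  assumes "input_selectability P" "robust_labelled P S" "(w, a) \<in> S"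
    and "\<And>l b. (l, b) \<in> S \<Longrightarrow> \<not> lx l w"
  shows "selectable P a"
proof -
  note D = robust_labelledD[OF assms(2,3)]
  have "is_var (args a ! k)" if "k \<in> out_pos P (pred a)" "\<not> bound P (pred a) k" for k
    using D(3)[OF that(1)] that(2) by (simp add: robust_position_def)
  moreover have "inputs_typed P (subst_atom Var a)" using assms(4) D(5)[of Var] by blast
  then have "\<not> is_var (args a ! k)" if "k \<in> in_pos P (pred a)" "\<not> variable_type (ptype P (pred a) ! k)" for k
    using that by (auto simp: inputs_typed_def variable_type_def is_var_def)
  ultimately show ?thesis using assms(1) D(1) unfolding input_selectability_def by blast
qed

text \<open>Instantiation may turn a variable into a compound term but never the converse, so an
  atom cannot become blocked by it.\<close>

lemma selectable_subst: "wf_atom P a \<Longrightarrow> (\<And>bs. bs \<in> block P (pred a) \<Longrightarrow> length bs = length (mode P (pred a))) \<Longrightarrow>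
  selectable P a \<Longrightarrow> selectable P (subst_atom \<sigma> a)"
  by (auto simp: selectable_def blocked_def wf_atom_def dest!: is_var_substD)

section \<open>The derivation tree of an infinite left-based derivation\<close>

lemma fresh_renaming:
  fixes X Y :: "'v::infinite set"
  assumes "finite X" "finite Y"
  obtains g :: "'v \<Rightarrow> 'v" where "inj_on g X" "g ` X \<inter> Y = {}"
proof -
  have "infinite (- Y)" using assms(2) by (simp add: infinite_UNIV Compl_eq_Diff_UNIV)
  then obtain T where T: "T \<subseteq> - Y" "finite T" "card T = card X"
    using infinite_arbitrarily_large[of "- Y" "card X"] by blast
  then obtain g where "bij_betw g X T" using finite_same_card_bij[OF assms(1), of T] by auto
  then show ?thesis using that[of g] T(1) by (auto simp: bij_betw_def)
qed

lemma variant_renaming: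
  assumes "inj_on g (vars_clause d)"
  shows "variant (subst_clause (\<lambda>x. Var (g x)) d) d"
proof -
  define h where "h = inv_into (vars_clause d) g"
  have "subst_clause (\<lambda>x. Var (h x)) (subst_clause (\<lambda>x. Var (g x)) d) = subst_clause (\<lambda>x. Var (h (g x))) d"
    by (simp add: subst_clause_def subst_query_def subst_atom_subst_atom)
  also have "\<dots> = subst_clause Var d" using assms by (intro subst_clause_cong) (simp add: h_def)
  also have "\<dots> = d" by (cases d) (simp add: subst_clause_def subst_query_def map_idI)
  finally show ?thesis unfolding variant_def by metis
qed

text \<open>\<open>permute f xs\<close> puts the element at position \<open>j\<close> into place
  \<open>f j\<close>, so values that depend on \<open>f j\<close> alone come out in their natural
  order. In the applications \<open>f j\<close> is the last entry of a label.\<close>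

lemma map_permute:
  assumes "f permutes {1..length xs}" "\<And>j. j \<in> {1..length xs} \<Longrightarrow> F (nth1 xs j) = G (f j)"
  shows "map F (permute f xs) = map G [1..<Suc (length xs)]"
  unfolding permute_def map_map
proof (rule map_cong[OF refl])
  fix i assume "i \<in> set [1..<Suc (length xs)]"
  then have i: "i \<in> {1..length xs}" by auto
  then have "inv f i \<in> {1..length xs}" using permutes_inv[OF assms(1)] by (metis permutes_in_image)
  then show "(F \<circ> (\<lambda>i. nth1 xs (inv f i))) i = G i"
    using assms(2)[of "inv f i"] permutes_inverses(1)[OF assms(1)] by simp
qed

lemma permute_map:
  assumes "f permutes {1..length xs}" shows "permute f (map g xs) = map g (permute f xs)"
  unfolding permute_def length_map map_map
proof (rule map_cong[OF refl])
  fix i assume "i \<in> set [1..<Suc (length xs)]"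
  then have "i \<in> {1..length xs}" by auto
  then have "inv f i \<in> {1..length xs}" using permutes_inv[OF assms] by (metis permutes_in_image)
  then show "nth1 (map g xs) (inv f i) = (g \<circ> (\<lambda>i. nth1 xs (inv f i))) i" by (simp add: nth1_map)
qed

lemma set_zip_nth1:
  "set (zip (map g [1..<Suc (length B)]) B) = (\<lambda>j. (g j, nth1 B j)) ` {1..length B}"
proof -
  have "zip (map g [1..<Suc (length B)]) B = map (\<lambda>j. (g j, nth1 B j)) [1..<Suc (length B)]"
    by (rule nth_equalityI) (auto simp: nth1_def simp del: upt_Suc)
  then show ?thesis by (simp only: list.set_map set_upt atLeastLessThanSuc_atLeastAtMost)
qed

locale left_based_run =
  fixes P :: "('p, 'f, 'v::infinite) program" and \<rho> :: "('p, 'f, 'v) clause \<Rightarrow> nat \<Rightarrow> nat"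
    and \<pi> :: "nat \<Rightarrow> nat" and Q :: "('p, 'f, 'v) query" and D :: "('p, 'f, 'v) derivation"
  assumes well_fed: "well_fed_program \<rho> P" "well_fed_query P \<pi> Q"
    and left_based: "left_based P Q D" and inf: "steps D = \<infinity>"
begin

text \<open>An input clause may be a variant of several program clauses, which may come with
  different permutations. One of them is fixed here, and the LD-derivation uses the same
  one.\<close>

definition origin :: "nat \<Rightarrow> ('p, 'f, 'v) clause" where
  "origin i = (SOME d. d \<in> clauses P \<and> variant (cls D i) d)"

definition perm :: "nat \<Rightarrow> nat \<Rightarrow> nat" where
  "perm i = \<rho> (origin i)"

text \<open>The list keeps the order of the text and the labels carry the order of the data flow.
  Both are needed: selection is governed by the first, typing by the second.\<close>

primrec lquery :: "nat \<Rightarrow> (nat list \<times> ('p, 'f, 'v) atom) list" where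
  "lquery 0 = zip (map (\<lambda>j. [\<pi> j]) [1..<Suc (length Q)]) Q"
| "lquery (Suc i) = map (\<lambda>(l, b). (l, subst_atom (sub D i) b))
     (take (sel D i) (lquery i) @
      zip (map (\<lambda>j. fst (lquery i ! sel D i) @ [perm i j]) [1..<Suc (length (body (cls D i)))]) (body (cls D i)) @
      drop (Suc (sel D i)) (lquery i))"

abbreviation S :: "nat \<Rightarrow> ('p, 'f, 'v) lquery" where
  "S i \<equiv> set (lquery i)"

definition lab :: "nat \<Rightarrow> nat list set" where
  "lab i = fst ` S i"

definition slab :: "nat \<Rightarrow> nat list" where
  "slab i = fst (lquery i ! sel D i)"

definition satom :: "nat \<Rightarrow> ('p, 'f, 'v) atom" where
  "satom i = snd (lquery i ! sel D i)"

lemma step: "resolution_step P (qry D i) (sel D i) (cls D i) (sub D i) (qry D (Suc i))"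
  using left_based inf by (simp add: left_based_def delay_respecting_def derivation_def)

lemma snd_lquery: "map snd (lquery i) = qry D i"
proof (induction i)
  case 0
  then show ?case using left_based
    by (simp add: left_based_def delay_respecting_def derivation_def del: upt_Suc)
next
  case (Suc i)
  have *: "map snd (map (\<lambda>(l, b). (l, subst_atom \<sigma> b)) xs) = map (subst_atom \<sigma>) (map snd xs)"
    for \<sigma> :: "('f, 'v) subst" and xs :: "(nat list \<times> ('p, 'f, 'v) atom) list" by (induction xs) auto
  show ?case
    using step[of i] unfolding lquery.simps *
    by (simp add: resolution_step_def subst_query_def Suc[symmetric] take_map drop_map del: upt_Suc)
qed

lemma length_qry: "length (qry D i) = length (lquery i)"
  using snd_lquery[of i] by (metis length_map)

lemma sel_less: "sel D i < length (lquery i)"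
  using step[of i] by (simp add: resolution_step_def length_qry)

lemma qry_nth: "k < length (lquery i) \<Longrightarrow> qry D i ! k = snd (lquery i ! k)"
  using snd_lquery[of i] by (metis nth_map)

lemma satom_qry: "satom i = qry D i ! sel D i"
  using qry_nth[OF sel_less] by (simp add: satom_def)

lemma selected_mem: "(slab i, satom i) \<in> S i"
  using sel_less[of i] by (simp add: slab_def satom_def)

lemma selectable_satom: "selectable P (satom i)"
  using left_based inf by (simp add: satom_qry left_based_def delay_respecting_def)

lemma mgu: "is_mgu (sub D i) (satom i) (head (cls D i))"
  using step[of i] by (simp add: resolution_step_def satom_qry)

lemma origin: "origin i \<in> clauses P" "variant (cls D i) (origin i)"
proof -
  have "\<exists>d. d \<in> clauses P \<and> variant (cls D i) d" using step[of i] by (auto simp: resolution_step_def)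
  then have "origin i \<in> clauses P \<and> variant (cls D i) (origin i)" unfolding origin_def by (rule someI_ex)
  then show "origin i \<in> clauses P" "variant (cls D i) (origin i)" by simp_all
qed

lemma fresh: "(l, b) \<in> S i \<Longrightarrow> vars_clause (cls D i) \<inter> avars b = {}"
proof -
  assume "(l, b) \<in> S i"
  then have "b \<in> set (qry D i)" using snd_lquery[of i] by (metis image_eqI list.set_map snd_conv)
  then show ?thesis using step[of i] by (auto simp: resolution_step_def vars_query_avars)
qed

lemma program: "input_selectability P" "wf_program P" "\<And>d. d \<in> clauses P \<Longrightarrow> robust_clause P (\<rho> d) d"
proof -
  show "input_selectability P" "wf_program P"
    using well_fed(1) by (auto simp: well_fed_program_def permutation_robustly_typed_def)
  show "robust_clause P (\<rho> d) d" if "d \<in> clauses P" for d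
    using that well_fed(1)
    by (intro robust_clause_of_robustly_typed)
      (auto simp: well_fed_program_def permutation_robustly_typed_def input_linear_def wf_program_def)
qed

lemma robust_cls: "robust_clause P (perm i) (cls D i)"
  unfolding perm_def using program(3)[OF origin(1)] origin(2) by (rule robust_clause_variant)

lemma permutes_perm: "perm i permutes {1..length (body (cls D i))}"
  using robust_clauseD(3)[OF robust_cls] .

lemma permutes_\<pi>: "\<pi> permutes {1..length Q}"
  using well_fed(2) by (simp add: well_fed_query_def robustly_typed_query_def)

lemma lquery_split:
  "lquery i = take (sel D i) (lquery i) @ (slab i, satom i) # drop (Suc (sel D i)) (lquery i)"
  using id_take_nth_drop[OF sel_less[of i]] by (simp add: slab_def satom_def)

lemma lquery_Suc:
  "lquery (Suc i) = map (\<lambda>(l, b). (l, subst_atom (sub D i) b))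
     (take (sel D i) (lquery i) @
      zip (map (\<lambda>j. slab i @ [perm i j]) [1..<Suc (length (body (cls D i)))]) (body (cls D i)) @
      drop (Suc (sel D i)) (lquery i))"
  by (simp add: slab_def del: upt_Suc)

declare lquery.simps(2) [simp del]

lemma S_Suc_of_distinct:
  assumes "distinct (map fst (lquery i))"
  shows "S (Suc i) = apply_labelled (sub D i) (expand (S i) (slab i) (perm i) (body (cls D i)))"
proof -
  define A where "A = take (sel D i) (lquery i)"
  define B where "B = drop (Suc (sel D i)) (lquery i)"
  have s: "lquery i = A @ (slab i, satom i) # B" using lquery_split by (simp add: A_def B_def)
  have "set A \<union> set B = {(l, b) \<in> S i. l \<noteq> slab i}"
    using assms unfolding s by (auto simp: image_iff)
  then show ?thesis
    unfolding lquery_Suc apply_labelled_def expand_def list.set_map set_append set_zip_nth1 A_def[symmetric] B_def[symmetric]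
    by blast
qed

text \<open>Distinctness is proved along with robust typedness because
  \<open>S_Suc_of_distinct\<close> depends on it: removing the selected label from the set of atoms
  must remove a single occurrence from the list.\<close>

lemma invariant: "distinct (map fst (lquery i)) \<and> robust_labelled P (S i)"
proof (induction i)
  case 0
  have wf: "wf_query P Q" and nm: "nicely_moded_query P \<pi> Q" and wt: "well_typed_query P \<pi> Q"
    and rp: "\<And>a k. a \<in> set Q \<Longrightarrow> k \<in> out_pos P (pred a) \<Longrightarrow> robust_position P a k"
    using well_fed(2) by (auto simp: well_fed_query_def robustly_typed_query_def)
  have wfa: "wf_atom P a" if "a \<in> set Q" for a using wf that by (simp add: wf_query_def)
  note lin = linear_outputs_query[OF wf]
  have l: "linear (concat (map (outputs P) Q))" using nm by (simp add: nicely_moded_query_def)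
  have inj: "\<pi> i = \<pi> j \<longleftrightarrow> i = j" for i j using permutes_\<pi> by (metis permutes_inj inj_eq)
  have nmd: "ivars P (nth1 Q i) \<inter> ovars P (nth1 Q j) = {}"
    if "i \<in> {1..length Q}" "j \<in> {1..length Q}" "\<pi> i \<le> \<pi> j" for i j
    using nm that by (simp add: nicely_moded_query_def vars_inputs vars_outputs wfa nth1_mem)
  have S0: "(l, a) \<in> S 0 \<longleftrightarrow> (\<exists>j\<in>{1..length Q}. l = [\<pi> j] \<and> a = nth1 Q j)" for l a
    unfolding lquery.simps(1) set_zip_nth1 by auto
  have "robust_labelled P (S 0)"
  proof (rule robust_labelledI, unfold S0; elim bexE conjE; hypsubst?)
    fix i j assume ij: "i \<in> {1..length Q}" "j \<in> {1..length Q}"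
    show "[\<pi> i] = [\<pi> j] \<and> nth1 Q i = nth1 Q j" if "prefix [\<pi> i] [\<pi> j]" using that inj by simp
    show "ovars P (nth1 Q i) \<inter> ovars P (nth1 Q j) = {}" if "[\<pi> i] \<noteq> [\<pi> j]"
      using lin(2)[OF l ij] that by auto
    show "ivars P (nth1 Q i) \<inter> ovars P (nth1 Q j) = {}" if "[\<pi> i] = [\<pi> j] \<or> lx [\<pi> i] [\<pi> j]"
      by (rule nmd[OF ij]) (use that in auto)
  next
    fix j assume j: "j \<in> {1..length Q}"
    note m = nth1_mem[OF j]
    show "wf_atom P (nth1 Q j)" using wfa m by simp
    show "plin (out_pos P (pred (nth1 Q j))) (args (nth1 Q j))" using lin(1)[OF l m] .
    show "robust_position P (nth1 Q j) k" if "k \<in> out_pos P (pred (nth1 Q j))" for k using rp[OF m that] .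
  next
    fix j \<sigma> assume j: "j \<in> {1..length Q}"
      and t: "\<And>l' a'. \<exists>j\<in>{1..length Q}. l' = [\<pi> j] \<and> a' = nth1 Q j \<Longrightarrow> lx l' [\<pi> j] \<Longrightarrow>
        outputs_typed P (subst_atom \<sigma> a')"
    have "outputs_typed P (subst_atom \<sigma> (nth1 Q i))" if "i \<in> {1..length Q}" "\<pi> i < \<pi> j" for i
      using t[of "[\<pi> i]" "nth1 Q i", OF bexI[OF _ that(1)]] that(2) by simp
    then show "inputs_typed P (subst_atom \<sigma> (nth1 Q j))" using wt j unfolding well_typed_query_def by blast
  qed
  moreover have "distinct (map fst (lquery 0))"
    unfolding lquery.simps(1) by (simp add: distinct_map inj_on_def inj del: upt_Suc)
  ultimately show ?case by simp
next
  case (Suc i)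
  then have d: "distinct (map fst (lquery i))" and r: "robust_labelled P (S i)" by auto
  obtain \<theta>0 where "canonical_step P (S i) (slab i) (satom i) (perm i) (cls D i) \<theta>0"
    by (rule canonical_step_selectable[OF r selected_mem robust_cls _ mgu program(1) selectable_satom])
      (use fresh in blast)
  then have "robust_labelled P (S (Suc i))"
    using canonical_step.robust_labelled_mgu[OF _ mgu] S_Suc_of_distinct[OF d] by metis
  moreover have "distinct (map fst (lquery (Suc i)))"
  proof -
    define A where "A = take (sel D i) (lquery i)"
    define B where "B = drop (Suc (sel D i)) (lquery i)"
    define ch where "ch = map (\<lambda>j. slab i @ [perm i j]) [1..<Suc (length (body (cls D i)))]"
    have s: "lquery i = A @ (slab i, satom i) # B" using lquery_split by (simp add: A_def B_def)
    have "map fst (lquery (Suc i)) = map fst A @ ch @ map fst B"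
      unfolding lquery_Suc A_def[symmetric] B_def[symmetric] ch_def[symmetric]
      by (simp add: ch_def case_prod_unfold o_def map_fst_zip[unfolded o_def] del: upt_Suc)
    moreover have "distinct ch"
      using permutes_inj[OF permutes_perm[of i]] by (simp add: ch_def distinct_map inj_on_def inj_def del: upt_Suc)
    moreover have "l \<notin> set ch" if l: "l \<in> fst ` (set A \<union> set B)" for l
    proof
      assume "l \<in> set ch"
      then have "prefix (slab i) l" by (auto simp: ch_def)
      moreover have "l \<in> fst ` S i" using l unfolding s by auto
      then obtain b where b: "(l, b) \<in> S i" by auto
      ultimately have "slab i = l" using robust_labelledD2(1)[OF r selected_mem b] by blast
      then show False using d l unfolding s by auto
    qed
    ultimately show ?thesis using d unfolding s by auto
  qed
  ultimately show ?case by simp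
qed

lemmas robust_S = conjunct2[OF invariant]
lemmas S_Suc = S_Suc_of_distinct[OF conjunct1[OF invariant]]

lemma canonical:
  obtains \<theta>0 where "canonical_step P (S i) (slab i) (satom i) (perm i) (cls D i) \<theta>0"
  by (rule canonical_step_selectable[OF robust_S selected_mem robust_cls _ mgu program(1) selectable_satom])
    (use fresh in blast)

lemma S_Suc_cases:
  assumes "(l, b) \<in> S (Suc i)"
  obtains (old) b' where "(l, b') \<in> S i" "l \<noteq> slab i" "b = subst_atom (sub D i) b'"
  | (new) j where "j \<in> {1..length (body (cls D i))}" "l = slab i @ [perm i j]"
      "b = subst_atom (sub D i) (nth1 (body (cls D i)) j)"
  using assms unfolding S_Suc mem_apply_labelled mem_expand by blast

lemma S_Suc_old: "(l, b) \<in> S i \<Longrightarrow> l \<noteq> slab i \<Longrightarrow> (l, subst_atom (sub D i) b) \<in> S (Suc i)"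
  unfolding S_Suc by (rule mem_step_old)

lemma S_Suc_new: "j \<in> {1..length (body (cls D i))} \<Longrightarrow>
  (slab i @ [perm i j], subst_atom (sub D i) (nth1 (body (cls D i)) j)) \<in> S (Suc i)"
  unfolding S_Suc by (rule mem_step_new)

lemma lab_iff: "l \<in> lab i \<longleftrightarrow> (\<exists>a. (l, a) \<in> S i)"
  by (force simp: lab_def)

lemma slab_lab: "slab i \<in> lab i"
  using selected_mem lab_iff by blast

lemma lab_prefix: "l \<in> lab i \<Longrightarrow> l' \<in> lab i \<Longrightarrow> prefix l l' \<Longrightarrow> l = l'"
  unfolding lab_iff using robust_labelledD2(1)[OF robust_S] by blast

lemma lab_total: "l \<in> lab i \<Longrightarrow> l' \<in> lab i \<Longrightarrow> l \<noteq> l' \<Longrightarrow> lx l l' \<or> lx l' l"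
  unfolding lab_iff using robust_labelledD2(5)[OF robust_S] by blast

lemma lab_Suc_cases:
  assumes "l \<in> lab (Suc i)"
  shows "l \<in> lab i \<and> l \<noteq> slab i \<or> (\<exists>j\<in>{1..length (body (cls D i))}. l = slab i @ [j])"
proof -
  obtain b where "(l, b) \<in> S (Suc i)" using assms lab_iff by blast
  then show ?thesis
  proof (cases rule: S_Suc_cases)
    case (new j)
    then have "perm i j \<in> {1..length (body (cls D i))}" using permutes_perm by (metis permutes_in_image)
    then show ?thesis using new by blast
  qed (auto simp: lab_iff)
qed

lemma lab_Suc_old: "l \<in> lab i \<Longrightarrow> l \<noteq> slab i \<Longrightarrow> l \<in> lab (Suc i)"
  using S_Suc_old lab_iff by metis

lemma lab_Suc_new: "j \<in> {1..length (body (cls D i))} \<Longrightarrow> slab i @ [j] \<in> lab (Suc i)"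
proof -
  assume j: "j \<in> {1..length (body (cls D i))}"
  then have "inv (perm i) j \<in> {1..length (body (cls D i))}"
    using permutes_inv[OF permutes_perm] by (metis permutes_in_image)
  from S_Suc_new[OF this] show ?thesis using permutes_inverses(1)[OF permutes_perm] lab_iff by metis
qed

lemma ancestor: "i \<le> j \<Longrightarrow> l \<in> lab j \<Longrightarrow> \<exists>l'\<in>lab i. prefix l' l"
proof (induction j arbitrary: l)
  case (Suc j)
  show ?case
  proof (cases "i = Suc j")
    case False
    then have ij: "i \<le> j" using Suc.prems by simp
    then show ?thesis using lab_Suc_cases[OF Suc.prems(2)] Suc.IH[OF ij] slab_lab[of j] prefix_order.trans
      by (metis prefixI)
  qed (use Suc.prems in blast)
qed blast

text \<open>Every later label extends one that is present right after step \<open>i\<close>, and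
  none of those is a prefix of \<open>slab i\<close>. In particular no node is resolved twice, so
  that \<open>inv slab\<close> recovers the step of a node.\<close>

lemma gone: "i < j \<Longrightarrow> l \<in> lab j \<Longrightarrow> \<not> prefix l (slab i)"
proof
  assume "i < j" "l \<in> lab j" "prefix l (slab i)"
  moreover from this obtain l' where l': "l' \<in> lab (Suc i)" "prefix l' l" using ancestor[of "Suc i" j l] by auto
  ultimately have p: "prefix l' (slab i)" using prefix_order.trans by blast
  show False using lab_Suc_cases[OF l'(1)]
  proof (elim disjE conjE bexE)
    assume "l' \<in> lab i" "l' \<noteq> slab i"
    then show False using lab_prefix[OF _ slab_lab p] by blast
  next
    fix k assume "l' = slab i @ [k]"
    then show False using p by (simp add: prefix_def)
  qed
qed

lemma inj_slab: "inj slab"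
proof (rule linorder_injI)
  fix i j :: nat assume "i < j"
  then show "slab i \<noteq> slab j" using gone[OF _ slab_lab] by force
qed

lemma stays: "i \<le> j \<Longrightarrow> l \<in> lab i \<Longrightarrow> (\<And>k. i \<le> k \<Longrightarrow> k < j \<Longrightarrow> slab k \<noteq> l) \<Longrightarrow> l \<in> lab j"
proof (induction j)
  case (Suc j)
  then show ?case using lab_Suc_old[of l j] by (cases "i = Suc j") (auto simp: le_Suc_eq)
qed simp

lemma below_resolved:
  assumes "l \<in> lab j" "prefix (slab k) l"
  shows "l = slab k \<or> (\<exists>c\<in>{1..length (body (cls D k))}. prefix (slab k @ [c]) l)"
proof (cases "j \<le> k")
  case True
  then obtain l' where l': "l' \<in> lab j" "prefix l' (slab k)" using ancestor[OF _ slab_lab] by blast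
  then have "l' = l" using lab_prefix[OF l'(1) assms(1)] assms(2) prefix_order.trans by blast
  then show ?thesis using l' assms(2) prefix_order.antisym by blast
next
  case False
  then obtain l' where l': "l' \<in> lab (Suc k)" "prefix l' l" using ancestor[of "Suc k" j l] assms(1) by auto
  show ?thesis using lab_Suc_cases[OF l'(1)]
  proof (elim disjE conjE bexE)
    assume n: "l' \<in> lab k" "l' \<noteq> slab k"
    then show ?thesis using prefix_same_cases[OF l'(2) assms(2)] lab_prefix[OF n(1) slab_lab] lab_prefix[OF slab_lab n(1)] by auto
  next
    fix c assume "c \<in> {1..length (body (cls D k))}" "l' = slab k @ [c]"
    then show ?thesis using l'(2) by blast
  qed
qed

section \<open>Accumulated substitutions and instances of a node at late stages\<close>

primrec csub :: "nat \<Rightarrow> nat \<Rightarrow> ('f, 'v) subst" where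
  "csub i 0 = Var"
| "csub i (Suc N) = (if i \<le> N then subst_comp (csub i N) (sub D N) else Var)"

lemma csub_refl [simp]: "csub i i = Var"
  by (cases i) auto

lemma csub_split: "i \<le> j \<Longrightarrow> j \<le> N \<Longrightarrow> csub i N = subst_comp (csub i j) (csub j N)"
proof (induction N)
  case (Suc N)
  show ?case
  proof (cases "j = Suc N")
    case True
    then show ?thesis by (simp add: subst_comp_def del: csub.simps)
  next
    case False
    then have "csub i N = subst_comp (csub i j) (csub j N)" "i \<le> N" "j \<le> N" using Suc by auto
    then show ?thesis by (simp add: subst_comp_def subst_trm_subst_trm)
  qed
qed (simp add: subst_comp_def)

lemma csub_step: "csub i (Suc i) = sub D i"
  by (simp add: subst_comp_def)

lemma csub_left: "i < N \<Longrightarrow> csub i N = subst_comp (sub D i) (csub (Suc i) N)"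
  using csub_split[of i "Suc i" N] csub_step by simp

lemma same_label: "i \<le> j \<Longrightarrow> (l, a) \<in> S i \<Longrightarrow> (l, b) \<in> S j \<Longrightarrow> b = subst_atom (csub i j) a"
proof (induction j arbitrary: b)
  case 0
  then show ?case using robust_labelledD2(2)[OF robust_S[of 0]] by simp
next
  case (Suc j)
  show ?case
  proof (cases "i = Suc j")
    case True
    then show ?thesis using Suc.prems robust_labelledD2(2)[OF robust_S[of i]] by (simp del: csub.simps)
  next
    case False
    then have ij: "i \<le> j" using Suc.prems by simp
    from Suc.prems(3) show ?thesis
    proof (cases rule: S_Suc_cases)
      case (old b')
      then have "b' = subst_atom (csub i j) a" using Suc.IH ij Suc.prems(2) by blast
      then show ?thesis using ij old(3) by (simp add: subst_atom_subst_comp)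
    next
      case (new c)
      obtain l' where l': "l' \<in> lab i" "prefix l' (slab j)" using ancestor[OF ij slab_lab] by blast
      then have "prefix l' l" "l' \<noteq> l" using new(2) by (auto simp: prefix_def)
      then show ?thesis using lab_prefix[OF l'(1)] Suc.prems(2) lab_iff by blast
    qed
  qed
qed

text \<open>The substitutions of all steps up to \<open>N\<close> are applied even if the node was
  resolved before \<open>N\<close>, so a node has an instance at every stage after its creation.
  Starting from any other stage at which it is present gives the same result
  (\<open>inst_eq\<close>).\<close>

definition inst :: "nat \<Rightarrow> nat list \<Rightarrow> ('p, 'f, 'v) atom" where
  "inst N l = (let i = (LEAST i. l \<in> lab i) in subst_atom (csub i N) (SOME a. (l, a) \<in> S i))"

lemma inst_eq: "(l, a) \<in> S i \<Longrightarrow> i \<le> N \<Longrightarrow> inst N l = subst_atom (csub i N) a"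
proof -
  assume a: "(l, a) \<in> S i" and N: "i \<le> N"
  define j where "j = (LEAST i. l \<in> lab i)"
  have li: "l \<in> lab i" using a lab_iff by blast
  have ji: "j \<le> i" and lj: "l \<in> lab j" unfolding j_def using li by (auto intro: Least_le LeastI)
  define b where "b = (SOME a. (l, a) \<in> S j)"
  have "(l, b) \<in> S j" unfolding b_def using lj lab_iff by (metis someI_ex)
  then have "a = subst_atom (csub j i) b" using same_label[OF ji] a by blast
  then show ?thesis using csub_split[OF ji N] by (simp add: inst_def Let_def j_def[symmetric] b_def[symmetric] subst_atom_subst_comp)
qed


section \<open>Following the derivation in the order of the leftmost selection rule\<close>

definition children :: "nat \<Rightarrow> nat list list" where
  "children k = map (\<lambda>c. slab k @ [c]) [1..<Suc (length (body (cls D k)))]"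

text \<open>The nodes of the LD-query after \<open>n\<close> steps. \<open>inv slab\<close> is the
  step of the given derivation that resolves the first node; it is meaningful only under
  \<open>resolved n\<close>.\<close>

primrec ld :: "nat \<Rightarrow> nat list list" where
  "ld 0 = map (\<lambda>c. [c]) [1..<Suc (length Q)]"
| "ld (Suc n) = children (inv slab (hd (ld n))) @ tl (ld n)"

definition resolved :: "nat \<Rightarrow> bool" where
  "resolved n \<longleftrightarrow> ld n \<noteq> [] \<and> hd (ld n) \<in> range slab"

text \<open>The given derivation may resolve the visited nodes in any order and very late, so the
  comparison is made only at stages beyond a bound that depends on \<open>n\<close>. The
  instantiating substitution may vary with the stage.\<close>

definition follows :: "nat \<Rightarrow> ('p, 'f, 'v) query \<Rightarrow> bool" where
  "follows n R \<longleftrightarrow> (\<exists>B. \<forall>N\<ge>B. \<exists>\<sigma>. map (subst_atom \<sigma>) R = map (inst N) (ld n))"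

lemma follows_0: "follows 0 (permute \<pi> Q)"
  unfolding follows_def
proof (intro exI allI impI)
  fix N
  have "subst_atom (csub 0 N) (nth1 Q j) = inst N [\<pi> j]" if "j \<in> {1..length Q}" for j
  proof -
    have "([\<pi> j], nth1 Q j) \<in> S 0" unfolding lquery.simps(1) set_zip_nth1 using that by blast
    then show ?thesis using inst_eq[of "[\<pi> j]" "nth1 Q j" 0 N] by simp
  qed
  then have "map (subst_atom (csub 0 N)) (permute \<pi> Q) = map (\<lambda>c. inst N [c]) [1..<Suc (length Q)]"
    by (intro map_permute[OF permutes_\<pi>])
  then show "map (subst_atom (csub 0 N)) (permute \<pi> Q) = map (inst N) (ld 0)" by (simp add: o_def del: upt_Suc)
qed

text \<open>At a late stage the node and the head of the clause that resolved it have the same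
  instance. Together with the generality of \<open>R\<close> this gives a unifier for a fresh
  variant of the permuted clause; factoring it through a most general one leaves the next query
  general enough.\<close>

lemma follows_step:
  assumes P': "clauses P' = (\<lambda>c. Clause (head c) (permute (\<rho> c) (body c))) ` clauses P"
    and fo: "follows n R" and rs: "resolved n"
  shows "\<exists>c \<mu> R'. resolution_step P' R 0 c \<mu> R' \<and> follows (Suc n) R'"
proof -
  define k where "k = inv slab (hd (ld n))"
  have wk: "hd (ld n) = slab k" using rs by (simp add: k_def resolved_def f_inv_into_f)
  have ldn: "ld n = slab k # tl (ld n)" using rs wk by (metis resolved_def list.collapse)
  have ldS: "ld (Suc n) = children k @ tl (ld n)" by (simp add: k_def)
  obtain B where B: "\<And>N. N \<ge> B \<Longrightarrow> \<exists>\<sigma>. map (subst_atom \<sigma>) R = map (inst N) (ld n)"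
    using fo by (auto simp: follows_def)
  \<comment> \<open>Beyond step \<open>k\<close> the accumulated substitution contains the unifier
    of that step, which identifies the node with the head of its clause.\<close>
  define B' where "B' = max B (Suc k)"
  define d where "d = origin k"
  obtain \<xi> where \<xi>: "cls D k = subst_clause \<xi> d" using origin(2)[of k] by (auto simp: variant_def d_def)
  define d' where "d' = Clause (head d) (permute (\<rho> d) (body d))"
  have d'P: "d' \<in> clauses P'" unfolding P' d'_def d_def using origin(1) by blast
  obtain g :: "'v \<Rightarrow> 'v" where g: "inj_on g (vars_clause d')" "g ` vars_clause d' \<inter> vars_query R = {}"
    using fresh_renaming[of "vars_clause d'" "vars_query R"] by auto
  define c where "c = subst_clause (\<lambda>x. Var (g x)) d'"
  have pd: "\<rho> d permutes {1..length (body d)}" using robust_clauseD(3)[OF program(3)[OF origin(1)]] by (simp add: d_def)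
  have lenb: "length (body (cls D k)) = length (body d)" by (simp add: \<xi> subst_clause_def subst_query_def)
  have vd: "avars (head d) \<subseteq> vars_clause d'" "\<And>b. b \<in> set (body d') \<Longrightarrow> avars b \<subseteq> vars_clause d'"
    using avars_vars_clause[where c = d'] by (auto simp: d'_def)
  have vc: "vars_clause c = g ` vars_clause d'"
    by (auto simp: c_def subst_clause_def subst_query_def vars_clause_avars vars_query_avars avars_subst)
  have key: "\<exists>\<chi>. unifier \<chi> (R ! 0) (head c) \<and> map (subst_atom \<chi>) (body c @ tl R) = map (inst N) (ld (Suc n))"
    if N: "N \<ge> B'" for N
  proof -
    have "N \<ge> B" "N > k" using N by (auto simp: B'_def)
    obtain \<sigma> where \<sigma>: "map (subst_atom \<sigma>) R = map (inst N) (ld n)" using B[OF \<open>N \<ge> B\<close>] by blast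
    define h where "h = inv_into (vars_clause d') g"
    \<comment> \<open>On the fresh variant, \<open>h\<close> leads back to the program clause,
      \<open>\<xi>\<close> on to the clause used at step \<open>k\<close>, and
      \<open>csub k N\<close> follows the run up to stage \<open>N\<close>.\<close>
    define \<chi> where "\<chi> x = (if x \<in> vars_clause c then subst_trm (csub k N) (\<xi> (h x)) else \<sigma> x)" for x
    have \<chi>g: "\<chi> (g x) = subst_trm (csub k N) (\<xi> x)" if "x \<in> vars_clause d'" for x
      using that g(1) by (simp add: \<chi>_def vc h_def)
    have \<chi>c: "subst_atom \<chi> (subst_atom (\<lambda>x. Var (g x)) b) = subst_atom (csub k N) (subst_atom \<xi> b)"
      if "avars b \<subseteq> vars_clause d'" for b
      using that \<chi>g by (auto simp: subst_atom_subst_atom intro!: subst_atom_cong)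
    have \<chi>R: "subst_atom \<chi> b = subst_atom \<sigma> b" if "b \<in> set R" for b
      using that g(2) by (intro subst_atom_cong) (auto simp: \<chi>_def vc vars_query_avars)
    have R: "R \<noteq> []" using \<sigma> ldn by auto
    have "subst_atom \<chi> (R ! 0) = inst N (slab k)"
    proof -
      have "ld n \<noteq> []" using ldn by (metis list.distinct(1))
      then have "subst_atom \<sigma> (hd R) = inst N (slab k)" using \<sigma> R wk by (metis hd_map)
      then show ?thesis using \<chi>R[of "hd R"] R by (simp add: hd_conv_nth[symmetric])
    qed
    also have "\<dots> = subst_atom (csub k N) (satom k)" using inst_eq[OF selected_mem] \<open>N > k\<close> by simp
    also have "\<dots> = subst_atom (csub k N) (head (cls D k))"
      using mgu[of k] csub_left[OF \<open>N > k\<close>] by (simp add: is_mgu_def unifier_def subst_atom_subst_comp)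
    also have "\<dots> = subst_atom \<chi> (head c)"
      using \<chi>c[OF vd(1)] by (simp add: c_def d'_def subst_clause_def \<xi>)
    finally have "unifier \<chi> (R ! 0) (head c)" by (simp add: unifier_def)
    moreover have "map (subst_atom \<chi>) (tl R) = map (inst N) (tl (ld n))"
    proof -
      have "map (subst_atom \<chi>) (tl R) = map (subst_atom \<sigma>) (tl R)" using \<chi>R by (auto dest: list.set_sel(2)[OF R])
      then show ?thesis using \<sigma> by (metis map_tl)
    qed
    moreover have "map (subst_atom \<chi>) (body c) = map (inst N) (children k)"
    proof -
      have "map (subst_atom \<chi>) (body c) = map (subst_atom (csub k N)) (map (subst_atom \<xi>) (body d'))"
        using \<chi>c[OF vd(2)] by (simp add: c_def subst_clause_def subst_query_def)
      also have "map (subst_atom \<xi>) (body d') = permute (perm k) (body (cls D k))"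
        using permute_map[OF pd, of "subst_atom \<xi>"] by (simp add: d'_def \<xi> subst_clause_def subst_query_def perm_def d_def)
      also have "map (subst_atom (csub k N)) \<dots> = map (\<lambda>c. inst N (slab k @ [c])) [1..<Suc (length (body (cls D k)))]"
      proof (rule map_permute[OF permutes_perm])
        fix j assume j: "j \<in> {1..length (body (cls D k))}"
        show "subst_atom (csub k N) (nth1 (body (cls D k)) j) = inst N (slab k @ [perm k j])"
          using inst_eq[OF S_Suc_new[OF j], of N] \<open>N > k\<close> csub_left[OF \<open>N > k\<close>] by (simp add: subst_atom_subst_comp)
      qed
      finally show ?thesis by (simp add: children_def o_def del: upt_Suc)
    qed
    ultimately show ?thesis unfolding ldS map_append by (intro exI[of _ \<chi>]) simp
  qed
  obtain \<mu> where \<mu>: "is_mgu \<mu> (R ! 0) (head c)" using key[of B'] unifiable_imp_mgu by blast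
  define R' where "R' = subst_query \<mu> (take 0 R @ body c @ drop (Suc 0) R)"
  have "0 < length R" using B[of B'] ldn by (cases R) (auto simp: B'_def)
  moreover have "variant c d'" unfolding c_def using g(1) by (rule variant_renaming)
  ultimately have "resolution_step P' R 0 c \<mu> R'"
    unfolding resolution_step_def using \<mu> d'P g(2) by (auto simp: vc R'_def)
  moreover have "follows (Suc n) R'"
    unfolding follows_def
  proof (rule exI[of _ B'], intro allI impI)
    fix N assume N: "N \<ge> B'"
    then obtain \<chi> where \<chi>: "unifier \<chi> (R ! 0) (head c)" "map (subst_atom \<chi>) (body c @ tl R) = map (inst N) (ld (Suc n))"
      using key by blast
    then obtain \<tau> where "\<And>x. \<chi> x = subst_trm \<tau> (\<mu> x)" using \<mu> unfolding is_mgu_def by blast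
    then have "\<chi> = subst_comp \<mu> \<tau>" by (auto simp: subst_comp_def)
    then have "map (subst_atom \<tau>) R' = map (subst_atom \<chi>) (body c @ tl R)"
      by (simp add: R'_def subst_query_def drop_Suc subst_atom_subst_comp)
    then show "\<exists>\<tau>. map (subst_atom \<tau>) R' = map (inst N) (ld (Suc n))" using \<chi>(2) by metis
  qed
  ultimately show ?thesis by blast
qed

lemma infinite_LD_derivation:
  assumes P': "clauses P' = (\<lambda>c. Clause (head c) (permute (\<rho> c) (body c))) ` clauses P"
    and rs: "\<And>n. resolved n"
  shows "\<exists>D'. LD_derivation P' (permute \<pi> Q) D' \<and> steps D' = \<infinity>"
proof -
  define T where "T R R' \<longleftrightarrow> (\<exists>c \<mu>. resolution_step P' R 0 c \<mu> R')" for R R'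
  have "\<exists>q. \<forall>n. (follows n (q n) \<and> (n = 0 \<longrightarrow> q n = permute \<pi> Q)) \<and> T (q n) (q (Suc n))"
  proof (rule dependent_nat_choice)
    show "\<exists>x. follows 0 x \<and> ((0::nat) = 0 \<longrightarrow> x = permute \<pi> Q)" using follows_0 by blast
    show "\<exists>y. (follows (Suc n) y \<and> (Suc n = 0 \<longrightarrow> y = permute \<pi> Q)) \<and> T x y"
      if "follows n x \<and> (n = 0 \<longrightarrow> x = permute \<pi> Q)" for x n
      using follows_step[OF P', of n x] that rs[of n] unfolding T_def by blast
  qed
  then obtain q where q: "q 0 = permute \<pi> Q" "\<And>n. T (q n) (q (Suc n))" by blast
  then obtain c \<mu> where c: "\<And>n. resolution_step P' (q n) 0 (c n) (\<mu> n) (q (Suc n))" unfolding T_def by metis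
  define D' where "D' = \<lparr>steps = \<infinity>, qry = q, sel = (\<lambda>_. 0), cls = c, sub = \<mu>\<rparr>"
  have "LD_derivation P' (permute \<pi> Q) D'" using q(1) c by (simp add: LD_derivation_def derivation_def D'_def)
  then show ?thesis by (intro exI[of _ D']) (simp add: D'_def)
qed

end

lemma lx_minimal:
  assumes "finite A" "A \<noteq> {}" shows "\<exists>m\<in>A. \<forall>x\<in>A. \<not> lx x m"
proof -
  have "asymp_on A lx" by (rule asymp_onI) (metis lx_trans lx_irrefl)
  moreover have "transp_on A lx" by (rule transp_onI) (rule lx_trans)
  ultimately have "\<exists>m\<in>A. \<forall>x\<in>A. x \<noteq> m \<longrightarrow> \<not> lx x m"
    using Finite_Set.bex_min_element[OF assms(1) _ _ assms(2)] by simp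
  then show ?thesis by (metis lx_irrefl)
qed

section \<open>The frontier of the leftmost traversal and the node at which it gets stuck\<close>

context left_based_run
begin

lemma resolved_hd: "resolved n \<Longrightarrow> \<exists>k. ld n = slab k # tl (ld n) \<and> ld (Suc n) = children k @ tl (ld n)"
proof -
  assume r: "resolved n"
  define k where "k = inv slab (hd (ld n))"
  have "hd (ld n) = slab k" using r by (simp add: k_def resolved_def f_inv_into_f)
  then have "ld n = slab k # tl (ld n)" using r by (metis resolved_def list.collapse)
  then show ?thesis by (intro exI[of _ k]) (simp add: k_def)
qed

lemma set_children: "set (children k) = (\<lambda>c. slab k @ [c]) ` {1..length (body (cls D k))}"
  unfolding children_def list.set_map set_upt atLeastLessThanSuc_atLeastAtMost ..

lemma lab_0: "lab 0 = (\<lambda>c. [c]) ` {1..length Q}"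
proof -
  have "lab 0 = (\<lambda>j. [\<pi> j]) ` {1..length Q}" unfolding lab_def lquery.simps(1) set_zip_nth1 by force
  also have "\<dots> = (\<lambda>c. [c]) ` \<pi> ` {1..length Q}" by auto
  finally show ?thesis by (simp only: permutes_image[OF permutes_\<pi>])
qed

lemma ld_nodes: "\<forall>m<n. resolved m \<Longrightarrow> x \<in> set (ld n) \<Longrightarrow> \<exists>i. x \<in> lab i"
proof (induction n arbitrary: x)
  case 0
  from 0(2) have "x \<in> lab 0" unfolding lab_0 ld.simps(1) list.set_map set_upt atLeastLessThanSuc_atLeastAtMost .
  then show ?case ..
next
  case (Suc n)
  obtain k where k: "ld n = slab k # tl (ld n)" "ld (Suc n) = children k @ tl (ld n)"
    using resolved_hd[of n] Suc.prems(1) by blast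
  from Suc.prems(2) consider "x \<in> set (children k)" | "x \<in> set (tl (ld n))" unfolding k(2) by auto
  then show ?case
  proof cases
    case 1
    then show ?thesis using lab_Suc_new[of _ k] unfolding set_children by blast
  next
    case 2
    then have "x \<in> set (ld n)" using k(1) by (metis list.set_intros(2))
    then show ?thesis using Suc.IH Suc.prems(1) by simp
  qed
qed

lemma ld_sorted: "\<forall>m<n. resolved m \<Longrightarrow> sorted_wrt lx (ld n)"
proof (induction n)
  case 0
  then show ?case by (simp add: sorted_wrt_map strict_sorted_equal sorted_wrt_upt del: upt_Suc)
next
  case (Suc n)
  obtain k where k: "ld n = slab k # tl (ld n)" "ld (Suc n) = children k @ tl (ld n)"
    using resolved_hd[of n] Suc.prems(1) by blast
  have "sorted_wrt lx (ld n)" using Suc by simp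
  then have "sorted_wrt lx (slab k # tl (ld n))" using k(1) by metis
  then have "sorted_wrt lx (tl (ld n))" and "\<forall>x\<in>set (tl (ld n)). lx (slab k) x" by simp_all
  moreover have "sorted_wrt lx (children k)"
    unfolding children_def by (simp add: sorted_wrt_map sorted_wrt_upt del: upt_Suc)
  ultimately show ?case unfolding k(2) sorted_wrt_append set_children
    using lx_append[of "slab k" _ _ "[]"] by auto
qed

text \<open>The frontier \<open>ld n\<close> cuts the tree: replacing its first node by all the
  children of that node loses only the node itself.\<close>

lemma ld_covers:
  "\<forall>m<n. resolved m \<Longrightarrow> l \<in> lab j \<Longrightarrow>
   (\<exists>m<n. l = hd (ld m)) \<or> (\<exists>x\<in>set (ld n). prefix x l)"
proof (induction n)
  case 0
  then obtain l' where "l' \<in> lab 0" "prefix l' l" using ancestor[of 0 j l] by auto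
  then show ?case unfolding lab_0 ld.simps(1) list.set_map set_upt atLeastLessThanSuc_atLeastAtMost by blast
next
  case (Suc n)
  obtain k where k: "ld n = slab k # tl (ld n)" "ld (Suc n) = children k @ tl (ld n)"
    using resolved_hd[of n] Suc.prems(1) by blast
  have hd: "hd (ld n) = slab k" using k(1) by (metis list.sel(1))
  have "(\<exists>m<n. l = hd (ld m)) \<or> (\<exists>x\<in>set (ld n). prefix x l)" using Suc by simp
  then consider m where "m < n" "l = hd (ld m)" | "prefix (slab k) l" | x where "x \<in> set (tl (ld n))" "prefix x l"
    using k(1) by (metis set_ConsD)
  then show ?case
  proof cases
    case 1
    then show ?thesis by (intro disjI1 exI[of _ m]) simp
  next
    case 2
    from below_resolved[OF Suc.prems(2) 2] show ?thesis
    proof (elim disjE bexE)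
      assume "l = slab k"
      then show ?thesis using hd by (intro disjI1 exI[of _ n]) simp
    next
      fix c assume c: "c \<in> {1..length (body (cls D k))}" "prefix (slab k @ [c]) l"
      have "slab k @ [c] \<in> set (ld (Suc n))"
        unfolding k(2) set_append set_children by (intro UnI1 imageI c(1))
      then show ?thesis using c(2) by (intro disjI2 bexI)
    qed
  next
    case 3
    then show ?thesis unfolding k(2) by auto
  qed
qed

text \<open>At the first unresolved \<open>n\<close> the frontier is not empty, for otherwise all
  selected labels would be among the finitely many visited ones, although \<open>slab\<close> is
  injective. Its first node \<open>u\<close> is never selected and therefore persists, and the
  frontier is sorted.\<close>

lemma stuck:
  assumes "\<not> resolved n"
  shows "\<exists>u N. u \<notin> range slab \<and> (\<forall>i\<ge>N. u \<in> lab i \<and> (\<forall>l\<in>lab i. l = u \<or> lx u l))"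
proof -
  define n where "n = (LEAST n. \<not> resolved n)"
  have nr: "\<not> resolved n" unfolding n_def using assms by (rule LeastI)
  have rs: "\<forall>m<n. resolved m" using not_less_Least unfolding n_def by blast
  define Done where "Done = (\<lambda>m. hd (ld m)) ` {..<n}"
  have cov: "l \<in> Done \<or> (\<exists>x\<in>set (ld n). prefix x l)" if "l \<in> lab j" for l j
    using ld_covers[OF rs that] by (auto simp: Done_def)
  have "ld n \<noteq> []"
  proof
    assume "ld n = []"
    then have "range slab \<subseteq> Done" using cov slab_lab by fastforce
    then show False using inj_slab finite_subset[of "range slab" Done] finite_imageD[of slab UNIV]
      by (auto simp: Done_def)
  qed
  define u where "u = hd (ld n)"
  have u: "u \<notin> range slab" using nr \<open>ld n \<noteq> []\<close> by (simp add: resolved_def u_def)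
  have ldn: "ld n = u # tl (ld n)" using \<open>ld n \<noteq> []\<close> by (simp add: u_def)
  obtain i0 where i0: "u \<in> lab i0" using ld_nodes[OF rs, of u] ldn by (metis list.set_intros(1))
  have ui: "u \<in> lab i" if "i \<ge> i0" for i using stays[OF that i0] u by blast
  have "\<exists>k. \<forall>i>k. hd (ld m) \<notin> lab i" if mn: "m < n" for m
  proof -
    obtain k where k: "ld m = slab k # tl (ld m)" using resolved_hd[of m] rs mn by blast
    then have "hd (ld m) = slab k" by (metis list.sel(1))
    then show ?thesis using gone[of k] by (intro exI[of _ k]) auto
  qed
  then obtain K where K: "\<And>m i. m < n \<Longrightarrow> i > K m \<Longrightarrow> hd (ld m) \<notin> lab i" by metis
  \<comment> \<open>From \<open>N\<close> on, \<open>u\<close> is present and all visited nodes are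
    resolved, so every current label lies below the frontier.\<close>
  define N where "N = max i0 (Suc (Max (insert 0 (K ` {..<n}))))"
  have KN: "K m < i" if "m < n" "i \<ge> N" for m i
  proof -
    have "K m \<le> Max (insert 0 (K ` {..<n}))" using that(1) by (intro Max_ge) auto
    then show ?thesis using that(2) by (simp add: N_def)
  qed
  have least: "l = u \<or> lx u l" if il: "i \<ge> N" "l \<in> lab i" for i l
  proof -
    have "l \<notin> Done" using K KN il by (auto simp: Done_def)
    then obtain x where x: "x \<in> set (ld n)" "prefix x l" using cov[OF il(2)] by blast
    show ?thesis
    proof (cases "x = u")
      case True
      then show ?thesis using lab_prefix[OF ui il(2)] x(2) il(1) by (auto simp: N_def)
    next
      case False
      then have "x \<in> set (tl (ld n))" using x(1) ldn by (metis set_ConsD)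
      moreover have "sorted_wrt lx (u # tl (ld n))" using ld_sorted[OF rs] ldn by metis
      ultimately have "lx u x" by simp
      then show ?thesis using x(2) lx_append[of u x "[]"] by (auto simp: prefix_def)
    qed
  qed
  have "u \<in> lab i" if "i \<ge> N" for i using ui that by (simp add: N_def)
  then show ?thesis using u least by blast
qed


section \<open>Textual positions and waiting atoms\<close>

definition labs :: "nat \<Rightarrow> nat list list" where
  "labs i = map fst (lquery i)"

definition width :: "nat \<Rightarrow> nat" where
  "width i = length (body (cls D i))"

lemma length_labs: "length (labs i) = length (lquery i)"
  by (simp add: labs_def)

lemma sel_labs: "sel D i < length (labs i)" "labs i ! sel D i = slab i"
  using sel_less[of i] by (simp_all add: labs_def slab_def)

lemma set_labs: "set (labs i) = lab i"
  by (simp add: labs_def lab_def)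

lemma labs_Suc: "labs (Suc i) = take (sel D i) (labs i) @ map (\<lambda>j. slab i @ [perm i j]) [1..<Suc (width i)] @
    drop (Suc (sel D i)) (labs i)"
  by (simp add: labs_def lquery_Suc width_def case_prod_unfold o_def map_fst_zip[unfolded o_def] take_map drop_map
      del: upt_Suc)

lemma labs_left: "k < sel D i \<Longrightarrow> labs (Suc i) ! k = labs i ! k"
  using sel_labs[of i] by (simp add: labs_Suc nth_append del: upt_Suc)

lemma labs_child: "t < width i \<Longrightarrow> labs (Suc i) ! (sel D i + t) = slab i @ [perm i (Suc t)]"
  using sel_labs[of i] by (simp add: labs_Suc nth_append del: upt_Suc)

text \<open>An atom to the right shifts by \<open>width i - 1\<close>, which is negative for an
  empty body; hence the index \<open>Suc k - width i\<close> into the old query.\<close>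

lemma labs_right: "sel D i + width i \<le> k \<Longrightarrow> labs (Suc i) ! k = labs i ! (Suc k - width i)"
proof -
  assume k: "sel D i + width i \<le> k"
  then have "\<not> k < sel D i" "\<not> k - sel D i < width i" "Suc (sel D i + (k - sel D i - width i)) = Suc k - width i"
    by linarith+
  then show ?thesis using sel_labs[of i] by (simp add: labs_Suc nth_append del: upt_Suc)
qed

lemma length_labs_Suc: "Suc (length (labs (Suc i))) = length (labs i) + width i"
  using sel_labs[of i] by (simp add: labs_Suc del: upt_Suc)

lemma labs_Suc_cases:
  assumes "k < length (labs (Suc i))"
  obtains (left) "k < sel D i" "labs (Suc i) ! k = labs i ! k"
  | (child) t where "t < width i" "k = sel D i + t" "labs (Suc i) ! k = slab i @ [perm i (Suc t)]"
  | (right) "sel D i + width i \<le> k" "Suc k - width i < length (labs i)" "labs (Suc i) ! k = labs i ! (Suc k - width i)"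
proof -
  consider "k < sel D i" | "sel D i \<le> k" "k < sel D i + width i" | "sel D i + width i \<le> k" by linarith
  then show ?thesis
  proof cases
    case 2
    then show ?thesis using child[of "k - sel D i"] labs_child[of "k - sel D i" i] by simp
  next
    case 3
    then show ?thesis using right labs_right[of i k] assms length_labs_Suc[of i] by linarith
  qed (use left labs_left in blast)
qed

text \<open>Labels stay in this set after they have been resolved: it records all nodes of the tree
  born so far in an unsafe position, and prefixes of current labels are looked up in it.\<close>

primrec unsafe :: "nat \<Rightarrow> nat list set" where
  "unsafe 0 = (\<lambda>j. [\<pi> j]) ` {j \<in> {1..length Q}. \<not> safe_position \<pi> j}"
| "unsafe (Suc i) = unsafe i \<union> (\<lambda>j. slab i @ [perm i j]) ` {j \<in> {1..width i}. \<not> safe_position (perm i) j}"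

lemma unsafe_mono: "i \<le> j \<Longrightarrow> unsafe i \<subseteq> unsafe j"
  by (rule lift_Suc_mono_le[of unsafe]) auto

lemma finite_unsafe: "finite (unsafe i)"
  by (induction i) auto

lemma unsafe_birth: "x \<in> unsafe i \<Longrightarrow> \<exists>i'\<le>i. x \<in> unsafe i' \<and> x \<in> lab i'"
proof (induction i)
  case 0
  then obtain j where j: "j \<in> {1..length Q}" "x = [\<pi> j]" by auto
  have "\<pi> j \<in> {1..length Q}" using j(1) permutes_\<pi> by (metis permutes_in_image)
  then show ?case using 0 j(2) by (auto simp: lab_0)
next
  case (Suc i)
  show ?case
  proof (cases "x \<in> unsafe i")
    case True
    then show ?thesis using Suc.IH le_SucI by blast
  next
    case False
    then obtain j where "j \<in> {1..width i}" "x = slab i @ [perm i j]" using Suc.prems by auto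
    then have "x \<in> lab (Suc i)" using S_Suc_new[of j i] lab_iff unfolding width_def by blast
    then show ?thesis using Suc.prems by blast
  qed
qed

lemma child_not_old: "i' \<le> i \<Longrightarrow> slab i @ [c] \<notin> lab i'"
proof
  assume "i' \<le> i" "slab i @ [c] \<in> lab i'"
  moreover obtain l' where l': "l' \<in> lab i'" "prefix l' (slab i)" using ancestor[OF \<open>i' \<le> i\<close> slab_lab] by blast
  moreover have "prefix l' (slab i @ [c])" using l'(2) by (rule prefix_prefix)
  ultimately have "l' = slab i @ [c]" using lab_prefix by blast
  then show False using l'(2) by (simp add: prefix_def)
qed

text \<open>In a fed query or body, an atom in an unsafe position depends only on robust predicates,
  among them its own. The predicate does not change under renaming and instantiation.\<close>

lemma unsafe_robust: "(l, a) \<in> S i \<Longrightarrow> l \<in> unsafe i \<Longrightarrow> robust P (pred a)"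
proof (induction i arbitrary: a)
  case 0
  then obtain j where j: "j \<in> {1..length Q}" "l = [\<pi> j]" "\<not> safe_position \<pi> j" by auto
  obtain j' where j': "j' \<in> {1..length Q}" "l = [\<pi> j']" "a = nth1 Q j'"
    using 0(1) unfolding lquery.simps(1) set_zip_nth1 by auto
  then have "j' = j" using j(2) permutes_inj[OF permutes_\<pi>] by (auto dest: injD)
  moreover have "fed P \<pi> Q" using well_fed(2) by (simp add: well_fed_query_def)
  ultimately show ?case using j j' unfolding fed_def depends_on_def by blast
next
  case (Suc i)
  from Suc.prems(1) show ?case
  proof (cases rule: S_Suc_cases)
    case (old b')
    have "l \<noteq> slab i @ [perm i j]" for j
      using lab_prefix[OF slab_lab, of l i] old(1,2) lab_iff by (metis prefixI)
    then have "l \<in> unsafe i" using Suc.prems(2) by auto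
    then show ?thesis using Suc.IH[OF old(1)] old(3) by simp
  next
    case (new j)
    have "l \<notin> unsafe i" using unsafe_birth[of l i] child_not_old[of _ i] new(2) by blast
    then obtain j' where j': "j' \<in> {1..width i}" "l = slab i @ [perm i j']" "\<not> safe_position (perm i) j'"
      using Suc.prems(2) by auto
    then have "j' = j" using new(2) permutes_inj[OF permutes_perm] by (auto dest: injD)
    obtain \<xi> where \<xi>: "cls D i = subst_clause \<xi> (origin i)" using origin(2)[of i] by (auto simp: variant_def)
    have bd: "body (cls D i) = map (subst_atom \<xi>) (body (origin i))" by (simp add: \<xi> subst_clause_def subst_query_def)
    have "fed P (perm i) (body (origin i))"
      using well_fed(1) origin(1) by (simp add: well_fed_program_def well_fed_clause_def perm_def)
    moreover have "j \<in> {1..length (body (origin i))}" using new(1) by (simp add: bd)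
    ultimately have "robust P (pred (nth1 (body (origin i)) j))"
      using j'(3) \<open>j' = j\<close> unfolding fed_def depends_on_def by blast
    then show ?thesis using new(3) \<open>j \<in> {1..length (body (origin i))}\<close> by (simp add: bd nth1_map)
  qed
qed

text \<open>A safe position is preceded in the text by everything that precedes it in the data flow.
  Two labels diverge either at siblings or at atoms of the initial query, where safety of the second
  one decides; descendants inherit the textual order of their ancestors.\<close>

lemma text_order:
  "p < length (labs i) \<Longrightarrow> q < length (labs i) \<Longrightarrow> lx (labs i ! p) (labs i ! q) \<Longrightarrow>
   (\<And>x. prefix x (labs i ! q) \<Longrightarrow> x \<notin> unsafe i) \<Longrightarrow> p < q"
proof (induction i arbitrary: p q)
  case 0
  have lq: "length (labs 0) = length Q" by (simp add: labs_def del: upt_Suc)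
  have lb: "labs 0 ! p = [\<pi> (Suc p)]" if "p < length Q" for p using that by (simp add: labs_def del: upt_Suc)
  have "\<pi> (Suc p) < \<pi> (Suc q)" using 0(1-3) lb unfolding lq by simp
  moreover have "[\<pi> (Suc q)] \<notin> unsafe 0" using 0(4)[of "[\<pi> (Suc q)]"] lb 0(2) unfolding lq by simp
  then have "safe_position \<pi> (Suc q)" using 0(2) unfolding lq by auto
  ultimately show ?case by (auto simp: safe_position_def)
next
  case (Suc i)
  define k where "k = sel D i"
  have ns: "x \<notin> unsafe i" if "prefix x (labs (Suc i) ! q)" for x using Suc.prems(4)[OF that] by simp
  \<comment> \<open>No other current atom lies below the selected one, so comparing it with a child
    of the selected atom amounts to comparing it with the parent.\<close>
  have ne: "\<not> prefix (slab i) (labs i ! r)" if "r < length (labs i)" "r \<noteq> k" for r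
  proof -
    have "distinct (labs i)" using invariant by (simp add: labs_def)
    then have "labs i ! r \<noteq> slab i" using that sel_labs[of i] nth_eq_iff_index_eq unfolding k_def by metis
    moreover have "labs i ! r \<in> lab i" using that(1) set_labs nth_mem by blast
    ultimately show ?thesis using lab_prefix[OF slab_lab] by metis
  qed
  note IH = Suc.IH[OF _ _ _ ns]
  note sl = sel_labs[of i, folded k_def]
  from Suc.prems(1) show ?case
  proof (cases rule: labs_Suc_cases)
    case pl: left
    note pl = pl[folded k_def]
    from Suc.prems(2) show ?thesis
    proof (cases rule: labs_Suc_cases)
      case left
      then show ?thesis using IH[of p q] Suc.prems(3) pl sl by (simp add: k_def)
    qed (use pl in \<open>simp_all add: k_def\<close>)
  next
    case pc: (child t)
    from Suc.prems(2) show ?thesis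
    proof (cases rule: labs_Suc_cases)
      case left
      note left = left[folded k_def]
      have "lx (slab i) (labs i ! q)"
        using Suc.prems(3) pc(3) left(2) lx_append_left[of "slab i"] ne[of q] left(1) sl(1) by simp
      then have "k < q" using IH[of k q] sl left by simp
      then show ?thesis using left(1) by simp
    next
      case (child t')
      have "perm i (Suc t) < perm i (Suc t')" using Suc.prems(3) pc(3) child(3) by simp
      moreover have "slab i @ [perm i (Suc t')] \<notin> unsafe (Suc i)" using Suc.prems(4) child(3) by simp
      then have "safe_position (perm i) (Suc t')" using child(1) by auto
      ultimately show ?thesis using pc(2) child(2) by (auto simp: safe_position_def)
    qed (use pc in simp)
  next
    case pr: right
    note pr = pr[folded k_def]
    from Suc.prems(2) show ?thesis
    proof (cases rule: labs_Suc_cases)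
      case left
      note left = left[folded k_def]
      have "lx (labs i ! (Suc p - width i)) (labs i ! q)" using Suc.prems(3) pr(3) left(2) by simp
      then have "Suc p - width i < q" using IH[of "Suc p - width i" q] pr left sl by simp
      then show ?thesis using left pr by simp
    next
      case (child t)
      note child = child[folded k_def]
      have "lx (labs i ! (Suc p - width i)) (slab i)"
        using Suc.prems(3) pr child(3) lx_append_right[of _ "slab i"] ne[of "Suc p - width i"] by simp
      moreover have "x \<notin> unsafe i" if "prefix x (slab i)" for x
        using ns[of x] that child(3) by (simp add: prefix_order.trans[OF that])
      ultimately have "Suc p - width i < k" using Suc.IH[of "Suc p - width i" k] sl pr by simp
      then show ?thesis using pr by simp
    next
      case right
      note right = right[folded k_def]
      have "Suc p - width i < Suc q - width i" using IH[of "Suc p - width i" "Suc q - width i"] Suc.prems(3) pr right by simp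
      then show ?thesis by simp
    qed
  qed
qed

lemma descendant_prefix:
  assumes "descendant D (i, k) (j, l)" "k < length (labs i)"
  shows "i \<le> j \<and> l < length (labs j) \<and> prefix (labs i ! k) (labs j ! l)"
  using assms(1) unfolding descendant_def
proof (induction "(j, l)" arbitrary: j l rule: rtranclp_induct)
  case base
  then show ?case using assms(2) by simp
next
  case (step y)
  obtain j' l' where y: "y = (j', l')" by (cases y)
  then have IH: "i \<le> j'" "l' < length (labs j')" "prefix (labs i ! k) (labs j' ! l')" using step.hyps(3) by blast+
  have d: "j = Suc j'" "l' < sel D j' \<and> l = l' \<or>
      l' = sel D j' \<and> l' \<le> l \<and> l < l' + width j' \<or> sel D j' < l' \<and> Suc l = l' + width j'"
    using step.hyps(2) unfolding y direct_descendant_def width_def by auto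
  from d(2) show ?case
  proof (elim disjE conjE)
    assume "l' < sel D j'" "l = l'"
    then show ?thesis using IH labs_left length_labs_Suc[of j'] sel_labs(1)[of j'] d(1) by auto
  next
    assume l: "l' = sel D j'" "l' \<le> l" "l < l' + width j'"
    then have "labs j ! l = slab j' @ [perm j' (Suc (l - l'))]" using labs_child[of "l - l'" j'] d(1) by simp
    then show ?thesis using IH l sel_labs(2)[of j'] length_labs_Suc[of j'] d(1) sel_labs(1)[of j'] by (simp add: prefix_order.trans)
  next
    assume l: "sel D j' < l'" "Suc l = l' + width j'"
    then have "labs j ! l = labs j' ! l'" using labs_right[of j' l] d(1) by simp
    then show ?thesis using IH l length_labs_Suc[of j'] d(1) by simp
  qed
qed

text \<open>Without unsafe ancestors, \<open>text_order\<close> places the least atom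
  \<open>u\<close> to the left of the selected one. As \<open>u\<close> is selectable, the selected
  atom is not the leftmost selectable one and must be waiting, which leads to a contradiction at the
  stage \<open>j\<close> where the waiting began.\<close>

lemma selected_has_unsafe_prefix:
  assumes u: "u \<in> lab i" "u \<notin> range slab" and least: "\<And>l. l \<in> lab i \<Longrightarrow> l = u \<or> lx u l"
  shows "\<exists>x\<in>unsafe i. prefix x (slab i)"
proof (rule ccontr)
  assume "\<not> ?thesis"
  then have safe: "x \<notin> unsafe i" if "prefix x (slab i)" for x using that by blast
  have sel: "selectable P (qry D j ! p)" if "p < length (labs j)" "\<And>l. l \<in> lab j \<Longrightarrow> \<not> lx l (labs j ! p)" for j p
  proof (rule leftmost_imp_selectable[OF program(1) robust_S])
    show "(labs j ! p, qry D j ! p) \<in> S j"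
      using that(1) qry_nth[of p j] nth_mem[of p "lquery j"] by (simp add: labs_def)
    show "\<not> lx l (labs j ! p)" if "(l, b) \<in> S j" for l b using \<open>\<And>l. l \<in> lab j \<Longrightarrow> \<not> lx l (labs j ! p)\<close> that lab_iff by blast
  qed
  obtain p where p: "p < length (labs i)" "labs i ! p = u" using u(1) unfolding set_labs[symmetric] in_set_conv_nth by blast
  have "slab i \<noteq> u" using u(2) by auto
  then have "lx u (slab i)" using least[OF slab_lab] by blast
  then have "p < sel D i" using text_order[OF p(1) sel_labs(1)] safe p(2) sel_labs(2) by simp
  moreover have "selectable P (qry D i ! p)"
    using least lx_trans lx_irrefl p by (intro sel) blast+
  ultimately have "\<not> leftmost_selectable P (qry D i) (sel D i)" by (auto simp: leftmost_selectable_def)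
  then have "waiting P D (i, sel D i)" using left_based inf unfolding left_based_def by auto
  then obtain j R1 R2 k where j: "qry D j = R1 @ R2" "\<forall>a\<in>set R1. \<not> selectable P a" "k < length R1"
    "descendant D (j, k) (i, sel D i)" unfolding waiting_def by blast
  have len: "length R1 \<le> length (labs j)" using arg_cong[OF j(1), of length] by (simp add: length_labs length_qry)
  have k: "k < length (labs j)" using j(3) len by simp
  have ji: "j \<le> i" and pre: "prefix (labs j ! k) (slab i)"
    using descendant_prefix[OF j(4) k] sel_labs(2)[of i] by simp_all
  have "lab j \<noteq> {}" using slab_lab by blast
  \<comment> \<open>The least atom \<open>z\<close> of stage \<open>j\<close> is selectable, hence
    outside \<open>R1\<close> and to the right of \<open>k\<close>. But \<open>text_order\<close>,
    applied to the safe ancestor at \<open>k\<close>, places it to the left.\<close>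
  then obtain z where z: "z \<in> lab j" "\<And>l. l \<in> lab j \<Longrightarrow> \<not> lx l z" using lx_minimal[of "lab j"] by (auto simp: lab_def)
  obtain q where q: "q < length (labs j)" "labs j ! q = z" using z(1) unfolding set_labs[symmetric] in_set_conv_nth by blast
  have "selectable P (qry D j ! q)" using z(2) q by (intro sel) auto
  then have "length R1 \<le> q" using j(1,2) q(1) by (metis nth_append nth_mem not_le)
  then have "k < q" using j(3) by simp
  have kl: "labs j ! k \<in> lab j" using k set_labs nth_mem by blast
  have "distinct (labs j)" using invariant by (simp add: labs_def)
  then have "labs j ! k \<noteq> z" using q k \<open>k < q\<close> nth_eq_iff_index_eq by (metis less_irrefl)
  then have "lx z (labs j ! k)" using lab_total[OF kl z(1)] z(2)[OF kl] by blast
  moreover have "x \<notin> unsafe j" if "prefix x (labs j ! k)" for x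
    using safe[of x] unsafe_mono[OF ji] prefix_order.trans[OF that pre] by blast
  ultimately have "q < k" using text_order[OF q(1) k] q(2) by simp
  then show False using \<open>k < q\<close> by simp
qed

text \<open>
  All steps after some stage \<open>N\<close> take place below unsafe nodes. Hence the minimal unsafe nodes are
  created before \<open>N\<close>, so they are finitely many and \<open>\<alpha>\<close> may be chosen among them.
\<close>

lemma active_unsafe_node:
  assumes "\<not> resolved n"
  obtains \<alpha> a i0 where "(\<alpha>, a) \<in> S i0" "robust P (pred a)"
    "infinite {i. prefix \<alpha> (slab i)}" "finite {i. lx (slab i) \<alpha>}"
proof -
  from stuck[OF assms] obtain u N where u: "u \<notin> range slab"
    "\<forall>i\<ge>N. u \<in> lab i \<and> (\<forall>l\<in>lab i. l = u \<or> lx u l)" by (elim exE conjE)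
  have us: "\<exists>x\<in>unsafe i. prefix x (slab i)" if "i \<ge> N" for i
    using selected_has_unsafe_prefix[OF _ u(1)] u(2) that by simp
  define U where "U = (\<Union>i. unsafe i)"
  define A where "A = {x \<in> U. \<forall>y\<in>U. prefix y x \<longrightarrow> y = x}"
  have "A \<subseteq> unsafe N"
  proof
    fix x assume x: "x \<in> A"
    then obtain i where i: "x \<in> unsafe i" by (auto simp: A_def U_def)
    have "x \<in> unsafe j \<Longrightarrow> x \<in> unsafe N" for j
    proof (induction j)
      case 0
      then show ?case using unsafe_mono[of 0 N] by blast
    next
      case (Suc j)
      show ?case
      proof (rule ccontr)
        assume n: "x \<notin> unsafe N"
        then have "x \<notin> unsafe j" using Suc.IH by blast
        then obtain c where c: "x = slab j @ [c]" using Suc.prems by auto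
        have "N \<le> j" using n Suc.prems unsafe_mono[of "Suc j" N] by (meson not_less_eq_eq subsetD)
        then obtain y where y: "y \<in> unsafe j" "prefix y (slab j)" using us by blast
        then have "prefix y x" "y \<noteq> x" using c by (auto simp: prefix_def)
        then show False using x y(1) by (auto simp: A_def U_def)
      qed
    qed
    then show "x \<in> unsafe N" using i by blast
  qed
  then have finA: "finite A" using finite_unsafe finite_subset by blast
  have minimal: "\<exists>y\<in>A. prefix y x" if "x \<in> U" for x
    using that
  proof (induction "length x" arbitrary: x rule: less_induct)
    case less
    show ?case
    proof (cases "x \<in> A")
      case False
      then obtain y where y: "y \<in> U" "prefix y x" "y \<noteq> x" using less.prems by (auto simp: A_def)
      then have "length y < length x" by (metis prefix_length_less strict_prefixI)
      then obtain z where "z \<in> A" "prefix z y" using less.hyps y(1) by blast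
      then show ?thesis using y(2) prefix_order.trans by blast
    qed blast
  qed
  have usA: "\<exists>x\<in>A. prefix x (slab i)" if "i \<ge> N" for i
    using us[OF that] minimal prefix_order.trans unfolding U_def by blast
  define I where "I x = {i. prefix x (slab i)}" for x
  define A' where "A' = {x \<in> A. infinite (I x)}"
  have "A' \<noteq> {}"
  proof
    assume "A' = {}"
    then have "finite (\<Union>x\<in>A. I x)" using finA by (auto simp: A'_def)
    moreover have "{N..} \<subseteq> (\<Union>x\<in>A. I x)" using usA by (auto simp: I_def)
    ultimately show False using finite_subset infinite_Ici by blast
  qed
  then obtain \<alpha> where \<alpha>: "\<alpha> \<in> A'" "\<And>x. x \<in> A' \<Longrightarrow> \<not> lx x \<alpha>"
    using lx_minimal[of A'] finA by (auto simp: A'_def)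
  \<comment> \<open>A step left of \<open>\<alpha>\<close> from stage \<open>N\<close> on lies below
    a minimal unsafe node \<open>x\<close>. If \<open>x\<close> were in \<open>A'\<close>, the
    choice of \<open>\<alpha>\<close> and the incomparability of minimal nodes would put
    \<open>x\<close>, and with it the step, to the right of \<open>\<alpha>\<close>.\<close>
  have "{i. lx (slab i) \<alpha>} \<subseteq> {..<N} \<union> (\<Union>x\<in>A - A'. I x)"
  proof
    fix i assume "i \<in> {i. lx (slab i) \<alpha>}"
    then have i: "lx (slab i) \<alpha>" by simp
    show "i \<in> {..<N} \<union> (\<Union>x\<in>A - A'. I x)"
    proof (cases "i < N")
      case False
      then obtain x where x: "x \<in> A" "prefix x (slab i)" using usA[of i] by auto
      have "x \<notin> A'"
      proof
        assume xA: "x \<in> A'"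
        have "x \<noteq> \<alpha>" using x(2) lx_not_prefix[OF i] by auto
        moreover have "\<not> prefix x \<alpha>" "\<not> prefix \<alpha> x" using \<alpha>(1) x(1) \<open>x \<noteq> \<alpha>\<close> by (auto simp: A'_def A_def)
        ultimately have "lx \<alpha> x" using lx_total \<alpha>(2)[OF xA] by blast
        then have "lx \<alpha> (slab i)" using x(2) lx_append[of \<alpha> x "[]"] by (auto simp: prefix_def)
        then show False using i lx_trans lx_irrefl by blast
      qed
      then show ?thesis using x by (auto simp: I_def)
    qed simp
  qed
  moreover have "finite ({..<N} \<union> (\<Union>x\<in>A - A'. I x))" using finA by (auto simp: A'_def)
  ultimately have fin: "finite {i. lx (slab i) \<alpha>}" using finite_subset by blast
  have "\<alpha> \<in> unsafe N" using \<alpha>(1) \<open>A \<subseteq> unsafe N\<close> by (auto simp: A'_def)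
  then obtain i0 where i0: "\<alpha> \<in> unsafe i0" "\<alpha> \<in> lab i0" using unsafe_birth by blast
  then obtain a where a: "(\<alpha>, a) \<in> S i0" using lab_iff by blast
  show ?thesis
    by (rule that[OF a unsafe_robust[OF a i0(1)] _ fin]) (use \<alpha>(1) in \<open>simp add: A'_def I_def\<close>)
qed

end

section \<open>Simulating the steps below a node\<close>

text \<open>Each output position can be typed by itself: a bound one is type-consistent, a free one
  holds a variable and its type is nonempty. Different output positions share no variables, so the
  separate substitutions can be glued.\<close>

lemma outputs_typable:
  assumes wf: "wf_program P" and rl: "robust_labelled P S"
  shows "\<exists>\<eta>. \<forall>(l, b)\<in>S. outputs_typed P (subst_atom \<eta> b)"
proof -
  define A where "A = {(l, b, k). (l, b) \<in> S \<and> k \<in> out_pos P (pred b)}"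
  define X where "X = (\<lambda>(l::nat list, b, k). set (occs (args (b :: ('a, 'b, 'c) atom) ! k)))"
  have "\<exists>\<mu>. subst_trm \<mu> (args b ! k) \<in> ptype P (pred b) ! k" if b: "(l, b) \<in> S" and k: "k \<in> out_pos P (pred b)" for l b k
  proof (cases "bound P (pred b) k")
    case True
    then show ?thesis using robust_labelledD(3)[OF rl b k] by (simp add: robust_position_def type_consistent_def)
  next
    case False
    then obtain x where x: "args b ! k = Var x"
      using robust_labelledD(3)[OF rl b k] by (auto simp: robust_position_def is_var_def)
    have "pred b \<in> preds P" using robust_labelledD(1)[OF rl b] by (simp add: wf_atom_def)
    then have "is_type (ptype P (pred b) ! k)" using wf k by (auto simp: wf_program_def out_pos_def)
    then obtain t where "t \<in> ptype P (pred b) ! k" by (auto simp: is_type_def)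
    then show ?thesis using x by (intro exI[of _ "\<lambda>_. t"]) simp
  qed
  then have "\<forall>u\<in>A. \<exists>\<mu>. subst_trm \<mu> (args (fst (snd u)) ! snd (snd u)) \<in> ptype P (pred (fst (snd u))) ! snd (snd u)"
    by (auto simp: A_def)
  from bchoice[OF this] obtain \<mu> where
    "\<forall>u\<in>A. subst_trm (\<mu> u) (args (fst (snd u)) ! snd (snd u)) \<in> ptype P (pred (fst (snd u))) ! snd (snd u)" ..
  then have \<mu>: "\<And>l b k. (l, b, k) \<in> A \<Longrightarrow> subst_trm (\<mu> (l, b, k)) (args b ! k) \<in> ptype P (pred b) ! k"
    by force
  have disj: "X u \<inter> X v = {}" if uv: "u \<in> A" "v \<in> A" "u \<noteq> v" for u v
  proof -
    obtain l b k where u1: "u = (l, b, k)" by (cases u)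
    obtain l' b' k' where v1: "v = (l', b', k')" by (cases v)
    have u2: "(l, b) \<in> S" "k \<in> out_pos P (pred b)" and v2: "(l', b') \<in> S" "k' \<in> out_pos P (pred b')"
      using uv u1 v1 by (simp_all add: A_def)
    note u = u1 u2 and v = v1 v2
    show ?thesis
    proof (cases "l = l'")
      case True
      then have "b = b'" using robust_labelledD2(2)[OF rl u(2) v(2)] by simp
      moreover from this have "k \<noteq> k'" using uv(3) u v True by simp
      ultimately show ?thesis using robust_labelledD(2)[OF rl u(2)] u v by (auto simp: plin_def X_def)
    next
      case False
      then show ?thesis using robust_labelledD2(3)[OF rl u(2) v(2)] ovars_nth[OF u(3)] ovars_nth[OF v(3)] u v
        by (auto simp: X_def)
    qed
  qed
  obtain \<eta> where \<eta>: "\<And>u x. u \<in> A \<Longrightarrow> x \<in> X u \<Longrightarrow> \<eta> x = \<mu> u x"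
    using glue_substitutions[of A X \<mu>] disj by metis
  have "outputs_typed P (subst_atom \<eta> b)" if b: "(l, b) \<in> S" for l b
    unfolding outputs_typed_def
  proof (intro ballI)
    fix k assume "k \<in> out_pos P (pred (subst_atom \<eta> b))"
    then have k: "k \<in> out_pos P (pred b)" by simp
    then have u: "(l, b, k) \<in> A" using b by (simp add: A_def)
    have "subst_trm \<eta> (args b ! k) = subst_trm (\<mu> (l, b, k)) (args b ! k)"
      using \<eta>[OF u] by (intro subst_trm_cong) (simp add: X_def)
    then show "args (subst_atom \<eta> b) ! k \<in> ptype P (pred (subst_atom \<eta> b)) ! k"
      using \<mu>[OF u] args_subst_nth(2)[OF robust_labelledD(1)[OF rl b] k, of \<eta>] by simp
  qed
  then show ?thesis by blast
qed

lemma variant_trans: "variant c d \<Longrightarrow> variant d e \<Longrightarrow> variant c e"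
proof -
  assume "variant c d" "variant d e"
  then obtain \<sigma> \<tau> \<sigma>' \<tau>' where "c = subst_clause \<sigma> d" "d = subst_clause \<tau> c" "d = subst_clause \<sigma>' e" "e = subst_clause \<tau>' d"
    unfolding variant_def by blast
  moreover have "subst_clause \<sigma> (subst_clause \<tau> x) = subst_clause (subst_comp \<tau> \<sigma>) x" for \<sigma> \<tau> and x :: "('a, 'b, 'c) clause"
    by (simp add: subst_clause_def subst_query_def subst_atom_subst_comp)
  ultimately show ?thesis unfolding variant_def by metis
qed

text \<open>Turns a simulation in which only the stages in \<open>A\<close> are genuine steps into a
  derivation: \<open>R\<close> is constant between consecutive elements of \<open>A\<close>.\<close>

lemma skip_idle_steps:
  fixes A :: "nat set"
  assumes inf: "infinite A" and idle: "\<And>n. n \<notin> A \<Longrightarrow> R (Suc n) = R n"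
  obtains e where "\<And>n. e n \<in> A" "R (e 0) = R 0" "\<And>n. R (e (Suc n)) = R (Suc (e n))"
proof -
  have const: "m \<le> k \<Longrightarrow> (\<And>j. m \<le> j \<Longrightarrow> j < k \<Longrightarrow> j \<notin> A) \<Longrightarrow> R k = R m" for m k
  proof (induction k)
    case (Suc k)
    then show ?case using idle[of k] by (cases "m = Suc k") (auto simp: le_Suc_eq)
  qed simp
  define e where "e = enumerate A"
  have mem: "e n \<in> A" for n unfolding e_def using inf by (rule enumerate_in_set)
  have "R (e 0) = R 0" by (rule const) (auto simp: e_def enumerate_0 dest: not_less_Least)
  moreover have "R (e (Suc n)) = R (Suc (e n))" for n
  proof (rule const)
    show "Suc (e n) \<le> e (Suc n)" unfolding e_def using enumerate_step[OF inf] by (simp add: Suc_le_eq)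
    fix j assume j: "Suc (e n) \<le> j" "j < e (Suc n)"
    have "e (Suc n) = (LEAST s. s \<in> A \<and> e n < s)" unfolding e_def using enumerate_Suc''[OF inf] by simp
    then show "j \<notin> A" using j not_less_Least[of j "\<lambda>s. s \<in> A \<and> e n < s"] by auto
  qed
  ultimately show ?thesis using that[of e] mem by blast
qed

lemma filter_unique:
  "distinct xs \<Longrightarrow> x \<in> set xs \<Longrightarrow> (\<And>y. y \<in> set xs \<Longrightarrow> Q y \<longleftrightarrow> y = x) \<Longrightarrow> filter Q xs = [x]"
proof (induction xs)
  case (Cons y xs)
  show ?case
  proof (cases "y = x")
    case True
    then have "filter Q xs = []" using Cons.prems by (auto simp: filter_empty_conv)
    then show ?thesis using Cons.prems True by simp
  next
    case False
    then show ?thesis using Cons by auto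
  qed
qed simp

lemma inputs_typed_subst:
  assumes "wf_program P" "wf_atom P a" "inputs_typed P a"
  shows "inputs_typed P (subst_atom \<sigma> a)"
  unfolding inputs_typed_def
proof
  fix k assume "k \<in> in_pos P (pred (subst_atom \<sigma> a))"
  then have k: "k \<in> in_pos P (pred a)" by simp
  have "pred a \<in> preds P" using assms(2) by (simp add: wf_atom_def)
  then have "is_type (ptype P (pred a) ! k)" using assms(1) k by (auto simp: wf_program_def in_pos_def)
  then show "args (subst_atom \<sigma> a) ! k \<in> ptype P (pred (subst_atom \<sigma> a)) ! k"
    using assms(3) k args_subst_nth(1)[OF assms(2) k, of \<sigma>] by (auto simp: inputs_typed_def is_type_def)
qed

text \<open>
  Below, \<open>\<alpha>\<close> is the label of an atom created at stage \<open>i0\<close>, no atom to the left of which is selected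
  from stage \<open>N1\<close> on. The substitution \<open>final i\<close> performs the remaining steps before \<open>N1\<close> and then
  instantiates the outputs of the remaining atoms to terms of the correct types. The part of a query
  below \<open>\<alpha>\<close> is instantiated by \<open>\<kappa>\<close>, which agrees with \<open>final i\<close> on the external variables \<open>V\<close> and
  renames the others away from \<open>F\<close>. Steps below \<open>\<alpha>\<close> then become steps of the instantiated parts, while all
  other steps leave them unchanged.
\<close>

locale node_run = left_based_run P \<rho> \<pi> Q D
  for P :: "('p, 'f, 'v::infinite) program" and \<rho> \<pi> Q D +
  fixes \<alpha> :: "nat list" and i0 N1 :: nat and \<eta> :: "('f, 'v) subst"
  assumes node: "\<alpha> \<in> lab i0" and i0N1: "i0 \<le> N1"
    and left_finished: "\<And>i. lx (slab i) \<alpha> \<Longrightarrow> i < N1"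
    and typed_final: "\<And>l b. (l, b) \<in> S N1 \<Longrightarrow> outputs_typed P (subst_atom \<eta> b)"
begin

definition final :: "nat \<Rightarrow> ('f, 'v) subst" where
  "final i = subst_comp (csub i N1) \<eta>"

lemma final_step: "i < N1 \<Longrightarrow> final i x = subst_trm (final (Suc i)) (sub D i x)"
  using csub_left[of i N1] by (simp add: final_def subst_comp_def subst_trm_subst_trm)

lemma final_step_atom: "i < N1 \<Longrightarrow> subst_atom (final i) b = subst_atom (final (Suc i)) (subst_atom (sub D i) b)"
  using final_step unfolding subst_atom_subst_atom by (intro subst_atom_cong) simp

text \<open>Induction downwards from \<open>N1\<close>, where \<open>\<eta>\<close> types all
  outputs. This is what makes the inputs of the atom at \<open>\<alpha>\<close> correctly typed
  under \<open>final i0\<close>.\<close>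

lemma left_outputs_typed:
  "i \<le> N1 \<Longrightarrow> (l, b) \<in> S i \<Longrightarrow> lx l \<alpha> \<Longrightarrow> outputs_typed P (subst_atom (final i) b)"
proof (induction i arbitrary: l b rule: inc_induct)
  case base
  then show ?case using typed_final by (simp add: final_def subst_comp_def)
next
  case (step i)
  have "outputs_typed P (subst_atom (final (Suc i)) (subst_atom (sub D i) b))"
  proof (rule outputs_typed_backwards[OF robust_S selected_mem robust_cls _ _ step.prems])
    show "subst_atom (sub D i) (satom i) = subst_atom (sub D i) (head (cls D i))"
      using mgu[of i] by (simp add: is_mgu_def unifier_def)
  qed (use step.IH in \<open>simp add: S_Suc\<close>)
  then show ?case unfolding final_step_atom[OF step.hyps(2)] .
qed

definition lvars :: "nat \<Rightarrow> 'v set" where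
  "lvars i = (\<Union>(l, b)\<in>{(l, b) \<in> S i. lx l \<alpha>}. avars b)"

definition below :: "nat \<Rightarrow> (nat list \<times> ('p, 'f, 'v) atom) list" where
  "below i = filter (\<lambda>(l, b). prefix \<alpha> l) (lquery i)"

definition bvars :: "nat \<Rightarrow> 'v set" where
  "bvars i = (\<Union>(l, b)\<in>set (below i). avars b)"

definition bovars :: "nat \<Rightarrow> 'v set" where
  "bovars i = (\<Union>(l, b)\<in>set (below i). ovars P b)"

text \<open>A finite reservoir for all variables that external values can contain. Stages after
  \<open>N1\<close> contribute nothing, because from then on the external values only get passed
  along under new names.\<close>

definition F :: "'v set" where
  "F = (\<Union>i\<in>{i0..N1}. \<Union>x\<in>vars_query (qry D i). set (occs (final i x)))"

definition inst_below :: "nat \<Rightarrow> ('f, 'v) subst \<Rightarrow> ('p, 'f, 'v) query" where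
  "inst_below i \<kappa> = map (subst_atom \<kappa>) (map snd (below i))"

text \<open>\<open>V\<close> contains no output variable below \<open>\<alpha>\<close>, so a step
  below \<open>\<alpha>\<close> does not bind it. Agreement with \<open>final i\<close> is required
  only up to \<open>N1\<close>, where a step on the left may still instantiate \<open>V\<close>;
  later it suffices that the values stay within \<open>F\<close>.\<close>

definition simulates :: "nat \<Rightarrow> 'v set \<Rightarrow> ('f, 'v) subst \<Rightarrow> bool" where
  "simulates i V \<kappa> \<longleftrightarrow> lvars i \<subseteq> V \<and> V \<subseteq> lvars i \<union> bvars i \<and> V \<inter> bovars i = {} \<and>
     (i \<le> N1 \<longrightarrow> (\<forall>x\<in>V. \<kappa> x = final i x)) \<and> (\<forall>x\<in>V. set (occs (\<kappa> x)) \<subseteq> F) \<and>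
     (\<forall>x\<in>bvars i - V. \<exists>z. \<kappa> x = Var z \<and> z \<notin> F) \<and> inj_on \<kappa> (bvars i - V)"

lemma finite_F: "finite F"
  by (auto simp: F_def)

lemma mem_below: "(l, b) \<in> set (below i) \<longleftrightarrow> (l, b) \<in> S i \<and> prefix \<alpha> l"
  by (simp add: below_def)

lemma S_vars_query: "(l, b) \<in> S i \<Longrightarrow> avars b \<subseteq> vars_query (qry D i)"
  unfolding snd_lquery[symmetric] by (force simp: vars_query_avars)

lemma in_bvars: "(l, b) \<in> S i \<Longrightarrow> prefix \<alpha> l \<Longrightarrow> avars b \<subseteq> bvars i"
  and in_bovars: "(l, b) \<in> S i \<Longrightarrow> prefix \<alpha> l \<Longrightarrow> ovars P b \<subseteq> bovars i"
  unfolding bvars_def bovars_def using mem_below[of l b i] by force+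

lemma vars_in_query: "lvars i \<subseteq> vars_query (qry D i)" "bvars i \<subseteq> vars_query (qry D i)"
  unfolding lvars_def bvars_def using S_vars_query mem_below by (fastforce, fast)

lemma finite_bvars: "finite (bvars i)" "finite (lvars i)"
  using vars_in_query[of i] finite_subset finite_vars_query by blast+

lemma bovars_bvars: "bovars i \<subseteq> bvars i"
  using avars_io robust_labelledD(1)[OF robust_S] by (fastforce simp: bovars_def bvars_def mem_below)

lemma below_fresh: "(bvars i \<union> lvars i) \<inter> vars_clause (cls D i) = {}"
  using vars_in_query[of i] step[of i] by (auto simp: resolution_step_def)

lemma F_final: "i0 \<le> i \<Longrightarrow> i \<le> N1 \<Longrightarrow> x \<in> lvars i \<union> bvars i \<Longrightarrow> set (occs (final i x)) \<subseteq> F"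
  using vars_in_query[of i] by (fastforce simp: F_def)

text \<open>Labels only grow and \<open>\<alpha>\<close> is present at \<open>i0\<close>, so no
  proper prefix of \<open>\<alpha>\<close> can be current from then on.\<close>

lemma region:
  assumes "i0 \<le> i" "l \<in> lab i"
  shows "lx l \<alpha> \<or> prefix \<alpha> l \<or> lx \<alpha> l"
proof (rule ccontr)
  assume n: "\<not> ?thesis"
  then have "prefix l \<alpha>" using lx_total by blast
  obtain l' where l': "l' \<in> lab i0" "prefix l' l" using ancestor[OF assms] by blast
  then have "l' = \<alpha>" using lab_prefix[OF l'(1) node] prefix_order.trans[OF l'(2) \<open>prefix l \<alpha>\<close>] by blast
  then show False using n l'(2) by blast
qed

text \<open>The only exception would be a child equal to \<open>\<alpha>\<close>, but the parent of
  \<open>\<alpha>\<close> can no longer be selected at a stage from \<open>i0\<close> on.\<close>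

lemma child_region:
  assumes "i0 \<le> i" shows "prefix \<alpha> (slab i @ [c]) \<longleftrightarrow> prefix \<alpha> (slab i)"
    and "lx (slab i @ [c]) \<alpha> \<longleftrightarrow> lx (slab i) \<alpha>"
proof -
  note r = region[OF assms slab_lab]
  have ne: "\<alpha> \<noteq> slab i @ [c]"
  proof
    assume e: "\<alpha> = slab i @ [c]"
    then have "prefix (slab i) \<alpha>" "\<not> prefix \<alpha> (slab i)" by (simp_all add: prefix_def)
    then show False using r lx_not_prefix by blast
  qed
  then show "prefix \<alpha> (slab i @ [c]) \<longleftrightarrow> prefix \<alpha> (slab i)" by simp
  then show "lx (slab i @ [c]) \<alpha> \<longleftrightarrow> lx (slab i) \<alpha>"
    using r lx_append[of "slab i" \<alpha> "[c]" "[]"] lx_append[of \<alpha> "slab i" "[]" "[c]"] lx_trans[of \<alpha> "slab i @ [c]" \<alpha>]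
      lx_not_prefix[of "slab i @ [c]" \<alpha>] by auto
qed

lemma map_snd_labelled: "map f (map snd (map (\<lambda>(l, b). (l, g b)) xs)) = map (\<lambda>b. f (g b)) (map snd xs)"
  by (induction xs) auto

lemma filter_below_map:
  "filter (\<lambda>(l, b). prefix \<alpha> l) (map (\<lambda>(l, b). (l, g b)) xs) = map (\<lambda>(l, b). (l, g b)) (filter (\<lambda>(l, b). prefix \<alpha> l) xs)"
  by (induction xs) auto

lemma below_other:
  assumes "i0 \<le> i" "\<not> prefix \<alpha> (slab i)"
  shows "below (Suc i) = map (\<lambda>(l, b). (l, subst_atom (sub D i) b)) (below i)"
proof -
  define A where "A = take (sel D i) (lquery i)"
  define B where "B = drop (Suc (sel D i)) (lquery i)"
  define ch where "ch = zip (map (\<lambda>j. slab i @ [perm i j]) [1..<Suc (length (body (cls D i)))]) (body (cls D i))"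
  have s: "lquery i = A @ (slab i, satom i) # B" using lquery_split by (simp add: A_def B_def)
  have "\<not> prefix \<alpha> l" if "(l, b) \<in> set ch" for l b
    using that assms child_region(1)[OF assms(1)] unfolding ch_def set_zip_nth1 by auto
  then have "filter (\<lambda>(l, b). prefix \<alpha> l) ch = []" by (auto simp: filter_empty_conv)
  then show ?thesis
    using assms(2) unfolding below_def lquery_Suc A_def[symmetric] B_def[symmetric] ch_def[symmetric] filter_below_map
    by (simp add: s)
qed

lemma below_resolution:
  assumes "i0 \<le> i" "prefix \<alpha> (slab i)"
  obtains A B where "below i = A @ (slab i, satom i) # B"
    "below (Suc i) = map (\<lambda>(l, b). (l, subst_atom (sub D i) b))
      (A @ zip (map (\<lambda>j. slab i @ [perm i j]) [1..<Suc (length (body (cls D i)))]) (body (cls D i)) @ B)"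
proof -
  define A where "A = take (sel D i) (lquery i)"
  define B where "B = drop (Suc (sel D i)) (lquery i)"
  define ch where "ch = zip (map (\<lambda>j. slab i @ [perm i j]) [1..<Suc (length (body (cls D i)))]) (body (cls D i))"
  have s: "lquery i = A @ (slab i, satom i) # B" using lquery_split by (simp add: A_def B_def)
  have "prefix \<alpha> l" if "(l, b) \<in> set ch" for l b
    using that assms child_region(1)[OF assms(1)] unfolding ch_def set_zip_nth1 by auto
  then have "filter (\<lambda>(l, b). prefix \<alpha> l) ch = ch" by (auto simp: filter_id_conv)
  then show ?thesis
    using that[of "filter (\<lambda>(l, b). prefix \<alpha> l) A" "filter (\<lambda>(l, b). prefix \<alpha> l) B"] assms(2)
    unfolding below_def lquery_Suc A_def[symmetric] B_def[symmetric] ch_def[symmetric] filter_below_map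
    by (simp add: s)
qed

section \<open>Where the variables after a step come from\<close>

lemma S_Suc_vars:
  assumes "(l, b) \<in> S (Suc i)" "y \<in> avars b"
  shows "(\<exists>b' x. (l, b') \<in> S i \<and> l \<noteq> slab i \<and> x \<in> avars b' \<and> y \<in> set (occs (sub D i x))) \<or>
    (\<exists>c x. l = slab i @ [c] \<and> x \<in> vars_clause (cls D i) \<and> y \<in> set (occs (sub D i x)))"
  using assms(1)
proof (cases rule: S_Suc_cases)
  case (old b')
  then show ?thesis using assms(2) by (auto simp: avars_subst)
next
  case (new j)
  then show ?thesis using assms(2) avars_vars_clause(2)[OF nth1_mem[OF new(1)]] by (auto simp: avars_subst)
qed

definition cvars_if :: "bool \<Rightarrow> nat \<Rightarrow> 'v set" where
  "cvars_if c i = (if c then vars_clause (cls D i) else {})"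

lemma lvars_Suc:
  assumes "i0 \<le> i" "y \<in> lvars (Suc i)"
  shows "\<exists>x\<in>lvars i \<union> cvars_if (lx (slab i) \<alpha>) i. y \<in> set (occs (sub D i x))"
proof -
  obtain l b where b: "(l, b) \<in> S (Suc i)" "lx l \<alpha>" "y \<in> avars b" using assms(2) by (auto simp: lvars_def)
  from S_Suc_vars[OF b(1,3)] show ?thesis
  proof (elim disjE exE conjE)
    fix b' x assume "(l, b') \<in> S i" "x \<in> avars b'" "y \<in> set (occs (sub D i x))"
    then show ?thesis using b(2) by (intro bexI[of _ x]) (auto simp: lvars_def)
  next
    fix c x assume "l = slab i @ [c]" "x \<in> vars_clause (cls D i)" "y \<in> set (occs (sub D i x))"
    then show ?thesis using b(2) child_region(2)[OF assms(1)] by (intro bexI[of _ x]) (auto simp: cvars_if_def)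
  qed
qed

lemma bvars_Suc:
  assumes "i0 \<le> i" "y \<in> bvars (Suc i)"
  shows "\<exists>x\<in>bvars i \<union> cvars_if (prefix \<alpha> (slab i)) i. y \<in> set (occs (sub D i x))"
proof -
  obtain l b where b: "(l, b) \<in> S (Suc i)" "prefix \<alpha> l" "y \<in> avars b" using assms(2) by (auto simp: bvars_def mem_below)
  from S_Suc_vars[OF b(1,3)] show ?thesis
  proof (elim disjE exE conjE)
    fix b' x assume "(l, b') \<in> S i" "x \<in> avars b'" "y \<in> set (occs (sub D i x))"
    then show ?thesis using b(2) by (intro bexI[of _ x]) (auto simp: bvars_def mem_below)
  next
    fix c x assume "l = slab i @ [c]" "x \<in> vars_clause (cls D i)" "y \<in> set (occs (sub D i x))"
    then show ?thesis using b(2) child_region(1)[OF assms(1)] by (intro bexI[of _ x]) (auto simp: cvars_if_def)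
  qed
qed

text \<open>Going through \<open>\<theta>0\<close> makes the origin \<open>x\<close> a fixed point
  of \<open>\<theta>0\<close>, and the actual unifier is injective on fixed points. So
  \<open>y\<close> has only one origin of this kind, which later separates output variables from
  \<open>V\<close>.\<close>

lemma bovars_Suc:
  assumes "i0 \<le> i" "y \<in> bovars (Suc i)"
    and cs: "canonical_step P (S i) (slab i) (satom i) (perm i) (cls D i) \<theta>0"
  shows "\<exists>x\<in>bovars i \<union> cvars_if (prefix \<alpha> (slab i)) i. \<theta>0 x = Var x \<and> y \<in> set (occs (sub D i x))"
proof -
  interpret cs: canonical_step P "S i" "slab i" "satom i" "perm i" "cls D i" \<theta>0 by (rule cs)
  obtain l b where b: "(l, b) \<in> S (Suc i)" "prefix \<alpha> l" "y \<in> ovars P b" using assms(2) by (auto simp: bovars_def mem_below)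
  from b(1) show ?thesis
  proof (cases rule: S_Suc_cases)
    case (old b')
    obtain x where x: "x \<in> ovars P b'" "y \<in> set (occs (sub D i x))"
      using b(3) old(3) ovars_subst[OF robust_labelledD(1)[OF robust_S old(1)]] by auto
    have "x \<notin> ovars P (satom i)" using robust_labelledD2(3)[OF robust_S old(1) selected_mem old(2)] x(1) by blast
    then have "\<theta>0 x = Var x" using cs.fixed_old[OF old(1)] cs.old_vars(2)[OF old(1)] x(1) by blast
    moreover have "x \<in> bovars i" using old(1) b(2) x(1) by (auto simp: bovars_def mem_below)
    ultimately show ?thesis using x(2) by blast
  next
    case (new j)
    note m = nth1_mem[OF new(1)]
    have p: "prefix \<alpha> (slab i)" using b(2) new(2) child_region(1)[OF assms(1)] by simp
    obtain x where x: "x \<in> ovars P (nth1 (body (cls D i)) j)" "y \<in> set (occs (sub D i x))"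
      using b(3) new(3) ovars_subst[OF cs.C(2)[OF m]] by auto
    then obtain z where z: "z \<in> set (occs (\<theta>0 x))" "y \<in> set (occs (sub D i z))"
      using cs.via_canonical[OF mgu[of i], of x] set_occs_subst[of "sub D i" "\<theta>0 x"] by auto
    have xc: "x \<in> vars_clause (cls D i)" "x \<notin> ivars P (head (cls D i))"
      using x(1) cs.body_vars(2)[OF m] cs.C(8)[OF m] by auto
    have "ovars P (satom i) \<subseteq> bovars i" using in_bovars[OF selected_mem p] .
    then have "z \<in> bovars i \<union> cvars_if (prefix \<alpha> (slab i)) i"
      using z(1) cs.clause_range[OF xc] xc(1) p by (auto simp: cvars_if_def)
    then show ?thesis using cs.range_fixed[OF z(1)] z(2) by blast
  qed
qed

text \<open>
  For a step below \<open>\<alpha>\<close>, \<open>C\<close> are the variables of the input clause and \<open>K\<close> extends \<open>\<kappa>\<close> to them; for a step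
  to the right of \<open>\<alpha>\<close>, \<open>C\<close> is empty.
\<close>

lemma simulates_step:
  assumes i: "i0 \<le> i" "\<not> lx (slab i) \<alpha>"
    and cs: "canonical_step P (S i) (slab i) (satom i) (perm i) (cls D i) \<theta>0"
    and \<rho>0: "\<And>x. subst_trm \<rho>0 (sub D i x) = \<theta>0 x"
    and sim: "simulates i V \<kappa>"
    and fixedV: "\<And>x. x \<in> V \<Longrightarrow> \<theta>0 x = Var x"
    and closed: "\<And>x. x \<in> bvars i \<union> C \<Longrightarrow> set (occs (\<theta>0 x)) \<subseteq> bvars i \<union> C"
    and C: "C = cvars_if (prefix \<alpha> (slab i)) i"
    and KV: "\<And>x. x \<in> V \<Longrightarrow> K x = \<kappa> x"
    and KN: "\<And>x. x \<in> (bvars i - V) \<union> C \<Longrightarrow> \<exists>z. K x = Var z \<and> z \<notin> F" "inj_on K ((bvars i - V) \<union> C)"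
  shows "simulates (Suc i) ({y. \<exists>x\<in>V. sub D i x = Var y} \<inter> (lvars (Suc i) \<union> bvars (Suc i))) (subst_comp \<rho>0 K)"
proof -
  interpret cs: canonical_step P "S i" "slab i" "satom i" "perm i" "cls D i" \<theta>0 by (rule cs)
  note sim = sim[unfolded simulates_def]
  have \<rho>y: "\<rho>0 y = Var x" if "\<theta>0 x = Var x" "sub D i x = Var y" for x y
    using \<rho>0[of x] that by simp
  have \<kappa>y: "subst_comp \<rho>0 K y = K x" if "\<theta>0 x = Var x" "sub D i x = Var y" for x y
    using \<rho>y[OF that] by (simp add: subst_comp_def)
  have var: "sub D i x = Var y" if "\<theta>0 x = Var x" "y \<in> set (occs (sub D i x))" for x y
    using cs.renames_fixed[OF mgu[of i]] that by (auto simp: renames_def is_var_def)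
  have same: "x = x'" if "\<theta>0 x = Var x" "\<theta>0 x' = Var x'" "sub D i x = Var y" "sub D i x' = Var y" for x x' y
    using \<rho>y[of x y] \<rho>y[of x' y] that by simp
  have CV: "C \<inter> V = {}" using sim below_fresh[of i] unfolding C cvars_if_def by auto
  \<comment> \<open>By \<open>fixedV\<close> the step merely renames the variables of
    \<open>V\<close>; kept are those new names that still occur on the left or below.\<close>
  define V' where "V' = {y. \<exists>x\<in>V. sub D i x = Var y} \<inter> (lvars (Suc i) \<union> bvars (Suc i))"
  have inner: "\<exists>x\<in>(bvars i - V) \<union> C. \<theta>0 x = Var x \<and> sub D i x = Var y" if y: "y \<in> bvars (Suc i) - V'" for y
  proof -
    obtain x where x: "x \<in> bvars i \<union> C" "y \<in> set (occs (sub D i x))" using bvars_Suc[OF i(1)] y C by blast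
    then obtain z where z: "z \<in> set (occs (\<theta>0 x))" "y \<in> set (occs (sub D i z))"
      using cs.via_canonical[OF mgu[of i], of x] set_occs_subst[of "sub D i" "\<theta>0 x"] by auto
    have zf: "\<theta>0 z = Var z" using cs.range_fixed[OF z(1)] .
    have "sub D i z = Var y" using var[OF zf z(2)] .
    moreover from this have "z \<notin> V" using y by (auto simp: V'_def)
    moreover have "z \<in> bvars i \<union> C" using closed[OF x(1)] z(1) by blast
    ultimately show ?thesis using zf by blast
  qed
  have "lvars (Suc i) \<subseteq> V'"
  proof
    fix y assume y: "y \<in> lvars (Suc i)"
    obtain x where x: "x \<in> lvars i" "y \<in> set (occs (sub D i x))"
      using lvars_Suc[OF i(1) y] i(2) by (auto simp: cvars_if_def)
    then have "x \<in> V" using sim by blast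
    then show "y \<in> V'" using var[OF fixedV x(2)] y by (auto simp: V'_def)
  qed
  moreover have "V' \<inter> bovars (Suc i) = {}"
  proof (rule ccontr)
    assume "V' \<inter> bovars (Suc i) \<noteq> {}"
    then obtain y where y: "y \<in> V'" "y \<in> bovars (Suc i)" by blast
    obtain x where x: "x \<in> V" "sub D i x = Var y" using y(1) by (auto simp: V'_def)
    obtain z where z: "z \<in> bovars i \<union> C" "\<theta>0 z = Var z" "y \<in> set (occs (sub D i z))"
      using bovars_Suc[OF i(1) y(2) cs] C by blast
    have "z = x" using same[OF z(2) fixedV[OF x(1)] var[OF z(2,3)] x(2)] .
    then show False using x(1) z(1) sim CV by blast
  qed
  moreover have "subst_comp \<rho>0 K y = final (Suc i) y" if N: "Suc i \<le> N1" and y: "y \<in> V'" for y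
  proof -
    obtain x where x: "x \<in> V" "sub D i x = Var y" using y by (auto simp: V'_def)
    then show ?thesis using \<kappa>y[OF fixedV x(2)] KV sim final_step[of i x] N by simp
  qed
  moreover have "set (occs (subst_comp \<rho>0 K y)) \<subseteq> F" if y: "y \<in> V'" for y
  proof -
    obtain x where x: "x \<in> V" "sub D i x = Var y" using y by (auto simp: V'_def)
    then show ?thesis using \<kappa>y[OF fixedV x(2)] KV sim by simp
  qed
  moreover have "\<exists>z. subst_comp \<rho>0 K y = Var z \<and> z \<notin> F" if "y \<in> bvars (Suc i) - V'" for y
    using inner[OF that] \<kappa>y KN(1) by metis
  moreover have "inj_on (subst_comp \<rho>0 K) (bvars (Suc i) - V')"
  proof (rule inj_onI)
    fix y1 y2 assume y: "y1 \<in> bvars (Suc i) - V'" "y2 \<in> bvars (Suc i) - V'" "subst_comp \<rho>0 K y1 = subst_comp \<rho>0 K y2"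
    obtain x1 where x1: "x1 \<in> (bvars i - V) \<union> C" "\<theta>0 x1 = Var x1" "sub D i x1 = Var y1" using inner[OF y(1)] by blast
    obtain x2 where x2: "x2 \<in> (bvars i - V) \<union> C" "\<theta>0 x2 = Var x2" "sub D i x2 = Var y2" using inner[OF y(2)] by blast
    have "K x1 = K x2" using \<kappa>y[OF x1(2,3)] \<kappa>y[OF x2(2,3)] y(3) by simp
    then have "x1 = x2" using inj_onD[OF KN(2)] x1(1) x2(1) by blast
    then show "y1 = y2" using x1(3) x2(3) by simp
  qed
  moreover have "V' \<subseteq> lvars (Suc i) \<union> bvars (Suc i)" by (auto simp: V'_def)
  ultimately show ?thesis unfolding V'_def[symmetric] simulates_def by blast
qed

text \<open>Atoms to the left of \<open>\<alpha>\<close> and below it all precede the selected atom,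
  so the canonical unifier fixes their variables. The actual one renames them, and
  \<open>\<rho>0\<close> undoes the renaming.\<close>

lemma step_right:
  assumes i: "i0 \<le> i" "lx \<alpha> (slab i)" and sim: "simulates i V \<kappa>"
  shows "\<exists>V' \<kappa>'. simulates (Suc i) V' \<kappa>' \<and> inst_below (Suc i) \<kappa>' = inst_below i \<kappa>"
proof -
  obtain \<theta>0 where cs: "canonical_step P (S i) (slab i) (satom i) (perm i) (cls D i) \<theta>0" by (rule canonical)
  interpret cs: canonical_step P "S i" "slab i" "satom i" "perm i" "cls D i" \<theta>0 by (rule cs)
  obtain \<rho>0 where \<rho>0: "\<And>x. subst_trm \<rho>0 (sub D i x) = \<theta>0 x" using cs.back_to_canonical[OF mgu[of i]] by blast
  have np: "\<not> prefix \<alpha> (slab i)" using lx_not_prefix[OF i(2)] by blast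
  have nl: "\<not> lx (slab i) \<alpha>" using i(2) lx_trans lx_irrefl by blast
  have fx: "\<theta>0 x = Var x" if "(l, b) \<in> S i" "lx l \<alpha> \<or> prefix \<alpha> l" "x \<in> avars b" for l b x
  proof -
    have "lx l (slab i)" using that(2) i(2) lx_trans[of l \<alpha>] lx_append[of \<alpha> "slab i" _ "[]"] by (auto simp: prefix_def)
    then have "subst_atom \<theta>0 b = subst_atom Var b" using cs.old_unchanged[OF that(1)] by simp
    then show ?thesis using that(3) unfolding subst_atom_cong_iff by blast
  qed
  have fb: "\<theta>0 x = Var x" if "x \<in> lvars i \<union> bvars i" for x
    using that fx by (auto simp: lvars_def bvars_def mem_below)
  have V: "V \<subseteq> lvars i \<union> bvars i" using sim by (simp add: simulates_def)
  have sim': "simulates (Suc i) ({y. \<exists>x\<in>V. sub D i x = Var y} \<inter> (lvars (Suc i) \<union> bvars (Suc i))) (subst_comp \<rho>0 \<kappa>)"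
    by (rule simulates_step[OF i(1) nl cs \<rho>0 sim, where C = "{}"])
      (use V fb np sim in \<open>auto simp: cvars_if_def simulates_def\<close>)
  have "subst_atom (subst_comp \<rho>0 \<kappa>) (subst_atom (sub D i) b) = subst_atom \<kappa> b" if "(l, b) \<in> set (below i)" for l b
  proof -
    have "subst_trm (subst_comp \<rho>0 \<kappa>) (sub D i x) = \<kappa> x" if "x \<in> avars b" for x
      using fx[of l b x] that \<open>(l, b) \<in> set (below i)\<close> \<rho>0[of x] by (simp add: mem_below subst_trm_subst_comp)
    then show ?thesis unfolding subst_atom_subst_atom by (intro subst_atom_cong) simp
  qed
  then have "inst_below (Suc i) (subst_comp \<rho>0 \<kappa>) = inst_below i \<kappa>"
    unfolding inst_below_def below_other[OF i(1) np] by (auto simp: case_prod_unfold)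
  then show ?thesis using sim' by blast
qed

text \<open>The bindings of such a step are already contained in \<open>final i\<close>, so the
  instantiated part stays the same. In contrast to \<open>simulates_step\<close>, variables of
  \<open>V\<close> may become compound here, and \<open>V'\<close> has to collect the variables of
  their values.\<close>

lemma step_left:
  assumes i: "i0 \<le> i" "lx (slab i) \<alpha>" and sim: "simulates i V \<kappa>"
  shows "\<exists>V' \<kappa>'. simulates (Suc i) V' \<kappa>' \<and> inst_below (Suc i) \<kappa>' = inst_below i \<kappa>"
proof -
  obtain \<theta>0 where cs: "canonical_step P (S i) (slab i) (satom i) (perm i) (cls D i) \<theta>0" by (rule canonical)
  interpret cs: canonical_step P "S i" "slab i" "satom i" "perm i" "cls D i" \<theta>0 by (rule cs)
  note sim = sim[unfolded simulates_def]
  have iN: "i < N1" using left_finished[OF i(2)] .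
  have np: "\<not> prefix \<alpha> (slab i)" using lx_not_prefix[OF i(2)] by blast
  define I where "I = bvars i - V"
  have al: "avars (satom i) \<subseteq> lvars i" using selected_mem[of i] i(2) by (auto simp: lvars_def)
  have Ia: "I \<inter> avars (satom i) = {}" using al sim by (auto simp: I_def)
  have Ic: "I \<inter> vars_clause (cls D i) = {}" using below_fresh[of i] by (auto simp: I_def)
  have fI: "\<theta>0 x = Var x" if "x \<in> I" for x
    using that Ia Ic cs.fixed cs.old_vars(2)[OF selected_mem] by blast
  have varI: "\<exists>y. sub D i x = Var y" if "x \<in> I" for x
    using cs.renames_fixed[OF mgu[of i]] fI[OF that] by (auto simp: renames_def is_var_def)
  \<comment> \<open>Any other occurrence of \<open>y\<close> would come, through
    \<open>\<theta>0\<close>, from \<open>x'\<close>, the selected atom or the clause;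
    \<open>x'\<close> differs from \<open>x\<close>, and the other two contain no variable of
    \<open>I\<close>. Hence \<open>\<kappa>'\<close> can be defined separately on the names of
    \<open>I\<close> and on the rest.\<close>
  have apart: "y \<notin> set (occs (sub D i x'))" if x: "x \<in> I" "sub D i x = Var y" "x' \<noteq> x" for x x' y
  proof
    assume "y \<in> set (occs (sub D i x'))"
    then obtain z where z: "z \<in> set (occs (\<theta>0 x'))" "y \<in> set (occs (sub D i z))"
      using cs.via_canonical[OF mgu[of i], of x'] set_occs_subst[of "sub D i" "\<theta>0 x'"] by auto
    have zf: "\<theta>0 z = Var z" using cs.range_fixed[OF z(1)] .
    then have "sub D i z = Var y" using cs.renames_fixed[OF mgu[of i]] z(2) by (auto simp: renames_def is_var_def)
    moreover have "inj_on (sub D i) {x. \<theta>0 x = Var x}" using cs.renames_fixed[OF mgu[of i]] by (simp add: renames_def)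
    ultimately have "z = x" using zf fI[OF x(1)] x(2) by (simp add: inj_on_def)
    moreover have "z \<in> insert x' (avars (satom i) \<union> vars_clause (cls D i))" using cs.range_vars z(1) by blast
    ultimately show False using x(1,3) Ia Ic by blast
  qed
  define \<kappa>' where "\<kappa>' y = (if \<exists>x\<in>I. sub D i x = Var y then \<kappa> (SOME x. x \<in> I \<and> sub D i x = Var y) else final (Suc i) y)" for y
  have \<kappa>I: "\<kappa>' y = \<kappa> x" if "x \<in> I" "sub D i x = Var y" for x y
  proof -
    have "(SOME x. x \<in> I \<and> sub D i x = Var y) = x"
      using that apart by (intro some_equality) (auto, metis list.set_intros(1) occs.simps(1))
    then show ?thesis using that by (auto simp: \<kappa>'_def)
  qed
  have \<kappa>V: "\<kappa>' y = final (Suc i) y" if "x \<notin> I" "y \<in> set (occs (sub D i x))" for x y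
  proof -
    have "\<not> (\<exists>x'\<in>I. sub D i x' = Var y)" using that apart[of _ y x] by blast
    then show ?thesis by (simp add: \<kappa>'_def)
  qed
  define V' where "V' = ((\<Union>x\<in>V. set (occs (sub D i x))) \<union> lvars (Suc i)) \<inter> (lvars (Suc i) \<union> bvars (Suc i))"
  have V'x: "\<exists>x. x \<notin> I \<and> y \<in> set (occs (sub D i x))" if "y \<in> V'" for y
  proof (cases "y \<in> lvars (Suc i)")
    case True
    then obtain x where "x \<in> lvars i \<union> vars_clause (cls D i)" "y \<in> set (occs (sub D i x))"
      using lvars_Suc[OF i(1) True] i(2) by (auto simp: cvars_if_def)
    then show ?thesis using Ic sim by (auto simp: I_def)
  next
    case False
    then show ?thesis using that by (auto simp: V'_def I_def)
  qed
  have inner: "\<exists>x\<in>I. sub D i x = Var y" if y: "y \<in> bvars (Suc i) - V'" for y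
  proof -
    obtain x where x: "x \<in> bvars i" "y \<in> set (occs (sub D i x))"
      using bvars_Suc[OF i(1)] y np by (auto simp: cvars_if_def)
    then have "x \<in> I" using y by (auto simp: V'_def I_def)
    moreover from varI[OF this] obtain y' where "sub D i x = Var y'" by blast
    ultimately show ?thesis using x(2) by (intro bexI[of _ x]) simp_all
  qed
  have "simulates (Suc i) V' \<kappa>'"
    unfolding simulates_def
  proof (intro conjI ballI impI)
    show "lvars (Suc i) \<subseteq> V'" "V' \<subseteq> lvars (Suc i) \<union> bvars (Suc i)" by (auto simp: V'_def)
    show "V' \<inter> bovars (Suc i) = {}"
    proof (rule ccontr)
      assume "V' \<inter> bovars (Suc i) \<noteq> {}"
      then obtain y where y: "y \<in> V'" "y \<in> bovars (Suc i)" by blast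
      obtain z where z: "z \<in> bovars i" "y \<in> set (occs (sub D i z))"
        using bovars_Suc[OF i(1) y(2) cs] np by (auto simp: cvars_if_def)
      have zI: "z \<in> I" using z(1) sim bovars_bvars by (auto simp: I_def)
      then obtain y' where "sub D i z = Var y'" using varI by blast
      then have "sub D i z = Var y" using z(2) by simp
      then show False using V'x[OF y(1)] apart[OF zI] zI by metis
    qed
    show fin: "\<kappa>' y = final (Suc i) y" if "y \<in> V'" for y using V'x[OF that] \<kappa>V by blast
    show "set (occs (\<kappa>' y)) \<subseteq> F" if "y \<in> V'" for y
      using fin[OF that] F_final[of "Suc i" y] that i(1) iN by (auto simp: V'_def)
    show "\<exists>z. \<kappa>' y = Var z \<and> z \<notin> F" if "y \<in> bvars (Suc i) - V'" for y
      using inner[OF that] \<kappa>I sim by (auto simp: I_def)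
    show "inj_on \<kappa>' (bvars (Suc i) - V')"
    proof (rule inj_onI)
      fix y1 y2 assume y: "y1 \<in> bvars (Suc i) - V'" "y2 \<in> bvars (Suc i) - V'" "\<kappa>' y1 = \<kappa>' y2"
      obtain x1 x2 where x: "x1 \<in> I" "sub D i x1 = Var y1" "x2 \<in> I" "sub D i x2 = Var y2"
        using inner[OF y(1)] inner[OF y(2)] by blast
      then have "\<kappa> x1 = \<kappa> x2" using \<kappa>I y(3) by metis
      then have "x1 = x2" using sim x(1,3) by (auto simp: I_def dest: inj_onD)
      then show "y1 = y2" using x by simp
    qed
  qed
  moreover have "inst_below (Suc i) \<kappa>' = inst_below i \<kappa>"
  proof -
    have "subst_atom \<kappa>' (subst_atom (sub D i) b) = subst_atom \<kappa> b" if b: "(l, b) \<in> set (below i)" for l b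
    proof -
      have "subst_trm \<kappa>' (sub D i x) = \<kappa> x" if x: "x \<in> avars b" for x
      proof (cases "x \<in> I")
        case True
        then show ?thesis using varI[OF True] \<kappa>I by auto
      next
        case False
        have "x \<in> V" using x b False by (auto simp: I_def bvars_def)
        then have "\<kappa> x = final i x" using sim iN by simp
        also have "\<dots> = subst_trm (final (Suc i)) (sub D i x)" using final_step[OF iN] .
        also have "\<dots> = subst_trm \<kappa>' (sub D i x)" using \<kappa>V[OF False] by (intro subst_trm_cong) simp
        finally show ?thesis by simp
      qed
      then show ?thesis unfolding subst_atom_subst_atom by (intro subst_atom_cong) simp
    qed
    then show ?thesis unfolding inst_below_def below_other[OF i(1) np] by (auto simp: case_prod_unfold)
  qed
  ultimately show ?thesis by blast
qed

text \<open>The input clause is renamed by \<open>g\<close> away from all values of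
  \<open>\<kappa>\<close>. The canonical unifier leaves \<open>V\<close> alone and \<open>K\<close>
  is an injective renaming elsewhere, so transporting \<open>\<theta>0\<close> along
  \<open>K\<close> gives a most general unifier of the instances.\<close>

lemma step_below:
  assumes i: "i0 \<le> i" "prefix \<alpha> (slab i)" and sim: "simulates i V \<kappa>"
  shows "\<exists>V' \<kappa>'. simulates (Suc i) V' \<kappa>' \<and> (\<exists>p c \<mu>. resolution_step P (inst_below i \<kappa>) p c \<mu> (inst_below (Suc i) \<kappa>') \<and>
    selectable P (inst_below i \<kappa> ! p))"
proof -
  obtain \<theta>0 where cs: "canonical_step P (S i) (slab i) (satom i) (perm i) (cls D i) \<theta>0" by (rule canonical)
  interpret cs: canonical_step P "S i" "slab i" "satom i" "perm i" "cls D i" \<theta>0 by (rule cs)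
  obtain \<rho>0 where \<rho>0: "\<And>x. subst_trm \<rho>0 (sub D i x) = \<theta>0 x" using cs.back_to_canonical[OF mgu[of i]] by blast
  note simD = sim[unfolded simulates_def]
  have nl: "\<not> lx (slab i) \<alpha>" using i(2) lx_not_prefix by blast
  define C where "C = vars_clause (cls D i)"
  have Cc: "C = cvars_if (prefix \<alpha> (slab i)) i" using i(2) by (simp add: C_def cvars_if_def)
  have fresh': "C \<inter> (bvars i \<union> V) = {}" using simD below_fresh[of i] by (auto simp: C_def)
  have sa: "avars (satom i) \<subseteq> bvars i" "ovars P (satom i) \<subseteq> bovars i"
    using in_bvars[OF selected_mem i(2)] in_bovars[OF selected_mem i(2)] by blast+
  have fV: "\<theta>0 x = Var x" if "x \<in> V" for x
    using that simD sa(2) fresh' by (intro cs.fixed) (auto simp: C_def)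
  define Y where "Y = F \<union> (\<Union>x\<in>bvars i \<union> V. set (occs (\<kappa> x)))"
  have "finite V" using simD finite_bvars[of i] finite_subset[of V "lvars i \<union> bvars i"] by simp
  then have "finite Y" using finite_F finite_bvars by (simp add: Y_def)
  then obtain g where g: "inj_on g C" "g ` C \<inter> Y = {}" using fresh_renaming[of C Y] by (auto simp: C_def)
  define K where "K x = (if x \<in> C then Var (g x) else \<kappa> x)" for x
  have Kold: "K x = \<kappa> x" if "x \<in> bvars i \<union> V" for x using that fresh' by (auto simp: K_def)
  define N where "N = (bvars i - V) \<union> C"
  have KN: "\<exists>z. K x = Var z \<and> z \<notin> F" if "x \<in> N" for x
    using that simD g(2) by (auto simp: N_def K_def Y_def)
  have KNi: "inj_on K N"
  proof (rule inj_onI)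
    fix x y assume xy: "x \<in> N" "y \<in> N" "K x = K y"
    have mixed: False if "x \<in> C" "y \<notin> C" "y \<in> N" "K x = K y" for x y
    proof -
      have "y \<in> bvars i" using that by (auto simp: N_def)
      moreover have "\<kappa> y = Var (g x)" using that by (simp add: K_def)
      ultimately have "g x \<in> Y" by (auto simp: Y_def intro!: bexI[of _ y])
      then show False using g(2) that(1) by blast
    qed
    show "x = y"
    proof (cases "x \<in> C")
      case True
      then have "y \<in> C" using mixed xy by blast
      then show ?thesis using True xy(3) g(1) by (auto simp: K_def dest: inj_onD)
    next
      case False
      then have "y \<notin> C" using mixed[of y x] xy by auto
      then have "\<kappa> x = \<kappa> y" "x \<in> bvars i - V" "y \<in> bvars i - V" using xy False by (auto simp: K_def N_def)
      then show ?thesis using simD by (auto dest: inj_onD)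
    qed
  qed
  obtain h where h: "\<And>x. x \<in> N \<Longrightarrow> K x = Var (h x)" "\<And>x. x \<in> N \<Longrightarrow> h x \<notin> F" using KN by metis
  have hi: "inj_on h N" using KNi h(1) by (auto simp: inj_on_def)
  define Z where "Z = ovars P (satom i) \<union> C"
  have ZN: "Z \<subseteq> N" using simD sa(2) bovars_bvars[of i] by (auto simp: Z_def N_def)
  \<comment> \<open>Everything in question that \<open>\<theta>0\<close> can move lies in
    \<open>Z\<close>. On \<open>Z\<close> the substitution \<open>K\<close> is the injective
    renaming \<open>h\<close>, so a variable in \<open>h\<close> \<open>Z\<close> can be traced
    back, sent through \<open>\<theta>0\<close> and renamed again.\<close>
  define \<mu> where "\<mu> z = (if z \<in> h ` Z then subst_trm K (\<theta>0 (inv_into Z h z)) else Var z)" for z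
  have \<mu>Z: "\<mu> (h x) = subst_trm K (\<theta>0 x)" if "x \<in> Z" for x
    using that inj_on_subset[OF hi ZN] by (simp add: \<mu>_def)
  have \<mu>K: "subst_trm \<mu> (K x) = subst_trm K (\<theta>0 x)" if x: "x \<in> bvars i \<union> C" for x
  proof (cases "x \<in> Z")
    case True
    then show ?thesis using \<mu>Z h(1) ZN by auto
  next
    case xZ: False
    then have fx: "\<theta>0 x = Var x" by (intro cs.fixed) (auto simp: Z_def C_def)
    have "\<mu> z = Var z" if "z \<in> set (occs (K x))" for z
    proof (cases "x \<in> N")
      case True
      then have "z = h x" using h(1) that by simp
      then show ?thesis using True xZ ZN hi by (auto simp: \<mu>_def dest: inj_onD)
    next
      case False
      then have "x \<in> V" using x by (auto simp: N_def)
      then have "z \<in> F" using that Kold simD by auto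
      then show ?thesis using h(2) ZN by (auto simp: \<mu>_def)
    qed
    then show ?thesis using fx subst_trm_ident[of "K x" \<mu>] by simp
  qed
  have \<mu>K_atom: "subst_atom \<mu> (subst_atom K b) = subst_atom K (subst_atom \<theta>0 b)"
    if "avars b \<subseteq> bvars i \<union> C" for b :: "('p, 'f, 'v) atom"
    using that \<mu>K unfolding subst_atom_subst_atom by (intro subst_atom_cong) blast
  define c where "c = subst_clause (\<lambda>x. Var (g x)) (cls D i)"
  have cK: "c = subst_clause K (cls D i)" unfolding c_def by (intro subst_clause_cong) (simp add: K_def C_def)
  have hb: "avars (head (cls D i)) \<subseteq> C" "\<And>b. b \<in> set (body (cls D i)) \<Longrightarrow> avars b \<subseteq> C"
    using avars_vars_clause[where c = "cls D i"] by (simp_all add: C_def)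
  have hc: "head c = subst_atom K (head (cls D i))" and bc: "body c = map (subst_atom K) (body (cls D i))"
    by (simp_all add: cK subst_clause_def subst_query_def)
  obtain A B where AB: "below i = A @ (slab i, satom i) # B"
    "below (Suc i) = map (\<lambda>(l, b). (l, subst_atom (sub D i) b))
      (A @ zip (map (\<lambda>j. slab i @ [perm i j]) [1..<Suc (length (body (cls D i)))]) (body (cls D i)) @ B)"
    using below_resolution[OF i] by blast
  have bv: "avars b \<subseteq> bvars i" if "b \<in> snd ` set (below i)" for b using that by (auto simp: bvars_def)
  have \<kappa>K: "subst_atom \<kappa> b = subst_atom K b" if "b \<in> snd ` set (below i)" for b
    using bv[OF that] Kold by (intro subst_atom_cong) auto
  have im: "inst_below i \<kappa> = map (subst_atom K) (map snd A @ satom i # map snd B)"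
    using \<kappa>K unfolding inst_below_def AB(1) by simp
  define \<kappa>' where "\<kappa>' = subst_comp \<rho>0 K"
  have "subst_atom \<kappa>' (subst_atom (sub D i) b) = subst_atom K (subst_atom \<theta>0 b)"
    for b :: "('p, 'f, 'v) atom"
    by (simp add: \<kappa>'_def subst_atom_subst_atom subst_trm_subst_comp \<rho>0)
  then have im': "inst_below (Suc i) \<kappa>' = map (\<lambda>b. subst_atom K (subst_atom \<theta>0 b)) (map snd A @ body (cls D i) @ map snd B)"
    unfolding inst_below_def AB(2) map_snd_labelled by (simp del: upt_Suc)
  define p where "p = length A"
  have p: "p < length (inst_below i \<kappa>)" "inst_below i \<kappa> ! p = subst_atom K (satom i)"
    "take p (inst_below i \<kappa>) = map (subst_atom K) (map snd A)" "drop (Suc p) (inst_below i \<kappa>) = map (subst_atom K) (map snd B)"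
    unfolding im p_def by (simp_all add: nth_append)
  have "variant c (origin i)"
    using variant_renaming[of g "cls D i"] g(1) origin(2) variant_trans unfolding c_def C_def by blast
  moreover have "vars_clause c \<inter> vars_query (inst_below i \<kappa>) = {}"
  proof -
    have "vars_clause c = g ` C"
      by (auto simp: c_def subst_clause_def subst_query_def vars_clause_avars vars_query_avars avars_subst C_def)
    moreover have "vars_query (inst_below i \<kappa>) \<subseteq> Y"
      unfolding inst_below_def Y_def by (auto simp: vars_query_avars avars_subst bvars_def)
    ultimately show ?thesis using g(2) by blast
  qed
  moreover have "is_mgu \<mu> (inst_below i \<kappa> ! p) (head c)"
    unfolding is_mgu_def p(2) hc
  proof (intro conjI allI impI)
    have "subst_atom \<theta>0 (satom i) = subst_atom \<theta>0 (head (cls D i))" using cs.unifies by (simp add: unifier_def)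
    then show "unifier \<mu> (subst_atom K (satom i)) (subst_atom K (head (cls D i)))"
      using \<mu>K_atom[OF le_supI1[OF sa(1)]] \<mu>K_atom[OF le_supI2[OF hb(1)]] by (simp add: unifier_def)
    \<comment> \<open>Composed with \<open>K\<close>, a unifier of the instances unifies the
      original atom and head, so the generality of \<open>\<theta>0\<close> applies to it.\<close>
    fix \<chi> assume "unifier \<chi> (subst_atom K (satom i)) (subst_atom K (head (cls D i)))"
    then have "unifier (subst_comp K \<chi>) (satom i) (head (cls D i))" by (simp add: unifier_def subst_atom_subst_comp)
    then have "subst_comp K \<chi> x = subst_trm (subst_comp K \<chi>) (\<theta>0 x)" for x by (rule cs.general)
    then have gen: "subst_trm \<chi> (K x) = subst_trm \<chi> (subst_trm K (\<theta>0 x))" for x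
      unfolding subst_trm_subst_comp by (simp add: subst_comp_def)
    have "\<chi> z = subst_trm \<chi> (\<mu> z)" for z
    proof (cases "z \<in> h ` Z")
      case True
      then obtain x where x: "x \<in> Z" "z = h x" by blast
      then show ?thesis using gen[of x] \<mu>Z[OF x(1)] h(1)[of x] ZN by auto
    qed (simp add: \<mu>_def)
    then show "\<exists>\<tau>. \<forall>x. \<chi> x = subst_trm \<tau> (\<mu> x)" by blast
  qed
  moreover have "inst_below (Suc i) \<kappa>' = subst_query \<mu> (take p (inst_below i \<kappa>) @ body c @ drop (Suc p) (inst_below i \<kappa>))"
  proof -
    have "subst_atom \<mu> (subst_atom K b) = subst_atom K (subst_atom \<theta>0 b)" if "b \<in> set (map snd A @ body (cls D i) @ map snd B)" for b
    proof (rule \<mu>K_atom)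
      have "b \<in> snd ` set (below i) \<or> b \<in> set (body (cls D i))" using that by (auto simp: AB(1))
      then show "avars b \<subseteq> bvars i \<union> C" using bv hb(2) by blast
    qed
    then show ?thesis unfolding p(3,4) bc im' subst_query_def by simp
  qed
  ultimately have "resolution_step P (inst_below i \<kappa>) p c \<mu> (inst_below (Suc i) \<kappa>')"
    unfolding resolution_step_def using p(1) origin(1)[of i] by blast
  moreover have "selectable P (inst_below i \<kappa> ! p)"
    unfolding p(2)
  proof (rule selectable_subst[OF _ _ selectable_satom])
    show wf: "wf_atom P (satom i)" using cs.wf_a .
    show "length bs = length (mode P (pred (satom i)))" if "bs \<in> block P (pred (satom i))" for bs
      using program(2) wf that by (auto simp: wf_program_def wf_atom_def)
  qed
  moreover have "simulates (Suc i) ({y. \<exists>x\<in>V. sub D i x = Var y} \<inter> (lvars (Suc i) \<union> bvars (Suc i))) \<kappa>'"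
    unfolding \<kappa>'_def
  proof (rule simulates_step[OF i(1) nl cs \<rho>0 sim fV _ Cc])
    show "set (occs (\<theta>0 x)) \<subseteq> bvars i \<union> C" if "x \<in> bvars i \<union> C" for x
      using cs.range_vars[of x] that sa(1) by (auto simp: C_def)
    show "K x = \<kappa> x" if "x \<in> V" for x using Kold that by simp
  qed (use KN KNi in \<open>auto simp: N_def\<close>)
  ultimately show ?thesis by blast
qed

text \<open>Under \<open>final i0\<close> the outputs on the left are typed, hence so are the inputs
  of \<open>a\<close>. Renaming the outputs of \<open>a\<close> away from \<open>F\<close> separates
  them from the instantiated inputs, which makes the single atom robustly typed.\<close>

lemma simulates_initially:
  assumes a: "(\<alpha>, a) \<in> S i0"
  obtains V \<kappa> where "simulates i0 V \<kappa>" "inst_below i0 \<kappa> = [subst_atom \<kappa> a]" "robustly_typed_query P id [subst_atom \<kappa> a]"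
proof -
  have wf: "wf_atom P a" using robust_labelledD(1)[OF robust_S a] .
  have disj: "ivars P a \<inter> ovars P a = {}" using robust_labelledD(4)[OF robust_S a] .
  have "distinct (lquery i0)" using invariant[of i0] by (simp add: distinct_map)
  moreover have "prefix \<alpha> l \<longleftrightarrow> (l, b) = (\<alpha>, a)" if "(l, b) \<in> S i0" for l b
    using robust_labelledD2(1,2)[OF robust_S a that] by auto
  ultimately have bl: "below i0 = [(\<alpha>, a)]" unfolding below_def using a by (intro filter_unique) auto
  have bv: "bvars i0 = avars a" "bovars i0 = ovars P a" by (simp_all add: bvars_def bovars_def bl)
  \<comment> \<open>The input variables of \<open>a\<close> count as external even if they occur in
    no atom on the left, so they receive their final values as well.\<close>
  define V where "V = lvars i0 \<union> ivars P a"
  have "lvars i0 \<inter> ovars P a = {}"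
  proof -
    have "avars b \<inter> ovars P a = {}" if b: "(l, b) \<in> S i0" "lx l \<alpha>" for l b
    proof -
      have "l \<noteq> \<alpha>" using b(2) by auto
      then show ?thesis using robust_labelledD2(3,4)[OF robust_S b(1) a] b(2) avars_io[OF robust_labelledD(1)[OF robust_S b(1)]] by auto
    qed
    then show ?thesis by (auto simp: lvars_def)
  qed
  then have Vo: "V \<inter> ovars P a = {}" using disj by (auto simp: V_def)
  have "finite (ovars P a)" using avars_io[OF wf] finite_avars[of a] by simp
  then obtain g where g: "inj_on g (ovars P a)" "g ` ovars P a \<inter> F = {}"
    using finite_F by (rule fresh_renaming)
  define \<kappa> where "\<kappa> x = (if x \<in> ovars P a then Var (g x) else final i0 x)" for x
  have bV: "bvars i0 - V = ovars P a" using Vo avars_io[OF wf] by (auto simp: bv V_def)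
  have VF: "set (occs (final i0 x)) \<subseteq> F" if "x \<in> V" for x
    using F_final[of i0 x] i0N1 that avars_io[OF wf] by (auto simp: V_def bv)
  have \<kappa>V: "\<kappa> x = final i0 x" if "x \<in> V" for x using that Vo by (auto simp: \<kappa>_def)
  have sim: "simulates i0 V \<kappa>"
    unfolding simulates_def bV
  proof (intro conjI ballI impI)
    show "V \<subseteq> lvars i0 \<union> bvars i0" using avars_io[OF wf] by (auto simp: V_def bv)
    show "\<exists>z. \<kappa> x = Var z \<and> z \<notin> F" if "x \<in> ovars P a" for x using that g(2) by (auto simp: \<kappa>_def)
    show "inj_on \<kappa> (ovars P a)" using g(1) by (auto simp: \<kappa>_def inj_on_def)
  qed (use Vo VF \<kappa>V in \<open>auto simp: V_def bv\<close>)
  define a' where "a' = subst_atom \<kappa> a"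
  have ren: "renames \<kappa> (ovars P a)" using g(1) by (auto simp: renames_def \<kappa>_def inj_on_def)
  have wf': "wf_atom P a'" using wf by (simp add: a'_def)
  have pl: "plin (out_pos P (pred a')) (args a')"
    using rename_plin[OF ren[unfolded ovars_def] robust_labelledD(2)[OF robust_S a]] args_subst_nth(2)[OF wf]
    unfolding a'_def pred_subst_atom by blast
  have io: "ivars P a' \<inter> ovars P a' = {}"
  proof -
    have "ivars P a' \<subseteq> F" using VF \<kappa>V unfolding a'_def ivars_subst[OF wf] by (auto simp: V_def)
    moreover have "ovars P a' \<inter> F = {}" using g(2) unfolding a'_def ovars_subst[OF wf] by (auto simp: \<kappa>_def)
    ultimately show ?thesis by blast
  qed
  have "inputs_typed P (subst_atom (final i0) a)"
    using robust_labelledD(5)[OF robust_S a] left_outputs_typed[OF i0N1] by blast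
  moreover have "args a' ! k = args (subst_atom (final i0) a) ! k" if "k \<in> in_pos P (pred a)" for k
    unfolding a'_def args_subst_nth(1)[OF wf that] using ivars_nth[OF that] disj
    by (intro subst_trm_cong) (auto simp: \<kappa>_def)
  ultimately have it: "inputs_typed P a'" unfolding inputs_typed_def a'_def by simp
  have "robustly_typed_query P id [a']"
    unfolding robustly_typed_query_def
  proof (intro conjI ballI)
    show "nicely_moded_query P id [a']"
      using linear_outputs[OF wf'] pl io vars_inputs[OF wf'] vars_outputs[OF wf']
      by (simp add: nicely_moded_query_def nth1_def)
    show "well_typed_query P id [a']"
      using inputs_typed_subst[OF program(2) wf' it] by (simp add: well_typed_query_def nth1_def)
    show "id permutes {1..length [a']}" by (rule permutes_id)
    fix b k assume "b \<in> set [a']" "k \<in> out_pos P (pred b)"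
    then have b: "b = a'" and k: "k \<in> out_pos P (pred a)" by (auto simp: a'_def)
    show "robust_position P b k"
      unfolding b a'_def
      by (rule rename_robust_position[OF renames_subset[OF ren ovars_nth[OF k]] robust_labelledD(3)[OF robust_S a k]
            args_subst_nth(2)[OF wf k]])
  qed (use wf' in \<open>simp add: wf_query_def\<close>)
  moreover have "inst_below i0 \<kappa> = [a']" by (simp add: inst_below_def bl a'_def)
  ultimately show ?thesis using that sim unfolding a'_def by blast
qed

lemma not_robust:
  assumes a: "(\<alpha>, a) \<in> S i0" and inf_below: "infinite {i. prefix \<alpha> (slab i)}"
  shows "\<not> robust P (pred a)"
proof
  assume rob: "robust P (pred a)"
  obtain V0 \<kappa>0 where init: "simulates i0 V0 \<kappa>0" "inst_below i0 \<kappa>0 = [subst_atom \<kappa>0 a]"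
    "robustly_typed_query P id [subst_atom \<kappa>0 a]" using simulates_initially[OF a] by blast
  define step' where "step' n R R' \<longleftrightarrow> (if prefix \<alpha> (slab (i0 + n))
      then \<exists>p c \<mu>. resolution_step P R p c \<mu> R' \<and> selectable P (R ! p) else R' = R)" for n R R'
  have "\<exists>q. \<forall>n. (simulates (i0 + n) (fst (q n)) (snd (q n)) \<and> (n = 0 \<longrightarrow> q n = (V0, \<kappa>0))) \<and>
    step' n (inst_below (i0 + n) (snd (q n))) (inst_below (i0 + Suc n) (snd (q (Suc n))))"
  proof (rule dependent_nat_choice)
    show "\<exists>q. simulates (i0 + 0) (fst q) (snd q) \<and> ((0::nat) = 0 \<longrightarrow> q = (V0, \<kappa>0))" using init(1) by auto
    fix q n assume q: "simulates (i0 + n) (fst q) (snd q) \<and> (n = 0 \<longrightarrow> q = (V0, \<kappa>0))"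
    have i: "i0 \<le> i0 + n" by simp
    have "\<exists>V' \<kappa>'. simulates (Suc (i0 + n)) V' \<kappa>' \<and> step' n (inst_below (i0 + n) (snd q)) (inst_below (Suc (i0 + n)) \<kappa>')"
      using region[OF i slab_lab] step_left[OF i _ conjunct1[OF q]] step_right[OF i _ conjunct1[OF q]]
        step_below[OF i _ conjunct1[OF q]] lx_not_prefix unfolding step'_def by (metis (full_types))
    then show "\<exists>q'. (simulates (i0 + Suc n) (fst q') (snd q') \<and> (Suc n = 0 \<longrightarrow> q' = (V0, \<kappa>0))) \<and>
      step' n (inst_below (i0 + n) (snd q)) (inst_below (i0 + Suc n) (snd q'))" by auto
  qed
  then obtain q where q: "q 0 = (V0, \<kappa>0)"
    "\<And>n. step' n (inst_below (i0 + n) (snd (q n))) (inst_below (i0 + Suc n) (snd (q (Suc n))))" by blast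
  define R where "R n = inst_below (i0 + n) (snd (q n))" for n
  have st: "step' n (R n) (R (Suc n))" for n using q(2) by (simp add: R_def)
  define A where "A = {n. prefix \<alpha> (slab (i0 + n))}"
  have "infinite A"
  proof
    assume "finite A"
    moreover have "{i. prefix \<alpha> (slab i)} \<subseteq> (\<lambda>n. i0 + n) ` A"
    proof
      fix i assume "i \<in> {i. prefix \<alpha> (slab i)}"
      then have p: "prefix \<alpha> (slab i)" by simp
      \<comment> \<open>By \<open>gone\<close>, a step below \<open>\<alpha>\<close> before
        \<open>i0\<close> would exclude \<open>\<alpha>\<close> from stage
        \<open>i0\<close>.\<close>
      then have "i0 \<le> i" using gone[of i i0 \<alpha>] node by (meson not_le)
      then show "i \<in> (\<lambda>n. i0 + n) ` A" using p by (intro image_eqI[of _ _ "i - i0"]) (auto simp: A_def)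
    qed
    ultimately show False using inf_below finite_subset by blast
  qed
  then obtain e where e: "\<And>n. e n \<in> A" "R (e 0) = R 0" "\<And>n. R (e (Suc n)) = R (Suc (e n))"
    by (rule skip_idle_steps[of A R]) (use st in \<open>auto simp: step'_def A_def\<close>)
  have "\<exists>p c \<mu>. resolution_step P (R (e n)) p c \<mu> (R (e (Suc n))) \<and> selectable P (R (e n) ! p)" for n
    using st[of "e n"] e(1)[of n] e(3)[of n] by (simp add: step'_def A_def)
  then obtain p c \<mu> where D': "\<And>n. resolution_step P (R (e n)) (p n) (c n) (\<mu> n) (R (e (Suc n)))"
    "\<And>n. selectable P (R (e n) ! p n)" by metis
  define D' where "D' = \<lparr>steps = \<infinity>, qry = (\<lambda>n. R (e n)), sel = p, cls = c, sub = \<mu>\<rparr>"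
  have "R (e 0) = [subst_atom \<kappa>0 a]" using e(2) init(2) q(1) by (simp add: R_def)
  then have "delay_respecting P [subst_atom \<kappa>0 a] D'"
    using D' by (simp add: delay_respecting_def derivation_def D'_def)
  then have "finite_derivation D'" using rob init(3) unfolding robust_def by (metis pred_subst_atom)
  then show False by (simp add: finite_derivation_def D'_def)
qed

end

theorem theorem5p18:
  fixes P P' :: "('p, 'f, 'v::infinite) program"
    and Q Q' :: "('p, 'f, 'v) query"
    and \<rho> :: "('p, 'f, 'v) clause \<Rightarrow> nat \<Rightarrow> nat"
    and \<pi> :: "nat \<Rightarrow> nat"
  assumes "well_fed_program \<rho> P"
    and "well_fed_query P \<pi> Q"
    and "corresponding_program \<rho> P P'"
    and "corresponding_query P \<pi> Q Q'"
    and "\<forall>D. LD_derivation P' Q' D \<longrightarrow> finite_derivation D"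
  shows "\<forall>D. left_based P Q D \<longrightarrow> finite_derivation D"
proof (intro allI impI, rule ccontr)
  fix D assume D: "left_based P Q D" "\<not> finite_derivation D"
  interpret left_based_run P \<rho> \<pi> Q D
    by unfold_locales (use assms D in \<open>simp_all add: finite_derivation_def\<close>)
  have P': "clauses P' = (\<lambda>c. Clause (head c) (permute (\<rho> c) (body c))) ` clauses P"
    using assms(3) by (simp add: corresponding_program_def)
  have Q': "Q' = permute \<pi> Q" using assms(4) by (simp add: corresponding_query_def)
  show False
  proof (cases "\<forall>n. resolved n")
    case True
    then obtain D' where "LD_derivation P' Q' D'" "steps D' = \<infinity>"
      using infinite_LD_derivation[OF P'] Q' by blast
    then show False using assms(5) by (auto simp: finite_derivation_def)
  next
    case False
    then obtain n where "\<not> resolved n" by blast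
    then obtain \<alpha> a i0 where \<alpha>: "(\<alpha>, a) \<in> S i0" "robust P (pred a)"
      "infinite {i. prefix \<alpha> (slab i)}" "finite {i. lx (slab i) \<alpha>}" by (rule active_unsafe_node)
    \<comment> \<open>\<open>Suc\<close> makes the bound strict, and \<open>i0\<close> keeps the set
      nonempty and the bound beyond the creation of \<open>\<alpha>\<close>.\<close>
    define N1 where "N1 = Max (insert i0 (Suc ` {i. lx (slab i) \<alpha>}))"
    have N1: "m \<le> N1" if "m = i0 \<or> m \<in> Suc ` {i. lx (slab i) \<alpha>}" for m
      unfolding N1_def using that \<alpha>(4) by (intro Max_ge) auto
    obtain \<eta> where \<eta>: "\<forall>(l, b)\<in>S N1. outputs_typed P (subst_atom \<eta> b)"
      using outputs_typable[OF program(2) robust_S] by blast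
    interpret node_run P \<rho> \<pi> Q D \<alpha> i0 N1 \<eta>
    proof unfold_locales
      show "\<alpha> \<in> lab i0" using \<alpha>(1) lab_iff by blast
      show "i0 \<le> N1" using N1 by simp
      show "i < N1" if "lx (slab i) \<alpha>" for i using N1[of "Suc i"] that by (simp add: Suc_le_eq)
      show "outputs_typed P (subst_atom \<eta> b)" if "(l, b) \<in> S N1" for l b using \<eta> that by blast
    qed
    show False using not_robust[OF \<alpha>(1,3)] \<alpha>(2) by blast
  qed
qed

end
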